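(* Let $\mathbf z_1,\dots,\mathbf z_n$ be a random sample from the distribution of a random vector $\mathbf z\in\mathbb R^p$ with mutually independent components having mean $0$ and variance $1$. Notation is as in the context. (i) Suppose $\mathbf z$ has finite sixth moments and at most one of $\gamma_1,\dots,\gamma_p$ is zero. Then there exists a sequence of symmetric projection pursuit solutions $\hat{\mathbf W}$ based on skewness (that is, $\alpha=1$) such that $\hat{\mathbf W}\to_P\mathbf I_p$ and $$\sqrt n(\hat w_{kk}-1)=-\tfrac12\sqrt n(\hat s_{kk}-1)+o_P(1),\qquad \sqrt n\,\hat w_{kl}=\frac{\sqrt n\,\hat\psi_{1kl}}{\gamma_k^2+\gamma_l^2}+o_P(1),\quad l\ne k,$$ where $\hat\psi_{1kl}=\gamma_k\hat r_{kl}-\gamma_l\hat r_{lk}-\gamma_k^2\hat s_{kl}$. (ii) Suppose $\mathbf z$ has finite eighth moments and at most one of $\kappa_1,\dots,\kappa_p$ is zero. Then there exists a sequence of symmetric projection pursuit solutions $\hat{\mathbf W}$ based on kurtosis (that is, $\alpha=0$) such that $\hat{\mathbf W}\to_P\mathbf I_p$ and $$\sqrt n(\hat w_{kk}-1)=-\tfrac12\sqrt n(\hat s_{kk}-1)+o_P(1),\qquad \sqrt n\,\hat w_{kl}=\frac{\sqrt n\,\hat\psi_{2kl}}{\kappa_k^2+\kappa_l^2}+o_P(1),\quad l\ne k,$$ where $\hat\psi_{2kl}=\kappa_k\hat q_{kl}-\kappa_l\hat q_{lk}-(\kappa_k\beta_k-3\kappa_l)\hat s_{kl}$. (iii) Suppose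 $\mathbf z$ has finite eighth moments and $\gamma_k=\kappa_k=0$ for at most one $k$. Then there exists a sequence of symmetric projection pursuit solutions $\hat{\mathbf W}$ based on both skewness and kurtosis such that $\hat{\mathbf W}\to_P\mathbf I_p$ and $$\sqrt n(\hat w_{kk}-1)=-\tfrac12\sqrt n(\hat s_{kk}-1)+o_P(1),$$ $$\sqrt n\,\hat w_{kl}=\frac{3\alpha\sqrt n\,\hat\psi_{1kl}+4(1-\alpha)\sqrt n\,\hat\psi_{2kl}}{3\alpha(\gamma_k^2+\gamma_l^2)+4(1-\alpha)(\kappa_k^2+\kappa_l^2)}+o_P(1),\quad l\neq k,$$ where $\alpha\in[0,1]$ is the weight given to skewness, and $\hat\psi_{1kl}$ and $\hat\psi_{2kl}$ are as in (i) and (ii).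
   Context: Moments: $\gamma_k=E(z_k^3)$, $\beta_k=E(z_k^4)$, $\kappa_k=\beta_k-3$, where $z_k$ is the $k$th component of $\mathbf z$. Write $\mathbf z_i=(z_{i1},\dots,z_{ip})^T$ and $$\hat s_{kl}=\frac1n\sum_{i=1}^n z_{ik}z_{il},\quad \hat r_{kl}=\frac1n\sum_{i=1}^n(z_{ik}^2-1)z_{il},\quad \hat q_{kl}=\frac1n\sum_{i=1}^n(z_{ik}^3-\gamma_k)z_{il}.$$ Symmetric projection pursuit estimate with weight $\alpha\in[0,1]$: let $\bar{\mathbf z}=\frac1n\sum_i\mathbf z_i$, $\hat{\boldsymbol\Sigma}=\frac1n\sum_i(\mathbf z_i-\bar{\mathbf z})(\mathbf z_i-\bar{\mathbf z})^T$ and $\mathbf y_i=\hat{\boldsymbol\Sigma}^{-1/2}(\mathbf z_i-\bar{\mathbf z})$ (symmetric positive definite root; $\hat{\boldsymbol\Sigma}$ is nonsingular with probability tending to one). A symmetric projection pursuit solution is $\hat{\mathbf W}=(\hat w_{kl})=\hat{\mathbf U}\hat{\boldsymbol\Sigma}^{-1/2}$, where $\hat{\mathbf U}$ maximizes over orthogonal matrices $\mathbf U=(\mathbf u_1,\dots,\mathbf u_p)^T$ the function $$\alpha\sum_{k=1}^p\Big(\frac1n\sum_{i=1}^n(\mathbf u_k^T\mathbf y_i)^3\Big)^2+(1-\alpha)\sum_{k=1}^p\Big(\frac1n\sum_{i=1}^n(\mathbf u_k^T\mathbf y_i)^4-3\Big)^2 .$$ (The maximizer is at best unique up to permutation and sign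 changes of the rows.) Limits are as $n\to\infty$.
   Formalization: In (iii), at most one γ_k is additionally assumed to be zero when α=1, and at most one κ_k when α=0; without this a denominator 3α(γ_k²+γ_l²)+4(1−α)(κ_k²+κ_l²) vanishes and the formula is undefined. *)

theory Defs
  imports "HOL-Probability.Probability"
begin

text \<open>Population moments of the components of a random vector.\<close>

definition gam :: "'a measure \<Rightarrow> ('a \<Rightarrow> real ^ 'p) \<Rightarrow> 'p \<Rightarrow> real" where
  "gam M z k = (LINT \<omega>|M. (z \<omega> $ k) ^ 3)"

definition bet :: "'a measure \<Rightarrow> ('a \<Rightarrow> real ^ 'p) \<Rightarrow> 'p \<Rightarrow> real" where
  "bet M z k = (LINT \<omega>|M. (z \<omega> $ k) ^ 4)"

definition kap :: "'a measure \<Rightarrow> ('a \<Rightarrow> real ^ 'p) \<Rightarrow> 'p \<Rightarrow> real" where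
  "kap M z k = bet M z k - 3"

text \<open>Sample quantities. A realized sample is a sequence \<open>x\<close>, and the sample of size \<open>n\<close>
  consists of \<open>x 0, \<dots>, x (n - 1)\<close>. In \<open>q_hat\<close>, the argument \<open>g\<close> is the vector of
  population third moments.\<close>

definition s_hat :: "(nat \<Rightarrow> real ^ 'p) \<Rightarrow> nat \<Rightarrow> 'p \<Rightarrow> 'p \<Rightarrow> real" where
  "s_hat x n k l = (\<Sum>i<n. x i $ k * x i $ l) / real n"

definition r_hat :: "(nat \<Rightarrow> real ^ 'p) \<Rightarrow> nat \<Rightarrow> 'p \<Rightarrow> 'p \<Rightarrow> real" where
  "r_hat x n k l = (\<Sum>i<n. ((x i $ k)\<^sup>2 - 1) * x i $ l) / real n"

definition q_hat :: "('p \<Rightarrow> real) \<Rightarrow> (nat \<Rightarrow> real ^ 'p) \<Rightarrow> nat \<Rightarrow> 'p \<Rightarrow> 'p \<Rightarrow> real" where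
  "q_hat g x n k l = (\<Sum>i<n. ((x i $ k) ^ 3 - g k) * x i $ l) / real n"

definition psi1_hat :: "('p \<Rightarrow> real) \<Rightarrow> (nat \<Rightarrow> real ^ 'p) \<Rightarrow> nat \<Rightarrow> 'p \<Rightarrow> 'p \<Rightarrow> real" where
  "psi1_hat g x n k l =
     g k * r_hat x n k l - g l * r_hat x n l k - (g k)\<^sup>2 * s_hat x n k l"

definition psi2_hat ::
  "('p \<Rightarrow> real) \<Rightarrow> ('p \<Rightarrow> real) \<Rightarrow> ('p \<Rightarrow> real) \<Rightarrow> (nat \<Rightarrow> real ^ 'p) \<Rightarrow> nat \<Rightarrow> 'p \<Rightarrow> 'p \<Rightarrow> real" where
  "psi2_hat g b \<kappa> x n k l =
     \<kappa> k * q_hat g x n k l - \<kappa> l * q_hat g x n l k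
       - (\<kappa> k * b k - 3 * \<kappa> l) * s_hat x n k l"

definition sample_mean :: "(nat \<Rightarrow> real ^ 'p) \<Rightarrow> nat \<Rightarrow> real ^ 'p" where
  "sample_mean x n = (1 / real n) *\<^sub>R (\<Sum>i<n. x i)"

definition sample_cov :: "(nat \<Rightarrow> real ^ 'p) \<Rightarrow> nat \<Rightarrow> real ^ 'p ^ 'p" where
  "sample_cov x n =
     (\<chi> k l. (\<Sum>i<n. (x i - sample_mean x n) $ k * (x i - sample_mean x n) $ l) / real n)"

definition pos_def_matrix :: "real ^ 'p ^ 'p \<Rightarrow> bool" where
  "pos_def_matrix A \<longleftrightarrow> transpose A = A \<and> (\<forall>v. v \<noteq> 0 \<longrightarrow> v \<bullet> (A *v v) > 0)"

text \<open>The symmetric positive definite square root; it is meaningful for positive definite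
  arguments only.\<close>

definition mat_sqrt :: "real ^ 'p ^ 'p \<Rightarrow> real ^ 'p ^ 'p" where
  "mat_sqrt A = (THE R. pos_def_matrix R \<and> R ** R = A)"

definition mat_inv_sqrt :: "real ^ 'p ^ 'p \<Rightarrow> real ^ 'p ^ 'p" where
  "mat_inv_sqrt A = matrix_inv (mat_sqrt A)"

definition whitened :: "(nat \<Rightarrow> real ^ 'p) \<Rightarrow> nat \<Rightarrow> nat \<Rightarrow> real ^ 'p" where
  "whitened x n i = mat_inv_sqrt (sample_cov x n) *v (x i - sample_mean x n)"

definition spp_objective ::
  "real \<Rightarrow> (nat \<Rightarrow> real ^ 'p) \<Rightarrow> nat \<Rightarrow> real ^ 'p ^ 'p \<Rightarrow> real" where
  "spp_objective \<alpha> x n U =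
     \<alpha> * (\<Sum>k\<in>UNIV. ((\<Sum>i<n. (row k U \<bullet> whitened x n i) ^ 3) / real n)\<^sup>2)
     + (1 - \<alpha>) * (\<Sum>k\<in>UNIV. ((\<Sum>i<n. (row k U \<bullet> whitened x n i) ^ 4) / real n - 3)\<^sup>2)"

definition is_spp_solution ::
  "real \<Rightarrow> (nat \<Rightarrow> real ^ 'p) \<Rightarrow> nat \<Rightarrow> real ^ 'p ^ 'p \<Rightarrow> bool" where
  "is_spp_solution \<alpha> x n W \<longleftrightarrow>
     (\<exists>U. is_arg_max (spp_objective \<alpha> x n) orthogonal_matrix U
        \<and> W = U ** mat_inv_sqrt (sample_cov x n))"

text \<open>A sequence of solutions consists of random matrices. The estimate is defined only where
  the sample covariance matrix is nonsingular; elsewhere (an event whose probability tends to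
  zero in the setting of interest) its value is unconstrained.\<close>

definition spp_solution_seq ::
  "'a measure \<Rightarrow> real \<Rightarrow> (nat \<Rightarrow> 'a \<Rightarrow> real ^ 'p) \<Rightarrow> (nat \<Rightarrow> 'a \<Rightarrow> real ^ 'p ^ 'p) \<Rightarrow> bool" where
  "spp_solution_seq M \<alpha> Z W \<longleftrightarrow>
     (\<forall>n. W n \<in> borel_measurable M \<and>
        (\<forall>\<omega>\<in>space M. invertible (sample_cov (\<lambda>i. Z i \<omega>) n) \<longrightarrow>
           is_spp_solution \<alpha> (\<lambda>i. Z i \<omega>) n (W n \<omega>)))"

text \<open>Measurability is part of the definition because \<open>measure\<close> is \<open>0\<close> on
  nonmeasurable sets.\<close>

definition conv_in_prob ::
  "'a measure \<Rightarrow> (nat \<Rightarrow> 'a \<Rightarrow> 'b :: metric_space) \<Rightarrow> 'b \<Rightarrow> bool" where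
  "conv_in_prob M X c \<longleftrightarrow>
     (\<forall>n. X n \<in> borel_measurable M) \<and>
     (\<forall>\<epsilon>>0. (\<lambda>n. measure M {\<omega> \<in> space M. dist (X n \<omega>) c > \<epsilon>}) \<longlonglongrightarrow> 0)"

text \<open>\<open>X = Y + o\<^sub>P(1)\<close>\<close>

definition eq_up_to_oP ::
  "'a measure \<Rightarrow> (nat \<Rightarrow> 'a \<Rightarrow> real) \<Rightarrow> (nat \<Rightarrow> 'a \<Rightarrow> real) \<Rightarrow> bool" where
  "eq_up_to_oP M X Y \<longleftrightarrow> conv_in_prob M (\<lambda>n \<omega>. X n \<omega> - Y n \<omega>) 0"

end

theory Submission
  imports Defs "HOL-Library.Landau_Symbols"
begin

text \<open>
  Skewness and kurtosis criteria are treated at once. By Cauchy--Schwarz against each row, the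
  population objective at an orthogonal matrix is at most its value at the identity, and the
  moment condition forces every maximizer to be a signed permutation matrix. The sample objective
  is invariant under signed permutations of rows and close to the population objective, uniformly
  over the orthogonal group, when the sample moments are close to the population moments; hence the
  sample maximizer nearest to the identity tends to the identity. Rotating two of its rows gives the
  first-order conditions, which together with \<open>W S W\<^sup>T = I\<close> (with \<open>S\<close> the sample covariance) are
  linearized at the identity. All of this is deterministic, with a remainder quadratic in the
  deviation \<open>\<delta>\<close> of the sample moments. Since \<open>\<delta>\<^sup>2\<close> has expectation \<open>O(1/n)\<close>, the remainder is
  \<open>o\<^sub>P(n\<^sup>-\<^sup>1\<^sup>/\<^sup>2)\<close> by Markov's inequality. Fourth sample moments are controlled by eighth moments
  and third sample moments by sixth moments, and the latter suffice when \<open>\<alpha> = 1\<close>.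
\<close>

section \<open>Inverse square roots of positive definite matrices\<close>

text \<open>Two obstacles shape the proof. First, the linearized equations have errors quadratic
  both in the moment deviations and in \<open>W - I\<close>, and consistency gives no rate for the
  latter. Errors are therefore measured by a gauge containing both quantities; after the equations
  are solved, the quadratic error is absorbed by the gauge, which turns out to be of the order of
  the moment deviations alone. Linearizing in \<open>W = U S^(-1/2)\<close> instead of
  \<open>U\<close> keeps the first-order conditions and the constraint polynomial in
  \<open>W\<close> and the centered moments, so the matrix root is never differentiated. Second,
  convergence in probability is asserted for random matrices, so the maximizer nearest to the
  identity has to be chosen measurably. It is selected from a random compact set by successive
  minimization, and the inverse root, given by a definite description, is shown to be Borel through
  its graph. Uniformity in the sample, its size and the matrix is carried by Landau symbols along a
  filter on such triples.\<close>

lemma self_adjoint_eigenvector: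
  fixes f :: "'a::euclidean_space \<Rightarrow> 'a"
  assumes "linear f" and sa: "\<And>x y. f x \<bullet> y = x \<bullet> f y"
    and S: "subspace S" "f ` S \<subseteq> S" "S \<noteq> {0}"
  shows "\<exists>v\<in>S. \<exists>c. norm v = 1 \<and> f v = c *\<^sub>R v"
proof -
  interpret f: linear f by fact
  have cont: "continuous_on X f" for X
    using \<open>linear f\<close> linear_continuous_on linear_conv_bounded_linear by blast
  obtain w where w: "w \<in> S" "w \<noteq> 0"
    using S subspace_0 by blast
  have comp: "compact (S \<inter> sphere 0 1)"
    using closed_subspace[OF S(1)] by (simp add: closed_Int_compact)
  have "w /\<^sub>R norm w \<in> S \<inter> sphere 0 1"
    using w S(1) by (simp add: subspace_mul)
  then obtain v where v: "v \<in> S" "norm v = 1"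
    and max: "\<And>x. x \<in> S \<Longrightarrow> norm x = 1 \<Longrightarrow> x \<bullet> f x \<le> v \<bullet> f v"
    using continuous_attains_sup[OF comp _ continuous_on_inner[OF continuous_on_id cont]]
    by fastforce
  define c where "c = v \<bullet> f v"
  have le: "x \<bullet> f x \<le> c * (x \<bullet> x)" if "x \<in> S" for x
  proof (cases "x = 0")
    case False
    have "(x /\<^sub>R norm x) \<bullet> f (x /\<^sub>R norm x) \<le> c"
      unfolding c_def using False that S(1) by (intro max) (simp_all add: subspace_mul)
    then show ?thesis
      using False by (simp add: f.scaleR dot_square_norm field_simps power2_eq_square)
  qed (simp add: f.zero)
  have orth: "w \<bullet> f v = 0" if w: "w \<in> S" "w \<bullet> v = 0" for w
  proof -
    \<comment> \<open>\<open>b\<close> is the slack of \<open>w\<close> in \<open>le\<close>.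
      Applying \<open>le\<close> to \<open>v + t w\<close> leaves a linear term \<open>2 t a\<close>
      dominated by \<open>t\<^sup>2 b\<close> for every \<open>t\<close>, which forces
      \<open>a = 0\<close>.\<close>
    define a b where "a = w \<bullet> f v" and "b = c * (w \<bullet> w) - w \<bullet> f w"
    have b: "b \<ge> 0" using le[OF w(1)] by (simp add: b_def)
    have "2 * t * a \<le> t\<^sup>2 * b" for t
    proof -
      have "(v + t *\<^sub>R w) \<bullet> f (v + t *\<^sub>R w) \<le> c * ((v + t *\<^sub>R w) \<bullet> (v + t *\<^sub>R w))"
        using v w S(1) by (intro le) (simp add: subspace_add subspace_mul)
      moreover have "v \<bullet> f w = a"
        unfolding a_def sa[symmetric, of v w] by (rule inner_commute)
      moreover have "v \<bullet> w = 0" "v \<bullet> v = 1"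
        using w(2) v(2) by (simp_all add: inner_commute dot_square_norm)
      moreover have "(v + t *\<^sub>R w) \<bullet> f (v + t *\<^sub>R w)
          = v \<bullet> f v + t * (w \<bullet> f v) + (t * (v \<bullet> f w) + t * (t * (w \<bullet> f w)))"
        by (simp only: f.add f.scaleR inner_add_left inner_add_right inner_scaleR_left inner_scaleR_right distrib_left)
      moreover have "(v + t *\<^sub>R w) \<bullet> (v + t *\<^sub>R w)
          = v \<bullet> v + t * (w \<bullet> v) + (t * (v \<bullet> w) + t * (t * (w \<bullet> w)))"
        by (simp only: inner_add_left inner_add_right inner_scaleR_left inner_scaleR_right distrib_left)
      ultimately have "c + t * a + (t * a + t * (t * (w \<bullet> f w))) \<le> c * (1 + t * (t * (w \<bullet> w)))"
        by (simp only: w(2) a_def[symmetric] c_def[symmetric] mult_zero_right add_0_right add_0_left)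
      then show ?thesis
        unfolding b_def power2_eq_square by (simp add: algebra_simps)
    qed
    \<comment> \<open>For \<open>t = a / (b + 1)\<close> the linear term wins unless
      \<open>a = 0\<close>; the \<open>+ 1\<close> avoids a division by zero when
      \<open>b = 0\<close>.\<close>
    from mult_right_mono[OF this[of "a / (b + 1)"], of "(b + 1) * (b + 1)"]
    have "2 * a\<^sup>2 * (b + 1) \<le> a\<^sup>2 * b"
      using b by (simp add: power2_eq_square power_divide)
    then have "a\<^sup>2 * (b + 2) \<le> 0" by (simp add: algebra_simps)
    then show ?thesis using b by (simp add: mult_le_0_iff a_def[symmetric])
  qed
  \<comment> \<open>The residual lies in \<open>S\<close> and is orthogonal to \<open>v\<close>, so
    \<open>orth\<close> makes it orthogonal to \<open>f v\<close> as well, hence to itself.\<close>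
  define u where "u = f v - c *\<^sub>R v"
  have "u \<in> S" using v S by (auto simp: u_def intro!: subspace_diff subspace_mul)
  moreover have uv: "u \<bullet> v = 0"
    using v by (simp add: u_def inner_diff_left c_def dot_square_norm inner_commute[of "f v" v])
  ultimately have "u \<bullet> u = 0"
    using orth[of u] by (simp add: u_def inner_diff_right)
  then show ?thesis using v u_def by auto
qed

text \<open>Induction on the dimension: the complement of an eigenvector inside \<open>S\<close> is
  again invariant because \<open>f\<close> is self-adjoint, and it is strictly smaller.\<close>

lemma self_adjoint_eigenbasis:
  fixes f :: "'a::euclidean_space \<Rightarrow> 'a"
  assumes "linear f" and sa: "\<And>x y. f x \<bullet> y = x \<bullet> f y"
  assumes "subspace S" "f ` S \<subseteq> S"
  shows "\<exists>B c. finite B \<and> pairwise orthogonal B \<and> (\<forall>b\<in>B. norm b = 1 \<and> f b = c b *\<^sub>R b) \<and> span B = S"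
  using assms(3,4)
proof (induction "dim S" arbitrary: S rule: less_induct)
  case less
  interpret f: linear f by fact
  show ?case
  proof (cases "S = {0}")
    case True
    then show ?thesis by (intro exI[of _ "{}"]) (simp add: pairwise_def)
  next
    case False
    obtain v k where v: "v \<in> S" "norm v = 1" "f v = k *\<^sub>R v"
      using self_adjoint_eigenvector[OF assms(1) sa less.prems False] by blast
    define T where "T = {x\<in>S. x \<bullet> v = 0}"
    have T: "subspace T"
      using less.prems(1) by (auto simp: T_def subspace_def inner_add_left)
    have fT: "f ` T \<subseteq> T"
      using less.prems(2) v by (auto simp: T_def sa)
    have "v \<notin> T" using v by (auto simp: T_def dot_square_norm)
    then have "T \<subset> S" using v(1) unfolding T_def by blast
    then have "dim T < dim S"
      using T less.prems(1) by (metis dim_psubset span_eq_iff)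
    from less.hyps[OF this T fT] obtain B c where B: "finite B" "pairwise orthogonal B"
      "\<forall>b\<in>B. norm b = 1 \<and> f b = c b *\<^sub>R b" "span B = T" by blast
    have BT: "B \<subseteq> T" using B(4) span_superset by blast
    then have vB: "v \<notin> B" using \<open>v \<notin> T\<close> by blast
    have "span (insert v B) = S"
    proof
      show "span (insert v B) \<subseteq> S"
        using BT v(1) less.prems(1) by (intro span_minimal) (auto simp: T_def)
      show "S \<subseteq> span (insert v B)"
      proof
        fix x assume x: "x \<in> S"
        have "x - (x \<bullet> v) *\<^sub>R v \<in> T"
          using x v less.prems(1) by (auto simp: T_def subspace_diff subspace_mul inner_diff_left dot_square_norm)
        then show "x \<in> span (insert v B)"
          using B(4) by (subst span_insert) auto
      qed
    qed
    moreover have "pairwise orthogonal (insert v B)"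
      using B(2) BT vB by (auto simp: pairwise_insert T_def orthogonal_def inner_commute)
    moreover have "\<forall>b\<in>insert v B. norm b = 1 \<and> f b = (c(v := k)) b *\<^sub>R b"
      using B(3) v vB by auto
    ultimately show ?thesis using B(1) by (intro exI[of _ "insert v B"] exI[of _ "c(v := k)"]) simp
  qed
qed

lemma symmetric_matrix_iff:
  fixes A :: "real ^ 'n ^ 'n"
  shows "transpose A = A \<longleftrightarrow> (\<forall>x y. (A *v x) \<bullet> y = x \<bullet> (A *v y))"
proof -
  have "transpose A = A \<longleftrightarrow> (\<forall>x. transpose A *v x = A *v x)"
    by (simp add: matrix_eq)
  also have "\<dots> \<longleftrightarrow> (\<forall>x y. (transpose A *v x) \<bullet> y = (A *v x) \<bullet> y)"
    by (metis vector_eq_rdot)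
  finally show ?thesis by (metis dot_lmul_matrix transpose_matrix_vector)
qed

lemma pos_def_matrix_inner:
  assumes "pos_def_matrix A"
  shows "(A *v x) \<bullet> y = x \<bullet> (A *v y)"
  using assms by (simp add: pos_def_matrix_def symmetric_matrix_iff)

lemma symmetric_matrix_eigenbasis:
  fixes A :: "real ^ 'n ^ 'n"
  assumes "transpose A = A"
  obtains B c where "finite B" "pairwise orthogonal B" "\<And>b. b \<in> B \<Longrightarrow> norm b = 1"
    "\<And>b. b \<in> B \<Longrightarrow> A *v b = c b *\<^sub>R b" "span B = UNIV"
  using self_adjoint_eigenbasis[OF matrix_vector_mul_linear[of A], of UNIV] assms
  by (fastforce simp: symmetric_matrix_iff)

lemma matrix_eq_on_spanning:
  fixes A C :: "real ^ 'n ^ 'm"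
  assumes "span B = UNIV" "\<And>b. b \<in> B \<Longrightarrow> A *v b = C *v b"
  shows "A = C"
  unfolding matrix_eq
  using linear_eq_on_span[OF matrix_vector_mul_linear matrix_vector_mul_linear assms(2)] assms(1) by blast

lemma pos_def_sqrt_exists:
  fixes A :: "real ^ 'n ^ 'n"
  assumes "pos_def_matrix A"
  shows "\<exists>R. pos_def_matrix R \<and> R ** R = A"
proof -
  obtain B c where B: "finite B" "pairwise orthogonal B" "\<And>b. b \<in> B \<Longrightarrow> norm b = 1"
    "\<And>b. b \<in> B \<Longrightarrow> A *v b = c b *\<^sub>R b" "span B = UNIV"
    using symmetric_matrix_eigenbasis assms unfolding pos_def_matrix_def by metis
  have c: "c b > 0" if "b \<in> B" for b
  proof -
    have "b \<noteq> 0" using B(3)[OF that] by auto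
    then have "b \<bullet> (A *v b) > 0" using assms unfolding pos_def_matrix_def by blast
    then show ?thesis using B(3,4)[OF that] by (simp add: dot_square_norm)
  qed
  have inner: "a \<bullet> b = (if a = b then 1 else 0)" if "a \<in> B" "b \<in> B" for a b
    using B(2,3) that by (auto simp: pairwise_def orthogonal_def dot_square_norm)
  \<comment> \<open>\<open>f\<close> multiplies each eigenvector by the root of its eigenvalue.
    Written as a sum over the orthonormal eigenbasis, it shows its symmetry and positivity without a
    change of basis.\<close>
  define f where "f x = (\<Sum>b\<in>B. (sqrt (c b) * (x \<bullet> b)) *\<^sub>R b)" for x
  have "linear f"
    by (rule linearI) (simp_all add: f_def inner_add_left algebra_simps sum.distrib scaleR_sum_right)
  define R where "R = matrix f"
  have Rf: "R *v x = f x" for x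
    unfolding R_def using \<open>linear f\<close> by (simp add: matrix_works)
  have Rb: "R *v b = sqrt (c b) *\<^sub>R b" if "b \<in> B" for b
  proof -
    have "R *v b = (\<Sum>a\<in>B. if a = b then sqrt (c b) *\<^sub>R b else 0)"
      unfolding Rf f_def using that by (intro sum.cong) (auto simp: inner)
    then show ?thesis using B(1) that by simp
  qed
  have "transpose R = R"
    unfolding symmetric_matrix_iff Rf f_def
    by (simp add: inner_sum_left inner_sum_right algebra_simps inner_commute)
  moreover have "x \<bullet> (R *v x) > 0" if "x \<noteq> 0" for x
  proof -
    have eq: "x \<bullet> (R *v x) = (\<Sum>b\<in>B. sqrt (c b) * (x \<bullet> b)\<^sup>2)"
      unfolding Rf f_def by (simp add: inner_sum_right power2_eq_square algebra_simps)
    have nn: "\<And>b. b \<in> B \<Longrightarrow> 0 \<le> sqrt (c b) * (x \<bullet> b)\<^sup>2" using c by (simp add: less_imp_le)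
    \<comment> \<open>A vector orthogonal to all of \<open>B\<close> is orthogonal to the span of
      \<open>B\<close>, hence to itself.\<close>
    have "\<exists>b\<in>B. x \<bullet> b \<noteq> 0"
    proof (rule ccontr)
      assume "\<not> (\<exists>b\<in>B. x \<bullet> b \<noteq> 0)"
      then have "orthogonal x x"
        using B(5) orthogonal_to_span[of x B x] by (simp add: orthogonal_def)
      then show False using that by (simp add: orthogonal_def)
    qed
    then obtain b where "b \<in> B" "x \<bullet> b \<noteq> 0" by blast
    then have "0 < sqrt (c b) * (x \<bullet> b)\<^sup>2" using c by simp
    then show ?thesis unfolding eq using B(1) nn \<open>b \<in> B\<close> by (meson sum_pos2)
  qed
  moreover have "R ** R = A"
    using B(5)
  proof (rule matrix_eq_on_spanning)
    fix b assume b: "b \<in> B"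
    have "(R ** R) *v b = R *v (R *v b)" by (simp add: matrix_vector_mul_assoc)
    also have "\<dots> = (sqrt (c b) * sqrt (c b)) *\<^sub>R b"
      using b by (simp add: Rb matrix_vector_mult_scaleR)
    finally show "(R ** R) *v b = A *v b" using B(4)[OF b] c[OF b] by simp
  qed
  ultimately show ?thesis unfolding pos_def_matrix_def by blast
qed

text \<open>No common eigenbasis of \<open>R\<close> and \<open>S\<close> is required. On an
  eigenvector \<open>b\<close> of \<open>R - S\<close> with eigenvalue \<open>c\<close>, equal
  squares give equal norms of \<open>R b\<close> and \<open>S b\<close>, and the difference of the
  squared norms factors as \<open>c\<close> times a positive number.\<close>

lemma pos_def_sqrt_unique:
  fixes R S :: "real ^ 'n ^ 'n"
  assumes R: "pos_def_matrix R" and S: "pos_def_matrix S" and eq: "R ** R = S ** S"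
  shows "R = S"
proof -
  have "transpose (R - S) = R - S"
    using R S by (simp add: pos_def_matrix_def transpose_def vec_eq_iff)
  then obtain B c where B: "finite B" "pairwise orthogonal B" "\<And>b. b \<in> B \<Longrightarrow> norm b = 1"
    "\<And>b. b \<in> B \<Longrightarrow> (R - S) *v b = c b *\<^sub>R b" "span B = UNIV"
    using symmetric_matrix_eigenbasis by metis
  show ?thesis
    using B(5)
  proof (rule matrix_eq_on_spanning)
    fix b assume b: "b \<in> B"
    then have "b \<noteq> 0" using B(3)[of b] by auto
    then have pos: "b \<bullet> (R *v b) > 0" "b \<bullet> (S *v b) > 0" using R S by (auto simp: pos_def_matrix_def)
    have d: "R *v b = S *v b + c b *\<^sub>R b"
      using B(4)[OF b] by (simp add: matrix_vector_mult_diff_rdistrib algebra_simps)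
    have "(R *v b) \<bullet> (R *v b) = (S *v b) \<bullet> (S *v b)"
      using pos_def_matrix_inner[OF R] pos_def_matrix_inner[OF S] eq by (simp add: matrix_vector_mul_assoc)
    moreover have "(R *v b) \<bullet> (R *v b) - (S *v b) \<bullet> (S *v b)
        = (R *v b - S *v b) \<bullet> (R *v b) + (S *v b) \<bullet> (R *v b - S *v b)"
      by (simp add: inner_diff_left inner_diff_right)
    moreover have "R *v b - S *v b = c b *\<^sub>R b" using d by simp
    ultimately have "c b * (b \<bullet> (R *v b) + b \<bullet> (S *v b)) = 0"
      by (simp add: inner_commute distrib_left)
    then show "R *v b = S *v b" using pos d by auto
  qed
qed

lemma mat_sqrt_works:
  fixes A :: "real ^ 'n ^ 'n"
  assumes "pos_def_matrix A"
  shows "pos_def_matrix (mat_sqrt A)" "mat_sqrt A ** mat_sqrt A = A"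
proof -
  have "\<exists>!R. pos_def_matrix R \<and> R ** R = A"
    using pos_def_sqrt_exists[OF assms] pos_def_sqrt_unique by metis
  from theI'[OF this] show "pos_def_matrix (mat_sqrt A)" "mat_sqrt A ** mat_sqrt A = A"
    unfolding mat_sqrt_def by blast+
qed

lemma mat_sqrt_eqI:
  fixes A :: "real ^ 'n ^ 'n"
  assumes "pos_def_matrix R" "R ** R = A"
  shows "mat_sqrt A = R"
  unfolding mat_sqrt_def using assms pos_def_sqrt_unique by (intro the_equality) auto

lemma pos_def_matrix_invertible:
  fixes A :: "real ^ 'n ^ 'n"
  assumes "pos_def_matrix A"
  shows "invertible A"
proof -
  have "x = 0" if "A *v x = 0" for x
    using assms that unfolding pos_def_matrix_def by (metis inner_zero_right less_irrefl)
  then show ?thesis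
    using invertible_left_inverse matrix_left_invertible_ker by blast
qed

lemma matrix_inv_eqI:
  fixes A B :: "real ^ 'n ^ 'n"
  assumes "A ** B = mat 1"
  shows "matrix_inv A = B"
proof -
  have "invertible A" using assms invertible_right_inverse by blast
  then have "matrix_inv A ** A = mat 1" unfolding invertible_def matrix_inv_def by (metis (mono_tags, lifting) someI_ex)
  then show ?thesis
    by (metis assms matrix_mul_assoc matrix_mul_lid matrix_mul_rid)
qed

lemma pos_def_matrix_inverse:
  fixes R S :: "real ^ 'n ^ 'n"
  assumes "pos_def_matrix R" "R ** S = mat 1"
  shows "pos_def_matrix S"
proof -
  have RS: "R *v (S *v x) = x" for x using assms(2) by (simp add: matrix_vector_mul_assoc)
  have "(S *v x) \<bullet> y = x \<bullet> (S *v y)" for x y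
    using pos_def_matrix_inner[OF assms(1), of "S *v x" "S *v y"] by (simp add: RS)
  moreover have "x \<bullet> (S *v x) > 0" if "x \<noteq> 0" for x
  proof -
    have "S *v x \<noteq> 0" using that RS by (metis matrix_vector_mult_0_right)
    then have "(S *v x) \<bullet> (R *v (S *v x)) > 0" using assms(1) by (simp add: pos_def_matrix_def)
    then show ?thesis by (simp add: RS inner_commute)
  qed
  ultimately show ?thesis by (simp add: pos_def_matrix_def symmetric_matrix_iff)
qed

lemma mat_inv_sqrt_works:
  fixes A :: "real ^ 'n ^ 'n"
  assumes "pos_def_matrix A"
  shows "mat_sqrt A ** mat_inv_sqrt A = mat 1" "mat_inv_sqrt A ** mat_sqrt A = mat 1"
    "pos_def_matrix (mat_inv_sqrt A)"
    "mat_inv_sqrt A ** A ** mat_inv_sqrt A = mat 1"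
proof -
  have inv: "invertible (mat_sqrt A)"
    using mat_sqrt_works(1)[OF assms] by (rule pos_def_matrix_invertible)
  then have "mat_sqrt A ** mat_inv_sqrt A = mat 1 \<and> mat_inv_sqrt A ** mat_sqrt A = mat 1"
    unfolding invertible_def mat_inv_sqrt_def matrix_inv_def by (rule someI_ex)
  then show 1: "mat_sqrt A ** mat_inv_sqrt A = mat 1" and 2: "mat_inv_sqrt A ** mat_sqrt A = mat 1" by auto
  show "pos_def_matrix (mat_inv_sqrt A)"
    using pos_def_matrix_inverse[OF mat_sqrt_works(1)[OF assms] 1] .
  have "mat_inv_sqrt A ** A ** mat_inv_sqrt A
      = (mat_inv_sqrt A ** mat_sqrt A) ** (mat_sqrt A ** mat_inv_sqrt A)"
    using mat_sqrt_works(2)[OF assms] by (metis matrix_mul_assoc)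
  then show "mat_inv_sqrt A ** A ** mat_inv_sqrt A = mat 1" by (simp add: 1 2)
qed

text \<open>The entry sum \<open>e\<close> bounds the operator norm of \<open>A - I\<close>. The
  root is at least as close to the identity as \<open>A\<close>, since
  \<open>A - I = (R + I) (R - I)\<close> and \<open>R + I\<close> only increases norms. Passing to
  the inverse costs a factor \<open>1 / (1 - e)\<close>, at most 2.\<close>

lemma mat_inv_sqrt_near_one:
  fixes A :: "real ^ 'n ^ 'n"
  defines "e \<equiv> (\<Sum>i\<in>UNIV. \<Sum>j\<in>UNIV. \<bar>(A - mat 1) $ i $ j\<bar>)"
  assumes sym: "transpose A = A" and e: "e \<le> 1 / 2"
  shows "pos_def_matrix A" "\<bar>(mat_inv_sqrt A - mat 1) $ k $ l\<bar> \<le> 2 * e"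
proof -
  have near: "norm (A *v x - x) \<le> e * norm x" for x
    using onorm_le_matrix_component_sum[of "A - mat 1"] onorm[OF matrix_vector_mul_bounded_linear[of "A - mat 1"], of x]
    by (simp add: e_def matrix_vector_mult_diff_rdistrib) (meson mult_right_mono norm_ge_zero order_trans)
  have "x \<bullet> (A *v x) > 0" if "x \<noteq> 0" for x
  proof -
    have half: "norm (A *v x - x) \<le> 1 / 2 * norm x"
      using near[of x] mult_right_mono[OF e norm_ge_zero[of x]] by linarith
    have "x \<bullet> x - x \<bullet> (A *v x) \<le> norm x * norm (A *v x - x)"
      using norm_cauchy_schwarz[of x "x - A *v x"] by (simp add: inner_diff_right norm_minus_commute)
    also have "\<dots> \<le> norm x * (1 / 2 * norm x)"
      using half by (intro mult_left_mono) auto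
    finally have "x \<bullet> (A *v x) \<ge> (1/2) * (norm x)\<^sup>2" by (simp add: dot_square_norm power2_eq_square)
    moreover have "(norm x)\<^sup>2 > 0" using that by simp
    ultimately show ?thesis by linarith
  qed
  then show pd: "pos_def_matrix A" using sym by (simp add: pos_def_matrix_def)
  let ?R = "mat_sqrt A" and ?B = "mat_inv_sqrt A"
  have R: "norm (?R *v x - x) \<le> norm (A *v x - x)" for x
  proof -
    define y where "y = ?R *v x - x"
    have "A *v x - x = ?R *v y + y"
      unfolding y_def by (simp add: matrix_vector_mult_diff_distrib matrix_vector_mul_assoc mat_sqrt_works(2)[OF pd])
    moreover have "y \<bullet> (?R *v y) \<ge> 0"
      using mat_sqrt_works(1)[OF pd] by (cases "y = 0") (auto simp: pos_def_matrix_def less_imp_le)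
    ultimately have "norm y * norm y \<le> y \<bullet> (A *v x - x)"
      by (simp add: inner_add_right power2_norm_eq_inner[symmetric] power2_eq_square)
    also have "\<dots> \<le> norm y * norm (A *v x - x)" by (rule norm_cauchy_schwarz)
    finally show ?thesis unfolding y_def[symmetric]
      by (cases "y = 0") auto
  qed
  have B: "norm (?B *v y - y) \<le> 2 * e * norm y" for y
  proof -
    define x where "x = ?B *v y"
    have y: "y = ?R *v x" unfolding x_def by (simp add: matrix_vector_mul_assoc mat_inv_sqrt_works(1)[OF pd])
    have "norm (x - y) \<le> e * norm x" using R[of x] near[of x] y by (simp add: norm_minus_commute)
    also have "\<dots> \<le> e * norm (x - y) + e * norm y"
      unfolding distrib_left[symmetric]
      by (intro mult_left_mono) (auto simp: e_def intro!: sum_nonneg simp: norm_triangle_sub add.commute)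
    also have "\<dots> \<le> 1/2 * norm (x - y) + e * norm y"
      using e by (intro add_mono mult_right_mono) auto
    finally show ?thesis unfolding x_def by simp
  qed
  have "(?B - mat 1) $ k $ l = ((?B - mat 1) *v axis l 1) $ k"
    by (simp add: matrix_vector_mul_component inner_axis)
  also have "\<bar>\<dots>\<bar> \<le> norm (?B *v axis l 1 - axis l 1)"
    using component_le_norm_cart[of "(?B - mat 1) *v axis l 1" k]
    by (simp add: matrix_vector_mult_diff_rdistrib)
  also have "\<dots> \<le> 2 * e" using B[of "axis l 1"] by simp
  finally show "\<bar>(?B - mat 1) $ k $ l\<bar> \<le> 2 * e" .
qed

section \<open>Borel measurability of the inverse square root\<close>

lemma pos_def_matrix_square:
  fixes R :: "real ^ 'n ^ 'n"
  assumes "pos_def_matrix R"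
  shows "pos_def_matrix (R ** R)"
proof -
  have "transpose (R ** R) = R ** R"
    using assms by (simp add: matrix_transpose_mul pos_def_matrix_def)
  moreover have "x \<bullet> ((R ** R) *v x) > 0" if "x \<noteq> 0" for x
  proof -
    have "x \<bullet> ((R ** R) *v x) = (R *v x) \<bullet> (R *v x)"
      by (simp add: pos_def_matrix_inner[OF assms] matrix_vector_mul_assoc)
    moreover have "R *v x \<noteq> 0" using assms that unfolding pos_def_matrix_def by (metis inner_zero_right less_irrefl)
    ultimately show ?thesis by simp
  qed
  ultimately show ?thesis by (simp add: pos_def_matrix_def)
qed

text \<open>Squares of positive definite matrices are positive definite, so the description of the
  root is unsatisfiable here. What matters is that the resulting default value is the same for all
  such \<open>A\<close>: a constant is measurable.\<close>

lemma mat_inv_sqrt_not_pos_def: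
  fixes A :: "real ^ 'n ^ 'n"
  assumes "\<not> pos_def_matrix A"
  shows "mat_inv_sqrt A = matrix_inv (THE R. False)"
proof -
  have "(\<lambda>R. pos_def_matrix R \<and> R ** R = A) = (\<lambda>R. False)"
    using assms pos_def_matrix_square by blast
  then show ?thesis unfolding mat_inv_sqrt_def mat_sqrt_def
    by (rule arg_cong[where f="\<lambda>P. matrix_inv (The P)"])
qed

text \<open>A compact exhaustion of the positive definite matrices: \<open>m\<close> bounds the norm
  and the inverse of the least eigenvalue. Multiplying by \<open>m\<close> instead of dividing keeps
  every condition closed and makes \<open>m = 0\<close> harmless.\<close>

definition pos_def_level :: "nat \<Rightarrow> (real ^ 'n ^ 'n) set" where
  "pos_def_level m = {R. transpose R = R \<and> norm R \<le> real m \<and> (\<forall>x. x \<bullet> x \<le> real m * (x \<bullet> (R *v x)))}"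

lemma pos_def_level_mono: "m \<le> m' \<Longrightarrow> pos_def_level m \<subseteq> pos_def_level m'"
proof (safe; unfold pos_def_level_def mem_Collect_eq; safe)
  fix R :: "real ^ 'n ^ 'n" and x :: "real ^ 'n"
  assume m: "m \<le> m'" and le: "\<forall>x. x \<bullet> x \<le> real m * (x \<bullet> (R *v x))"
  have "0 \<le> real m * (x \<bullet> (R *v x))" using le by (meson inner_ge_zero order_trans)
  then have "m = 0 \<or> 0 \<le> x \<bullet> (R *v x)" by (auto simp: zero_le_mult_iff)
  then show "x \<bullet> x \<le> real m' * (x \<bullet> (R *v x))"
  proof
    assume "m = 0"
    then have "x \<bullet> x \<le> 0" using le by simp
    then have "x = 0" by (metis inner_gt_zero_iff not_le)
    then show ?thesis by simp
  next
    assume "0 \<le> x \<bullet> (R *v x)"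
    then show ?thesis using le m by (meson mult_right_mono of_nat_le_iff order_trans)
  qed
qed auto

lemma pos_def_level_pos_def:
  assumes "R \<in> pos_def_level m"
  shows "pos_def_matrix R"
proof -
  have "0 < x \<bullet> (R *v x)" if "x \<noteq> 0" for x
  proof -
    have "0 < real m * (x \<bullet> (R *v x))"
      using assms that unfolding pos_def_level_def by (smt (verit) inner_gt_zero_iff mem_Collect_eq)
    then show ?thesis by (simp add: zero_less_mult_iff)
  qed
  then show ?thesis using assms by (simp add: pos_def_matrix_def pos_def_level_def)
qed

text \<open>The quadratic form has a positive minimum \<open>c\<close> on the unit sphere, by
  compactness; any \<open>m\<close> above both the norm and \<open>1 / c\<close> will do.\<close>

lemma pos_def_matrix_in_level:
  fixes R :: "real ^ 'n ^ 'n"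
  assumes "pos_def_matrix R"
  shows "\<exists>m. R \<in> pos_def_level m"
proof -
  have "continuous_on (sphere 0 1) (\<lambda>x::real^'n. x \<bullet> (R *v x))"
    by (intro continuous_intros matrix_vector_mult_linear_continuous_on)
  moreover have "axis undefined 1 \<in> sphere (0::real^'n) 1" by simp
  ultimately obtain v where v: "v \<in> sphere (0::real^'n) 1"
    and min: "\<And>x. x \<in> sphere 0 1 \<Longrightarrow> v \<bullet> (R *v v) \<le> x \<bullet> (R *v x)"
    using continuous_attains_inf[OF compact_sphere] by blast
  define c where "c = v \<bullet> (R *v v)"
  have "v \<noteq> 0" using v by auto
  then have c: "c > 0" using assms by (simp add: c_def pos_def_matrix_def)
  obtain m :: nat where m: "real m \<ge> max (norm R) (1 / c)" using real_arch_simple by blast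
  have "x \<bullet> x \<le> real m * (x \<bullet> (R *v x))" for x
  proof (cases "x = 0")
    case False
    have "c \<le> (x /\<^sub>R norm x) \<bullet> (R *v (x /\<^sub>R norm x))"
      unfolding c_def using False by (intro min) simp
    then have "c * (x \<bullet> x) \<le> x \<bullet> (R *v x)"
      using False by (simp add: matrix_vector_mult_scaleR dot_square_norm field_simps power2_eq_square)
    then have "(1 / c) * (c * (x \<bullet> x)) \<le> real m * (x \<bullet> (R *v x))"
      using c m by (intro mult_mono) auto
    then show ?thesis using c by simp
  qed simp
  then have "R \<in> pos_def_level m"
    using assms m by (simp add: pos_def_level_def pos_def_matrix_def)
  then show ?thesis ..
qed

lemma continuous_on_matrix_mult [continuous_intros]:
  fixes f :: "'a::topological_space \<Rightarrow> real ^ 'n ^ 'm" and g :: "'a \<Rightarrow> real ^ 'k ^ 'n"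
  assumes "continuous_on S f" "continuous_on S g"
  shows "continuous_on S (\<lambda>x. f x ** g x)"
  unfolding matrix_matrix_mult_def by (intro continuous_intros continuous_on_vec_lambda assms)

lemma continuous_on_matrix_vector_mult [continuous_intros]:
  fixes f :: "'a::topological_space \<Rightarrow> real ^ 'n ^ 'm" and g :: "'a \<Rightarrow> real ^ 'n"
  assumes "continuous_on S f" "continuous_on S g"
  shows "continuous_on S (\<lambda>x. f x *v g x)"
  unfolding matrix_vector_mult_def by (intro continuous_intros continuous_on_vec_lambda assms)

lemma continuous_on_transpose [continuous_intros]:
  fixes f :: "'a::topological_space \<Rightarrow> real ^ 'n ^ 'm"
  assumes "continuous_on S f"
  shows "continuous_on S (\<lambda>x. transpose (f x))"
  unfolding transpose_def by (intro continuous_intros continuous_on_vec_lambda assms)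

lemma compact_pos_def_level: "compact (pos_def_level m :: (real ^ 'n ^ 'n) set)"
proof -
  have "closed (pos_def_level m :: (real ^ 'n ^ 'n) set)"
    unfolding pos_def_level_def
    by (intro closed_Collect_conj closed_Collect_all closed_Collect_eq closed_Collect_le continuous_intros)
  moreover have "bounded (pos_def_level m :: (real ^ 'n ^ 'n) set)"
    unfolding bounded_iff pos_def_level_def by blast
  ultimately show ?thesis by (simp add: compact_eq_bounded_closed)
qed

lemma borel_measurableI_closed:
  fixes f :: "'a \<Rightarrow> 'b::topological_space"
  assumes "\<And>C. closed C \<Longrightarrow> {x \<in> space M. f x \<in> C} \<in> sets M"
  shows "f \<in> borel_measurable M"
proof (rule borel_measurableI)
  fix S :: "'b set" assume "open S"
  then have "space M - {x \<in> space M. f x \<in> - S} \<in> sets M" by (intro sets.compl_sets assms closed_Compl)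
  also have "space M - {x \<in> space M. f x \<in> - S} = f -` S \<inter> space M" by auto
  finally show "f -` S \<inter> space M \<in> sets M" .
qed

text \<open>The graph of the inverse root over positive definite matrices is a countable union of
  compact sets, so preimages of closed sets are \<open>F\<^sub>\<sigma>\<close>.\<close>

lemma mat_inv_sqrt_preimage_sets:
  fixes C :: "(real ^ 'n ^ 'n) set"
  assumes "closed C"
  shows "{A. pos_def_matrix A \<and> mat_inv_sqrt A \<in> C} \<in> sets borel"
proof -
  define G where "G m = {p \<in> pos_def_level m \<times> (pos_def_level m \<inter> C). fst p ** snd p = mat 1}" for m
  have "{A. pos_def_matrix A \<and> mat_inv_sqrt A \<in> C} = (\<Union>m. (\<lambda>p. fst p ** fst p) ` G m)"
  proof (intro set_eqI iffI; clarsimp)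
    fix A :: "real ^ 'n ^ 'n" assume A: "pos_def_matrix A" "mat_inv_sqrt A \<in> C"
    obtain m1 m2 where "mat_sqrt A \<in> pos_def_level m1" "mat_inv_sqrt A \<in> pos_def_level m2"
      using pos_def_matrix_in_level mat_sqrt_works(1)[OF A(1)] mat_inv_sqrt_works(3)[OF A(1)] by blast
    then have "(mat_sqrt A, mat_inv_sqrt A) \<in> G (max m1 m2)"
      using A pos_def_level_mono[of m1 "max m1 m2"] pos_def_level_mono[of m2 "max m1 m2"]
        mat_inv_sqrt_works(1) by (auto simp: G_def)
    moreover have "A = fst (mat_sqrt A, mat_inv_sqrt A) ** fst (mat_sqrt A, mat_inv_sqrt A)"
      using mat_sqrt_works(2)[OF A(1)] by simp
    ultimately show "\<exists>m. A \<in> (\<lambda>p. fst p ** fst p) ` G m" by blast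
  next
    fix m R S assume "(R, S) \<in> G m"
    then have *: "R \<in> pos_def_level m" "S \<in> C" "R ** S = mat 1" by (auto simp: G_def)
    then have "pos_def_matrix R" by (simp add: pos_def_level_pos_def)
    then show "pos_def_matrix (R ** R) \<and> mat_inv_sqrt (R ** R) \<in> C"
      using * by (simp add: pos_def_matrix_square mat_inv_sqrt_def mat_sqrt_eqI matrix_inv_eqI)
  qed
  moreover have "compact ((\<lambda>p. fst p ** fst p) ` G m)" for m
  proof (rule compact_continuous_image)
    show "continuous_on (G m) (\<lambda>p. fst p ** fst p)" by (intro continuous_intros)
    have "G m = (pos_def_level m \<times> (pos_def_level m \<inter> C)) \<inter> {p. fst p ** snd p = mat 1}"
      by (auto simp: G_def)
    moreover have "closed {p. (fst p :: real ^ 'n ^ 'n) ** (snd p :: real ^ 'n ^ 'n) = mat 1}"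
      by (intro closed_Collect_eq continuous_intros)
    ultimately show "compact (G m)"
      using compact_pos_def_level assms by (auto intro!: compact_Int_closed compact_Times)
  qed
  ultimately show ?thesis by (simp add: sets.countable_UN borel_compact image_subset_iff)
qed

lemma mat_inv_sqrt_measurable [measurable]:
  "mat_inv_sqrt \<in> borel_measurable (borel :: (real ^ 'n ^ 'n) measure)"
proof (rule borel_measurableI_closed)
  fix C :: "(real ^ 'n ^ 'n) set" assume C: "closed C"
  let ?P = "\<lambda>C. {A :: real ^ 'n ^ 'n. pos_def_matrix A \<and> mat_inv_sqrt A \<in> C}"
  let ?c = "matrix_inv (THE R. False) :: real ^ 'n ^ 'n"
  have "mat_inv_sqrt A \<in> C \<longleftrightarrow> ?c \<in> C" if "\<not> pos_def_matrix A" for A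
    unfolding mat_inv_sqrt_not_pos_def[OF that] by (rule refl)
  \<comment> \<open>\<open>?P UNIV\<close> is the set of positive definite matrices; its complement,
    where the value is the constant \<open>?c\<close>, belongs to the preimage entirely or not at
    all.\<close>
  then have "{A \<in> space borel. mat_inv_sqrt A \<in> C} = ?P C \<union> (if ?c \<in> C then - ?P UNIV else {})"
    by auto
  then show "{A \<in> space borel. mat_inv_sqrt A \<in> C} \<in> sets borel"
    using mat_inv_sqrt_preimage_sets[OF C] mat_inv_sqrt_preimage_sets[OF closed_UNIV]
    by (auto intro!: sets.Un borel_comp)
qed

section \<open>Measurable selection of minimizers\<close>

definition argmin_on :: "'b set \<Rightarrow> ('b \<Rightarrow> real) \<Rightarrow> 'b set" where
  "argmin_on K g = {u \<in> K. \<forall>v\<in>K. g u \<le> g v}"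

text \<open>Measurability of a set-valued map through its hits of closed sets. Closed test sets fit
  the use: they are stable under intersection with closed sublevel sets, and for a singleton value
  they give ordinary measurability.\<close>

definition measurable_compact_valued :: "'a measure \<Rightarrow> ('a \<Rightarrow> 'b::topological_space set) \<Rightarrow> bool" where
  "measurable_compact_valued M A \<longleftrightarrow>
     (\<forall>\<omega>\<in>space M. compact (A \<omega>) \<and> A \<omega> \<noteq> {}) \<and>
     (\<forall>C. closed C \<longrightarrow> {\<omega> \<in> space M. A \<omega> \<inter> C \<noteq> {}} \<in> sets M)"

lemma argmin_on_compact_nonempty:
  fixes K :: "'b::t2_space set"
  assumes K: "compact K" "K \<noteq> {}" and g: "continuous_on K g"
  shows "compact (argmin_on K g)" "argmin_on K g \<noteq> {}"
proof -
  obtain u where u: "u \<in> K" "\<And>v. v \<in> K \<Longrightarrow> g u \<le> g v"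
    using continuous_attains_inf[OF K g] by blast
  then show "argmin_on K g \<noteq> {}" by (auto simp: argmin_on_def)
  have "argmin_on K g = K \<inter> (K \<inter> g -` {..g u})"
    using u by (auto simp: argmin_on_def intro: order_trans)
  also have "compact \<dots>"
    using K(1) continuous_closed_preimage[OF g compact_imp_closed[OF K(1)] closed_atMost]
    by (rule compact_Int_closed)
  finally show "compact (argmin_on K g)" .
qed

lemma dense_approx_less:
  fixes S :: "'b::metric_space set" and g :: "'b \<Rightarrow> real"
  assumes "D \<subseteq> S" "S \<subseteq> closure D" "continuous_on S g" "u \<in> S" "g u < c"
  shows "\<exists>d\<in>D. g d < c"
proof -
  obtain \<delta> where \<delta>: "\<delta> > 0" "\<And>x. x \<in> S \<Longrightarrow> dist x u < \<delta> \<Longrightarrow> dist (g x) (g u) < c - g u"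
    using assms(3-5) unfolding continuous_on_iff by (metis diff_gt_0_iff_gt)
  obtain d where "d \<in> D" "dist d u < \<delta>"
    using assms(2,4) \<delta>(1) closure_approachable by blast
  then show ?thesis using \<delta>(2)[of d] assms(1) by (intro bexI[of _ d]) (auto simp: dist_real_def)
qed

lemma sets_Collect_Bex_countable_set:
  assumes "countable X" "\<And>i. i \<in> X \<Longrightarrow> {x \<in> space M. P i x} \<in> sets M"
  shows "{x \<in> space M. \<exists>i\<in>X. P i x} \<in> sets M"
proof -
  have "{x \<in> space M. \<exists>i\<in>X. P i x} = (\<Union>i\<in>X. {x \<in> space M. P i x})" by blast
  then show ?thesis using sets.countable_UN'[of X "\<lambda>i. {x \<in> space M. P i x}" M] assms by force
qed

lemma sets_Collect_Ball_countable_set: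
  assumes "countable X" "\<And>i. i \<in> X \<Longrightarrow> {x \<in> space M. P i x} \<in> sets M"
  shows "{x \<in> space M. \<forall>i\<in>X. P i x} \<in> sets M"
proof -
  have "{x \<in> space M. \<not> (\<exists>i\<in>X. \<not> P i x)} \<in> sets M"
    by (intro sets.sets_Collect_neg sets_Collect_Bex_countable_set assms)
  then show ?thesis by simp
qed

text \<open>A minimizer lies in \<open>C\<close> iff the minimum over \<open>K \<inter> C\<close>
  does not exceed the one over \<open>K\<close>. Both minima are tested on countable dense subsets;
  the tolerance \<open>inverse (real (Suc n))\<close> is there because a dense subset only
  approximates the minimum over \<open>K \<inter> C\<close>.\<close>

lemma measurable_compact_valued_argmin:
  fixes K :: "'b::{metric_space, second_countable_topology} set"
  assumes K: "compact K" "K \<noteq> {}"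
    and g: "\<And>u. u \<in> K \<Longrightarrow> (\<lambda>\<omega>. g \<omega> u) \<in> borel_measurable M"
    and cont: "\<And>\<omega>. \<omega> \<in> space M \<Longrightarrow> continuous_on K (g \<omega>)"
  shows "measurable_compact_valued M (\<lambda>\<omega>. argmin_on K (g \<omega>))"
  unfolding measurable_compact_valued_def
proof (intro conjI ballI allI impI)
  fix \<omega> assume "\<omega> \<in> space M"
  then show "compact (argmin_on K (g \<omega>))" "argmin_on K (g \<omega>) \<noteq> {}"
    using argmin_on_compact_nonempty[OF K cont] by blast+
next
  fix C :: "'b set" assume C: "closed C"
  show "{\<omega> \<in> space M. argmin_on K (g \<omega>) \<inter> C \<noteq> {}} \<in> sets M"
  proof (cases "K \<inter> C = {}")
    case True
    then have "{\<omega> \<in> space M. argmin_on K (g \<omega>) \<inter> C \<noteq> {}} = {}"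
      by (auto simp: argmin_on_def)
    then show ?thesis by (simp only: sets.empty_sets)
  next
    case False
    obtain D where D: "countable D" "D \<subseteq> K \<inter> C" "K \<inter> C \<subseteq> closure D" using separable by blast
    obtain D' where D': "countable D'" "D' \<subseteq> K" "K \<subseteq> closure D'" using separable by blast
    have KC: "compact (K \<inter> C)" using K(1) C by blast
    have eq: "argmin_on K (g \<omega>) \<inter> C \<noteq> {} \<longleftrightarrow>
        (\<forall>d'\<in>D'. \<forall>n::nat. \<exists>d\<in>D. g \<omega> d \<le> g \<omega> d' + inverse (real (Suc n)))" (is "?L = ?R")
      if \<omega>: "\<omega> \<in> space M" for \<omega>
    proof
      assume ?L
      then obtain u where u: "u \<in> K" "u \<in> C" "\<And>v. v \<in> K \<Longrightarrow> g \<omega> u \<le> g \<omega> v" by (auto simp: argmin_on_def)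
      have c: "continuous_on (K \<inter> C) (g \<omega>)" using cont[OF \<omega>] by (rule continuous_on_subset) auto
      show ?R
      proof (intro ballI allI)
        fix d' n assume "d' \<in> D'"
        then have "g \<omega> u \<le> g \<omega> d'" using u(3) D'(2) by blast
        then have "g \<omega> u < g \<omega> d' + inverse (real (Suc n))"
          by (smt (verit) inverse_positive_iff_positive of_nat_0_less_iff zero_less_Suc)
        from dense_approx_less[OF D(2,3) c _ this] u show "\<exists>d\<in>D. g \<omega> d \<le> g \<omega> d' + inverse (real (Suc n))"
          by (auto intro: less_imp_le)
      qed
    next
      assume R: ?R
      obtain u where u: "u \<in> K \<inter> C" "\<And>v. v \<in> K \<inter> C \<Longrightarrow> g \<omega> u \<le> g \<omega> v"
        using continuous_attains_inf[OF KC False, of "g \<omega>"] cont[OF \<omega>] by (meson continuous_on_subset inf_le1)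
      have "g \<omega> u \<le> g \<omega> v" if v: "v \<in> K" for v
      proof (rule ccontr)
        assume "\<not> g \<omega> u \<le> g \<omega> v"
        then obtain d' where d': "d' \<in> D'" "g \<omega> d' < g \<omega> u"
          using dense_approx_less[OF D'(2,3) cont[OF \<omega>] v] by (auto simp: not_le)
        obtain n where n: "inverse (real (Suc n)) < g \<omega> u - g \<omega> d'"
          using reals_Archimedean[of "g \<omega> u - g \<omega> d'"] d'(2) by auto
        obtain d where "d \<in> D" "g \<omega> d \<le> g \<omega> d' + inverse (real (Suc n))" using R d'(1) by blast
        then show False using n u(2)[of d] D(2) by fastforce
      qed
      then show ?L using u by (auto simp: argmin_on_def)
    qed
    have "{\<omega> \<in> space M. argmin_on K (g \<omega>) \<inter> C \<noteq> {}} =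
        {\<omega> \<in> space M. \<forall>d'\<in>D'. \<forall>n::nat. \<exists>d\<in>D. g \<omega> d \<le> g \<omega> d' + inverse (real (Suc n))}"
      using eq by blast
    also have "\<dots> \<in> sets M"
    proof (intro sets_Collect_Ball_countable_set sets.sets_Collect_countable_All
        sets_Collect_Bex_countable_set D D')
      fix d' n d assume "d' \<in> D'" "d \<in> D"
      then have [measurable]: "(\<lambda>\<omega>. g \<omega> d) \<in> borel_measurable M" "(\<lambda>\<omega>. g \<omega> d') \<in> borel_measurable M"
        using D D' g by auto
      show "{\<omega> \<in> space M. g \<omega> d \<le> g \<omega> d' + inverse (real (Suc n))} \<in> sets M" by measurable
    qed
    finally show ?thesis .
  qed
qed

text \<open>A minimizer of \<open>g\<close> lies in \<open>C\<close> iff every sublevel set that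
  meets \<open>A \<omega>\<close> meets it inside \<open>C\<close>. Rational levels suffice, as one
  of them separates two distinct minima, and each test is a hit of a closed set.\<close>

lemma measurable_compact_valued_refine:
  fixes A :: "'a \<Rightarrow> 'b::metric_space set"
  assumes A: "measurable_compact_valued M A" and g: "continuous_on UNIV g"
  shows "measurable_compact_valued M (\<lambda>\<omega>. argmin_on (A \<omega>) g)"
  unfolding measurable_compact_valued_def
proof (intro conjI ballI allI impI)
  note gX = continuous_on_subset[OF g subset_UNIV]
  have cpt: "compact (A \<omega>)" "A \<omega> \<noteq> {}" if "\<omega> \<in> space M" for \<omega>
    using A that by (auto simp: measurable_compact_valued_def)
  {
    fix \<omega> assume "\<omega> \<in> space M"
    then show "compact (argmin_on (A \<omega>) g)" "argmin_on (A \<omega>) g \<noteq> {}"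
      using argmin_on_compact_nonempty[OF cpt gX] by blast+
  }
  fix C :: "'b set" assume C: "closed C"
  define L where "L q = {u. g u \<le> q}" for q
  have L: "closed (L q)" for q
    unfolding L_def by (intro closed_Collect_le g continuous_on_const)
  have eq: "argmin_on (A \<omega>) g \<inter> C \<noteq> {} \<longleftrightarrow>
      A \<omega> \<inter> C \<noteq> {} \<and> (\<forall>q\<in>\<rat>. A \<omega> \<inter> L q \<noteq> {} \<longrightarrow> A \<omega> \<inter> (C \<inter> L q) \<noteq> {})" (is "?L = ?R")
    if \<omega>: "\<omega> \<in> space M" for \<omega>
  proof
    assume ?L
    then show ?R by (fastforce simp: argmin_on_def L_def intro: order_trans)
  next
    assume R: ?R
    then obtain u where u: "u \<in> A \<omega> \<inter> C" "\<And>v. v \<in> A \<omega> \<inter> C \<Longrightarrow> g u \<le> g v"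
      using continuous_attains_inf[OF compact_Int_closed[OF cpt(1)[OF \<omega>] C] _ gX] by metis
    have "g u \<le> g v" if v: "v \<in> A \<omega>" for v
    proof (rule ccontr)
      assume "\<not> g u \<le> g v"
      then obtain q where q: "q \<in> \<rat>" "g v < q" "q < g u" using Rats_dense_in_real by (auto simp: not_le)
      then have "A \<omega> \<inter> L q \<noteq> {}" using v by (auto simp: L_def less_imp_le)
      then obtain w where "w \<in> A \<omega> \<inter> (C \<inter> L q)" using R q(1) by blast
      then show False using u(2)[of w] q(3) by (auto simp: L_def)
    qed
    then show ?L using u by (auto simp: argmin_on_def)
  qed
  have meas: "{\<omega> \<in> space M. A \<omega> \<inter> C \<noteq> {}} \<in> sets M" if "closed C" for C
    using A that by (simp add: measurable_compact_valued_def)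
  have "{\<omega> \<in> space M. argmin_on (A \<omega>) g \<inter> C \<noteq> {}} =
      {\<omega> \<in> space M. A \<omega> \<inter> C \<noteq> {} \<and> (\<forall>q\<in>\<rat>. A \<omega> \<inter> L q \<noteq> {} \<longrightarrow> A \<omega> \<inter> (C \<inter> L q) \<noteq> {})}"
    using eq by blast
  also have "\<dots> \<in> sets M"
    by (intro sets.sets_Collect_conj sets_Collect_Ball_countable_set[OF countable_rat]
        sets.sets_Collect_imp meas closed_Int C L)
  finally show "{\<omega> \<in> space M. argmin_on (A \<omega>) g \<inter> C \<noteq> {}} \<in> sets M" .
qed

text \<open>Minimizing one coordinate after the other shrinks the set to a point.\<close>

lemma measurable_compact_valued_selection:
  fixes A :: "'a \<Rightarrow> 'b::euclidean_space set"
  assumes "measurable_compact_valued M A"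
  shows "\<exists>w\<in>borel_measurable M. \<forall>\<omega>\<in>space M. w \<omega> \<in> A \<omega>"
proof -
  \<comment> \<open>The invariant: after minimizing along the vectors of \<open>B\<close>, all
    remaining points agree in these coordinates.\<close>
  have "\<exists>A'. measurable_compact_valued M A' \<and> (\<forall>\<omega>. A' \<omega> \<subseteq> A \<omega>) \<and>
      (\<forall>\<omega>. \<forall>u\<in>A' \<omega>. \<forall>v\<in>A' \<omega>. \<forall>b\<in>B. u \<bullet> b = v \<bullet> b)" if "finite B" for B :: "'b set"
    using that
  proof induction
    case empty
    then show ?case using assms by blast
  next
    case (insert b B)
    then obtain A' where A': "measurable_compact_valued M A'" "\<And>\<omega>. A' \<omega> \<subseteq> A \<omega>"
      "\<And>\<omega> u v b. u \<in> A' \<omega> \<Longrightarrow> v \<in> A' \<omega> \<Longrightarrow> b \<in> B \<Longrightarrow> u \<bullet> b = v \<bullet> b" by blast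
    have c: "continuous_on UNIV (\<lambda>u. u \<bullet> b)" by (intro continuous_intros)
    show ?case
    proof (intro exI[of _ "\<lambda>\<omega>. argmin_on (A' \<omega>) (\<lambda>u. u \<bullet> b)"] conjI allI ballI)
      show "measurable_compact_valued M (\<lambda>\<omega>. argmin_on (A' \<omega>) (\<lambda>u. u \<bullet> b))"
        by (rule measurable_compact_valued_refine[OF A'(1) c])
      show "argmin_on (A' \<omega>) (\<lambda>u. u \<bullet> b) \<subseteq> A \<omega>" for \<omega>
        using A'(2) by (auto simp: argmin_on_def)
      fix \<omega> u v a
      assume "u \<in> argmin_on (A' \<omega>) (\<lambda>u. u \<bullet> b)" "v \<in> argmin_on (A' \<omega>) (\<lambda>u. u \<bullet> b)" "a \<in> insert b B"
      then have "u \<in> A' \<omega>" "v \<in> A' \<omega>" "u \<bullet> b = v \<bullet> b" "a = b \<or> a \<in> B"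
        by (auto simp: argmin_on_def intro!: order_antisym)
      then show "u \<bullet> a = v \<bullet> a" using A'(3) by blast
    qed
  qed
  from this[OF finite_Basis] obtain A' where A': "measurable_compact_valued M A'" "\<And>\<omega>. A' \<omega> \<subseteq> A \<omega>"
    "\<And>\<omega> u v b. u \<in> A' \<omega> \<Longrightarrow> v \<in> A' \<omega> \<Longrightarrow> b \<in> Basis \<Longrightarrow> u \<bullet> b = v \<bullet> b" by blast
  define w where "w \<omega> = (SOME u. u \<in> A' \<omega>)" for \<omega>
  have w: "w \<omega> \<in> A' \<omega>" if "\<omega> \<in> space M" for \<omega>
    using A'(1) that by (auto simp: w_def measurable_compact_valued_def some_in_eq)
  have single: "A' \<omega> = {w \<omega>}" if "\<omega> \<in> space M" for \<omega>
  proof -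
    have "u = w \<omega>" if "u \<in> A' \<omega>" for u
      using A'(3)[OF that w[OF \<open>\<omega> \<in> space M\<close>]] by (rule euclidean_eqI)
    then show ?thesis using w[OF that] by blast
  qed
  \<comment> \<open>The remaining set is a singleton, so the choice operator is harmless and
    preimages of \<open>w\<close> are hitting sets.\<close>
  have "w \<in> borel_measurable M"
  proof (rule borel_measurableI_closed)
    fix C :: "'b set" assume "closed C"
    then have "{\<omega> \<in> space M. A' \<omega> \<inter> C \<noteq> {}} \<in> sets M"
      using A'(1) by (simp add: measurable_compact_valued_def)
    also have "{\<omega> \<in> space M. A' \<omega> \<inter> C \<noteq> {}} = {\<omega> \<in> space M. w \<omega> \<in> C}"
      using single by auto
    finally show "{\<omega> \<in> space M. w \<omega> \<in> C} \<in> sets M" .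
  qed
  then show ?thesis using w A'(2) by blast
qed

text \<open>The inner criterion is random; \<open>h\<close> is a deterministic tie-break among its
  minimizers, to be used with the distance to the identity.\<close>

lemma measurable_argmin_argmin:
  fixes K :: "'b::euclidean_space set"
  assumes "compact K" "K \<noteq> {}"
    and "\<And>u. u \<in> K \<Longrightarrow> (\<lambda>\<omega>. g \<omega> u) \<in> borel_measurable M"
    and "\<And>\<omega>. \<omega> \<in> space M \<Longrightarrow> continuous_on K (g \<omega>)"
    and "continuous_on UNIV h"
  shows "\<exists>w\<in>borel_measurable M. \<forall>\<omega>\<in>space M. w \<omega> \<in> argmin_on (argmin_on K (g \<omega>)) h"
  by (rule measurable_compact_valued_selection
      [OF measurable_compact_valued_refine[OF measurable_compact_valued_argmin[OF assms(1-4)] assms(5)]])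

section \<open>The projection pursuit objective\<close>

definition smean :: "nat \<Rightarrow> (nat \<Rightarrow> real) \<Rightarrow> real" where
  "smean n f = (\<Sum>i<n. f i) / real n"

lemma sample_cov_sym: "transpose (sample_cov x n) = sample_cov x n"
  by (simp add: transpose_def sample_cov_def mult.commute)

lemma row_nth [simp]: "row k U = U $ k"
  by (simp add: row_def vec_eq_iff)

lemma matrix_mult_row_inner:
  fixes U :: "real ^ 'n ^ 'm" and B :: "real ^ 'k ^ 'n"
  shows "(U ** B) $ k \<bullet> v = U $ k \<bullet> (B *v v)"
  by (metis matrix_vector_mul_assoc matrix_vector_mul_component)

definition proj_index :: "real \<Rightarrow> nat \<Rightarrow> (nat \<Rightarrow> real ^ 'p) \<Rightarrow> real ^ 'p \<Rightarrow> real" where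
  "proj_index \<alpha> n y u =
     \<alpha> * (smean n (\<lambda>i. (u \<bullet> y i) ^ 3))\<^sup>2 + (1 - \<alpha>) * (smean n (\<lambda>i. (u \<bullet> y i) ^ 4) - 3)\<^sup>2"

lemma spp_objective_eq: "spp_objective \<alpha> x n U = (\<Sum>k\<in>UNIV. proj_index \<alpha> n (whitened x n) (row k U))"
  by (simp add: spp_objective_def proj_index_def smean_def sum.distrib sum_distrib_left)

lemma orthogonal_matrix_rows:
  fixes U :: "real ^ 'n ^ 'n"
  shows "orthogonal_matrix U \<longleftrightarrow> (\<forall>k l. U $ k \<bullet> U $ l = (if k = l then 1 else 0))"
  by (simp add: orthogonal_matrix_orthonormal_rows orthogonal_def norm_eq_1) metis

lemma compact_orthogonal_matrices: "compact {U :: real ^ 'n ^ 'n. orthogonal_matrix U}"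
proof -
  have "closed {U :: real ^ 'n ^ 'n. orthogonal_matrix U}"
    unfolding orthogonal_matrix by (intro closed_Collect_eq continuous_intros)
  moreover have "norm U \<le> real CARD('n)" if "orthogonal_matrix U" for U :: "real ^ 'n ^ 'n"
  proof -
    have "norm U \<le> (\<Sum>k\<in>UNIV. norm (U $ k))"
      unfolding norm_vec_def by (rule L2_set_le_sum) auto
    also have "\<dots> = real CARD('n)" using that by (simp add: orthogonal_matrix_orthonormal_rows)
    finally show ?thesis .
  qed
  ultimately show ?thesis unfolding compact_eq_bounded_closed bounded_iff by blast
qed

lemma continuous_on_spp_objective: "continuous_on S (spp_objective \<alpha> x n)"
  unfolding spp_objective_def row_nth divide_inverse by (intro continuous_intros)

section \<open>Measurability of the sample quantities and of the estimate\<close>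

lemma borel_measurable_vecI:
  fixes f :: "'a \<Rightarrow> 'b::euclidean_space ^ 'n"
  assumes "\<And>i. (\<lambda>x. f x $ i) \<in> borel_measurable M"
  shows "f \<in> borel_measurable M"
  unfolding borel_measurable_euclidean_space[of f]
proof
  fix b :: "'b ^ 'n" assume "b \<in> Basis"
  then obtain i c where "b = axis i c" by (auto simp: Basis_vec_def)
  then show "(\<lambda>x. f x \<bullet> b) \<in> borel_measurable M"
    using assms by (simp add: inner_axis)
qed

lemma borel_measurable_vec_nth [measurable (raw)]:
  fixes f :: "'a \<Rightarrow> 'b::euclidean_space ^ 'n"
  assumes "f \<in> borel_measurable M"
  shows "(\<lambda>x. f x $ i) \<in> borel_measurable M"
  using assms by (rule borel_measurable_continuous_on[rotated]) (intro continuous_intros)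

lemma borel_measurable_matrix_mult [measurable (raw)]:
  fixes f :: "'a \<Rightarrow> real ^ 'n ^ 'm" and g :: "'a \<Rightarrow> real ^ 'k ^ 'n"
  assumes [measurable]: "f \<in> borel_measurable M" "g \<in> borel_measurable M"
  shows "(\<lambda>x. f x ** g x) \<in> borel_measurable M"
  unfolding matrix_matrix_mult_def by (intro borel_measurable_vecI) simp

lemma borel_measurable_matrix_vector_mult [measurable (raw)]:
  fixes f :: "'a \<Rightarrow> real ^ 'n ^ 'm" and g :: "'a \<Rightarrow> real ^ 'n"
  assumes [measurable]: "f \<in> borel_measurable M" "g \<in> borel_measurable M"
  shows "(\<lambda>x. f x *v g x) \<in> borel_measurable M"
  unfolding matrix_vector_mult_def by (intro borel_measurable_vecI) simp

context
  fixes M :: "'a measure" and Z :: "nat \<Rightarrow> 'a \<Rightarrow> real ^ 'p"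
  assumes Z [measurable]: "\<And>i. Z i \<in> borel_measurable M"
begin

lemma sample_mean_measurable [measurable]: "(\<lambda>\<omega>. sample_mean (\<lambda>i. Z i \<omega>) n) \<in> borel_measurable M"
  unfolding sample_mean_def by measurable

lemma sample_cov_measurable [measurable]: "(\<lambda>\<omega>. sample_cov (\<lambda>i. Z i \<omega>) n) \<in> borel_measurable M"
  unfolding sample_cov_def by (intro borel_measurable_vecI) simp

lemma mat_inv_sqrt_sample_cov_measurable [measurable]:
  "(\<lambda>\<omega>. mat_inv_sqrt (sample_cov (\<lambda>i. Z i \<omega>) n)) \<in> borel_measurable M"
  by (rule measurable_compose[OF sample_cov_measurable mat_inv_sqrt_measurable])

lemma spp_objective_measurable [measurable]:
  "(\<lambda>\<omega>. spp_objective \<alpha> (\<lambda>i. Z i \<omega>) n U) \<in> borel_measurable M"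
  unfolding spp_objective_def whitened_def by measurable

text \<open>Valid for every outcome, also where the sample covariance is singular: whatever the
  whitened data are, the objective is continuous in the matrix and the orthogonal group is
  compact.\<close>

lemma measurable_spp_maximizer:
  "\<exists>U\<in>borel_measurable M. \<forall>\<omega>\<in>space M.
     is_arg_max (spp_objective \<alpha> (\<lambda>i. Z i \<omega>) n) orthogonal_matrix (U \<omega>) \<and>
     (\<forall>V. is_arg_max (spp_objective \<alpha> (\<lambda>i. Z i \<omega>) n) orthogonal_matrix V \<longrightarrow>
        dist (U \<omega>) (mat 1) \<le> dist V (mat 1))"
proof -
  let ?K = "{U :: real ^ 'p ^ 'p. orthogonal_matrix U}"
  let ?g = "\<lambda>\<omega> U. - spp_objective \<alpha> (\<lambda>i. Z i \<omega>) n U"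
  have "\<exists>w\<in>borel_measurable M. \<forall>\<omega>\<in>space M.
      w \<omega> \<in> argmin_on (argmin_on ?K (?g \<omega>)) (\<lambda>U. dist U (mat 1))"
  proof (rule measurable_argmin_argmin)
    show "?K \<noteq> {}" using orthogonal_matrix_id by blast
  qed (auto intro!: compact_orthogonal_matrices continuous_intros continuous_on_spp_objective)
  moreover have "U \<in> argmin_on ?K (?g \<omega>) \<longleftrightarrow> is_arg_max (spp_objective \<alpha> (\<lambda>i. Z i \<omega>) n) orthogonal_matrix U"
    for U \<omega> by (auto simp: argmin_on_def is_arg_max_def not_less)
  ultimately show ?thesis by (fastforce simp: argmin_on_def[of "argmin_on _ _"])
qed

end

section \<open>Symmetries and first-order conditions of the objective\<close>

definition signed_row_perm :: "('p \<Rightarrow> 'p) \<Rightarrow> ('p \<Rightarrow> real) \<Rightarrow> real ^ 'p ^ 'p \<Rightarrow> real ^ 'p ^ 'p" where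
  "signed_row_perm \<pi> \<sigma> U = (\<chi> k. \<sigma> k *\<^sub>R U $ \<pi> k)"

text \<open>Signs disappear because third moments are squared and fourth powers are even; a
  permutation merely reindexes the sum over rows.\<close>

lemma spp_objective_signed_row_perm:
  fixes U :: "real ^ 'p ^ 'p"
  assumes "bij \<pi>" and \<sigma>: "\<And>k. \<sigma> k = 1 \<or> \<sigma> k = -1"
  shows "spp_objective \<alpha> x n (signed_row_perm \<pi> \<sigma> U) = spp_objective \<alpha> x n U"
proof -
  have "proj_index \<alpha> n y (\<sigma> k *\<^sub>R u) = proj_index \<alpha> n y u" for k and y :: "nat \<Rightarrow> real ^ 'p" and u
    using \<sigma>[of k] by (auto simp: proj_index_def smean_def sum_negf)
  then have "spp_objective \<alpha> x n (signed_row_perm \<pi> \<sigma> U)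
      = (\<Sum>k\<in>UNIV. proj_index \<alpha> n (whitened x n) (U $ \<pi> k))"
    by (simp add: spp_objective_eq signed_row_perm_def)
  also have "\<dots> = spp_objective \<alpha> x n U"
    unfolding spp_objective_eq row_nth
    using sum.reindex_bij_betw[of \<pi> UNIV UNIV "\<lambda>k. proj_index \<alpha> n (whitened x n) (U $ k)"] assms(1) by simp
  finally show ?thesis .
qed

lemma orthogonal_signed_row_perm:
  fixes U :: "real ^ 'p ^ 'p"
  assumes "inj \<pi>" and \<sigma>: "\<And>k. \<sigma> k = 1 \<or> \<sigma> k = -1" and "orthogonal_matrix U"
  shows "orthogonal_matrix (signed_row_perm \<pi> \<sigma> U)"
  unfolding orthogonal_matrix_rows
proof (intro allI)
  fix k l
  have "\<pi> k = \<pi> l \<longleftrightarrow> k = l" using assms(1) by (simp add: inj_eq)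
  moreover have "\<sigma> k * \<sigma> k = 1" using \<sigma>[of k] by auto
  ultimately show "signed_row_perm \<pi> \<sigma> U $ k \<bullet> signed_row_perm \<pi> \<sigma> U $ l = (if k = l then 1 else 0)"
    using assms(3) by (auto simp: signed_row_perm_def orthogonal_matrix_rows)
qed

lemma proj_index_rotation_derivative:
  fixes u v :: "real ^ 'p" and y :: "nat \<Rightarrow> real ^ 'p"
  defines "a i \<equiv> u \<bullet> y i" and "b i \<equiv> v \<bullet> y i"
  shows "((\<lambda>\<theta>. proj_index \<alpha> n y (cos \<theta> *\<^sub>R u + sin \<theta> *\<^sub>R v)) has_real_derivative
     \<alpha> * (2 * smean n (\<lambda>i. a i ^ 3) * (3 * smean n (\<lambda>i. a i ^ 2 * b i)))
     + (1 - \<alpha>) * (2 * (smean n (\<lambda>i. a i ^ 4) - 3) * (4 * smean n (\<lambda>i. a i ^ 3 * b i)))) (at 0)"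
proof -
  \<comment> \<open>The exponent is a generic \<open>Suc m\<close>, so that cubes and fourth powers
    need one computation.\<close>
  have d: "((\<lambda>\<theta>. smean n (\<lambda>i. (cos \<theta> * a i + sin \<theta> * b i) ^ Suc m)) has_real_derivative
      real (Suc m) * smean n (\<lambda>i. a i ^ m * b i)) (at 0)" for m
  proof -
    have "((\<lambda>\<theta>. (cos \<theta> * a i + sin \<theta> * b i) ^ Suc m) has_real_derivative
        real (Suc m) * (a i ^ m * b i)) (at 0)" for i
    proof -
      have "((\<lambda>\<theta>. cos \<theta> * a i + sin \<theta> * b i) has_real_derivative b i) (at 0)"
        by (auto intro!: derivative_eq_intros)
      from DERIV_power_Suc[OF this, of m] show ?thesis by (simp add: mult_ac)
    qed
    then have "((\<lambda>\<theta>. \<Sum>i<n. (cos \<theta> * a i + sin \<theta> * b i) ^ Suc m) has_real_derivative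
        (\<Sum>i<n. real (Suc m) * (a i ^ m * b i))) (at 0)" by (intro DERIV_sum)
    from DERIV_cdivide[OF this, of "real n"] show ?thesis
      unfolding smean_def by (simp add: sum_distrib_left)
  qed
  have "((\<lambda>\<theta>. \<alpha> * (smean n (\<lambda>i. (cos \<theta> * a i + sin \<theta> * b i) ^ 3))\<^sup>2
      + (1 - \<alpha>) * (smean n (\<lambda>i. (cos \<theta> * a i + sin \<theta> * b i) ^ 4) - 3)\<^sup>2) has_real_derivative
     \<alpha> * (2 * smean n (\<lambda>i. a i ^ 3) * (3 * smean n (\<lambda>i. a i ^ 2 * b i)))
     + (1 - \<alpha>) * (2 * (smean n (\<lambda>i. a i ^ 4) - 3) * (4 * smean n (\<lambda>i. a i ^ 3 * b i)))) (at 0)"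
    using d[of 2] d[of 3] by (auto intro!: derivative_eq_intros simp: eval_nat_numeral)
  then show ?thesis by (simp add: proj_index_def a_def b_def inner_add_left)
qed

text \<open>Rotations in the plane of two rows give one stationarity equation per pair. The weights
  3 and 4 are the derivatives of the cube and the fourth power; the common factor 2 from the outer
  squares is cancelled.\<close>

lemma spp_first_order_condition:
  fixes U :: "real ^ 'p ^ 'p"
  assumes max: "is_arg_max (spp_objective \<alpha> x n) orthogonal_matrix U" and "k \<noteq> l"
  defines "a i \<equiv> U $ k \<bullet> whitened x n i" and "b i \<equiv> U $ l \<bullet> whitened x n i"
  shows "3 * \<alpha> * (smean n (\<lambda>i. a i ^ 3) * smean n (\<lambda>i. a i ^ 2 * b i)
            - smean n (\<lambda>i. b i ^ 3) * smean n (\<lambda>i. b i ^ 2 * a i))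
       + 4 * (1 - \<alpha>) * ((smean n (\<lambda>i. a i ^ 4) - 3) * smean n (\<lambda>i. a i ^ 3 * b i)
            - (smean n (\<lambda>i. b i ^ 4) - 3) * smean n (\<lambda>i. b i ^ 3 * a i)) = 0"
proof -
  define y where "y = whitened x n"
  \<comment> \<open>The rotation by \<theta>: row \<open>l\<close> moves towards
    \<open>- U $ k\<close>, so that all rows stay orthonormal, and this sign produces the
    antisymmetric form of the condition.\<close>
  define R where "R \<theta> = (\<chi> j. if j = k then cos \<theta> *\<^sub>R U $ k + sin \<theta> *\<^sub>R U $ l
     else if j = l then cos \<theta> *\<^sub>R U $ l + sin \<theta> *\<^sub>R (- U $ k) else U $ j)" for \<theta>
  have U: "orthogonal_matrix U" using max by (simp add: is_arg_max_def)
  have in1: "U $ i \<bullet> U $ j = (if i = j then 1 else 0)" for i j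
    using U by (simp add: orthogonal_matrix_rows)
  have orth: "orthogonal_matrix (R \<theta>)" for \<theta>
    unfolding orthogonal_matrix_rows R_def using \<open>k \<noteq> l\<close>
    by (auto simp: inner_add_left inner_add_right inner_diff_left inner_diff_right in1
        power2_eq_square[symmetric])
  let ?G = "proj_index \<alpha> n y"
  have sp: "(\<Sum>j\<in>UNIV. f j) = f k + f l + (\<Sum>j\<in>UNIV - {k, l}. f j)" for f :: "'p \<Rightarrow> real"
    using \<open>k \<noteq> l\<close> by (simp add: sum.remove[of UNIV k] sum.remove[of "UNIV - {k}" l] Diff_insert2[symmetric] insert_commute)
  have obj: "spp_objective \<alpha> x n (R \<theta>) = ?G (cos \<theta> *\<^sub>R U $ k + sin \<theta> *\<^sub>R U $ l)
      + ?G (cos \<theta> *\<^sub>R U $ l + sin \<theta> *\<^sub>R (- U $ k)) + (\<Sum>j\<in>UNIV - {k, l}. ?G (U $ j))" for \<theta>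
    unfolding spp_objective_eq row_nth y_def[symmetric] sp[of "\<lambda>j. ?G (R \<theta> $ j)"]
    using \<open>k \<noteq> l\<close> by (simp add: R_def)
  have R0: "R 0 = U" by (auto simp: R_def vec_eq_iff)
  let ?D = "\<alpha> * (2 * smean n (\<lambda>i. a i ^ 3) * (3 * smean n (\<lambda>i. a i ^ 2 * b i)))
     + (1 - \<alpha>) * (2 * (smean n (\<lambda>i. a i ^ 4) - 3) * (4 * smean n (\<lambda>i. a i ^ 3 * b i)))
     + (\<alpha> * (2 * smean n (\<lambda>i. b i ^ 3) * (3 * smean n (\<lambda>i. b i ^ 2 * - a i)))
     + (1 - \<alpha>) * (2 * (smean n (\<lambda>i. b i ^ 4) - 3) * (4 * smean n (\<lambda>i. b i ^ 3 * - a i))))"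
  have "((\<lambda>\<theta>. spp_objective \<alpha> x n (R \<theta>)) has_real_derivative ?D + 0) (at 0)"
    unfolding obj
    using proj_index_rotation_derivative[of \<alpha> n y "U $ k" "U $ l"]
      proj_index_rotation_derivative[of \<alpha> n y "U $ l" "- U $ k"]
    by (intro DERIV_add DERIV_const) (simp_all add: a_def b_def y_def)
  moreover have "spp_objective \<alpha> x n (R \<theta>) \<le> spp_objective \<alpha> x n (R 0)" for \<theta>
    using max orth[of \<theta>] unfolding R0 is_arg_max_def by (meson not_less)
  ultimately have "?D + 0 = 0"
    by (intro DERIV_local_max[of _ _ 0 1]) auto
  moreover have "smean n (\<lambda>i. b i ^ m * - a i) = - smean n (\<lambda>i. b i ^ m * a i)" for m
    by (simp add: smean_def sum_negf)
  ultimately show ?thesis by (simp add: algebra_simps)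
qed

text \<open>This exact equation takes the place of a first-order expansion of the inverse
  root.\<close>

lemma spp_constraint:
  fixes U :: "real ^ 'p ^ 'p"
  assumes "orthogonal_matrix U" "pos_def_matrix S"
  shows "(U ** mat_inv_sqrt S) ** S ** transpose (U ** mat_inv_sqrt S) = mat 1"
proof -
  let ?B = "mat_inv_sqrt S"
  have "transpose ?B = ?B" using mat_inv_sqrt_works(3)[OF assms(2)] by (simp add: pos_def_matrix_def)
  then have "(U ** ?B) ** S ** transpose (U ** ?B) = U ** (?B ** S ** ?B) ** transpose U"
    by (simp add: matrix_transpose_mul matrix_mul_assoc)
  also have "\<dots> = mat 1"
    using assms(1) by (simp add: mat_inv_sqrt_works(4)[OF assms(2)] orthogonal_matrix_def)
  finally show ?thesis .
qed

section \<open>Sample moments and the population objective\<close>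

definition kron :: "'p \<Rightarrow> 'p \<Rightarrow> real" where
  "kron a b = (if a = b then 1 else 0)"

definition mom3 :: "('p \<Rightarrow> real) \<Rightarrow> 'p \<Rightarrow> 'p \<Rightarrow> 'p \<Rightarrow> real" where
  "mom3 \<gamma> a b c = (if a = b \<and> b = c then \<gamma> a else 0)"

text \<open>Fourth mixed moments under independence and unit variances: the three pairings of the
  Gaussian case plus a fourth cumulant on the diagonal.\<close>

definition mom4 :: "('p \<Rightarrow> real) \<Rightarrow> 'p \<Rightarrow> 'p \<Rightarrow> 'p \<Rightarrow> 'p \<Rightarrow> real" where
  "mom4 \<kappa> a b c d = kron a b * kron c d + kron a c * kron b d + kron a d * kron b c
     + (if a = b \<and> b = c \<and> c = d then \<kappa> a else 0)"

definition raw1 :: "(nat \<Rightarrow> real ^ 'p) \<Rightarrow> nat \<Rightarrow> 'p \<Rightarrow> real" where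
  "raw1 x n a = smean n (\<lambda>i. x i $ a)"

definition raw2 :: "(nat \<Rightarrow> real ^ 'p) \<Rightarrow> nat \<Rightarrow> 'p \<Rightarrow> 'p \<Rightarrow> real" where
  "raw2 x n a b = smean n (\<lambda>i. x i $ a * x i $ b)"

text \<open>The right-nested product lets \<open>smean_proj\<close> peel off one projection at a
  time.\<close>

definition raw3 :: "(nat \<Rightarrow> real ^ 'p) \<Rightarrow> nat \<Rightarrow> 'p \<Rightarrow> 'p \<Rightarrow> 'p \<Rightarrow> real" where
  "raw3 x n a b c = smean n (\<lambda>i. x i $ a * (x i $ b * x i $ c))"

definition raw4 :: "(nat \<Rightarrow> real ^ 'p) \<Rightarrow> nat \<Rightarrow> 'p \<Rightarrow> 'p \<Rightarrow> 'p \<Rightarrow> 'p \<Rightarrow> real" where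
  "raw4 x n a b c d = smean n (\<lambda>i. x i $ a * (x i $ b * (x i $ c * x i $ d)))"

abbreviation centered :: "(nat \<Rightarrow> real ^ 'p) \<Rightarrow> nat \<Rightarrow> nat \<Rightarrow> real ^ 'p" where
  "centered x n \<equiv> \<lambda>i. x i - sample_mean x n"

section \<open>Averages, centering and projected moments\<close>

lemma smean_add: "smean n (\<lambda>i. f i + g i) = smean n f + smean n g"
  by (simp add: smean_def sum.distrib add_divide_distrib)

lemma smean_diff: "smean n (\<lambda>i. f i - g i) = smean n f - smean n g"
  by (simp add: smean_def sum_subtractf diff_divide_distrib)

lemma smean_cmult: "smean n (\<lambda>i. c * f i) = c * smean n f"
  by (simp add: smean_def sum_distrib_left)

lemma smean_const: "n > 0 \<Longrightarrow> smean n (\<lambda>i. c) = c"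
  by (simp add: smean_def)

lemma smean_sum: "smean n (\<lambda>i. \<Sum>a\<in>A. f a i) = (\<Sum>a\<in>A. smean n (f a))"
  unfolding smean_def sum_divide_distrib by (rule sum.swap)

lemma sample_mean_nth: "sample_mean x n $ a = raw1 x n a"
  by (simp add: sample_mean_def raw1_def smean_def)

lemma sample_cov_nth: "sample_cov x n $ a $ b = raw2 (centered x n) n a b"
  by (simp add: sample_cov_def raw2_def smean_def)

text \<open>Centering is expanded exactly because it is not negligible at order 1/sqrt n: in third
  and fourth moments the terms linear in the mean survive and turn into the centerings inside
  \<open>r_hat\<close> and \<open>q_hat\<close>.\<close>

lemma raw2_centered:
  assumes "n > 0"
  shows "raw2 (centered x n) n a b = raw2 x n a b - raw1 x n a * raw1 x n b"
proof -
  let ?m = "raw1 x n"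
  have "(\<lambda>i. centered x n i $ a * centered x n i $ b)
      = (\<lambda>i. x i $ a * x i $ b - ?m b * x i $ a - ?m a * x i $ b + ?m a * ?m b)"
    by (simp add: sample_mean_nth algebra_simps)
  then have "raw2 (centered x n) n a b = raw2 x n a b - ?m b * ?m a - ?m a * ?m b + ?m a * ?m b"
    unfolding raw2_def by (simp only: smean_add smean_diff smean_cmult smean_const[OF assms] raw1_def)
  then show ?thesis by simp
qed

lemma raw3_centered:
  assumes "n > 0"
  shows "raw3 (centered x n) n a b c = raw3 x n a b c
    - raw1 x n a * raw2 x n b c - raw1 x n b * raw2 x n a c - raw1 x n c * raw2 x n a b
    + 2 * (raw1 x n a * (raw1 x n b * raw1 x n c))"
proof -
  let ?m = "raw1 x n"
  have "(\<lambda>i. centered x n i $ a * (centered x n i $ b * centered x n i $ c))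
      = (\<lambda>i. x i $ a * (x i $ b * x i $ c) - ?m a * (x i $ b * x i $ c) - ?m b * (x i $ a * x i $ c)
         - ?m c * (x i $ a * x i $ b) + ?m a * ?m b * x i $ c + ?m a * ?m c * x i $ b
         + ?m b * ?m c * x i $ a - ?m a * ?m b * ?m c)"
    by (simp add: sample_mean_nth algebra_simps)
  then have "raw3 (centered x n) n a b c = raw3 x n a b c - ?m a * raw2 x n b c - ?m b * raw2 x n a c
         - ?m c * raw2 x n a b + ?m a * ?m b * ?m c + ?m a * ?m c * ?m b
         + ?m b * ?m c * ?m a - ?m a * ?m b * ?m c"
    unfolding raw2_def raw3_def by (simp only: smean_add smean_diff smean_cmult smean_const[OF assms] raw1_def)
  then show ?thesis by simp
qed

text \<open>The coefficient 3 merges four terms with three means and one raw factor, which all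
  become the same product of means, with the single product of four means of opposite sign.\<close>

lemma raw4_centered:
  assumes "n > 0"
  shows "raw4 (centered x n) n a b c d = raw4 x n a b c d
    - raw1 x n a * raw3 x n b c d - raw1 x n b * raw3 x n a c d
    - raw1 x n c * raw3 x n a b d - raw1 x n d * raw3 x n a b c
    + (raw1 x n a * (raw1 x n b * raw2 x n c d) + raw1 x n a * (raw1 x n c * raw2 x n b d)
       + raw1 x n a * (raw1 x n d * raw2 x n b c) + raw1 x n b * (raw1 x n c * raw2 x n a d)
       + raw1 x n b * (raw1 x n d * raw2 x n a c) + raw1 x n c * (raw1 x n d * raw2 x n a b))
    - 3 * (raw1 x n a * (raw1 x n b * (raw1 x n c * raw1 x n d)))"
proof -
  let ?m = "raw1 x n"
  have "(\<lambda>i. centered x n i $ a * (centered x n i $ b * (centered x n i $ c * centered x n i $ d)))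
      = (\<lambda>i. x i $ a * (x i $ b * (x i $ c * x i $ d))
         - ?m a * (x i $ b * (x i $ c * x i $ d)) - ?m b * (x i $ a * (x i $ c * x i $ d))
         - ?m c * (x i $ a * (x i $ b * x i $ d)) - ?m d * (x i $ a * (x i $ b * x i $ c))
         + ?m a * ?m b * (x i $ c * x i $ d) + ?m a * ?m c * (x i $ b * x i $ d)
         + ?m a * ?m d * (x i $ b * x i $ c) + ?m b * ?m c * (x i $ a * x i $ d)
         + ?m b * ?m d * (x i $ a * x i $ c) + ?m c * ?m d * (x i $ a * x i $ b)
         - ?m a * ?m b * ?m c * x i $ d - ?m a * ?m b * ?m d * x i $ c
         - ?m a * ?m c * ?m d * x i $ b - ?m b * ?m c * ?m d * x i $ a
         + ?m a * ?m b * ?m c * ?m d)"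
    by (simp add: sample_mean_nth algebra_simps)
  then have "raw4 (centered x n) n a b c d = raw4 x n a b c d
         - ?m a * raw3 x n b c d - ?m b * raw3 x n a c d - ?m c * raw3 x n a b d - ?m d * raw3 x n a b c
         + ?m a * ?m b * raw2 x n c d + ?m a * ?m c * raw2 x n b d
         + ?m a * ?m d * raw2 x n b c + ?m b * ?m c * raw2 x n a d
         + ?m b * ?m d * raw2 x n a c + ?m c * ?m d * raw2 x n a b
         - ?m a * ?m b * ?m c * ?m d - ?m a * ?m b * ?m d * ?m c
         - ?m a * ?m c * ?m d * ?m b - ?m b * ?m c * ?m d * ?m a
         + ?m a * ?m b * ?m c * ?m d"
    unfolding raw2_def raw3_def raw4_def
    by (simp only: smean_add smean_diff smean_cmult smean_const[OF assms] raw1_def)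
  then show ?thesis by (simp add: algebra_simps)
qed

lemma smean_proj:
  fixes u :: "real ^ 'p"
  shows "smean n (\<lambda>i. (u \<bullet> y i) * g i) = (\<Sum>a\<in>UNIV. u $ a * smean n (\<lambda>i. y i $ a * g i))"
  by (simp add: inner_vec_def sum_distrib_right smean_sum mult.assoc smean_cmult)

lemma smean_proj2:
  fixes u v :: "real ^ 'p"
  shows "smean n (\<lambda>i. (u \<bullet> y i) * (v \<bullet> y i)) = (\<Sum>a\<in>UNIV. u $ a * (\<Sum>b\<in>UNIV. v $ b * raw2 y n a b))"
  unfolding smean_proj[of n u] mult.commute[of "_ $ _" "v \<bullet> _"] smean_proj[of n v]
  by (simp add: raw2_def mult.commute)

lemma smean_proj3:
  fixes u v w :: "real ^ 'p"
  shows "smean n (\<lambda>i. (u \<bullet> y i) * ((v \<bullet> y i) * (w \<bullet> y i)))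
    = (\<Sum>a\<in>UNIV. u $ a * (\<Sum>b\<in>UNIV. v $ b * (\<Sum>c\<in>UNIV. w $ c * raw3 y n a b c)))"
  unfolding smean_proj[of n u] mult.left_commute[of "_ $ _" "v \<bullet> _"] smean_proj[of n v]
    mult.commute[of "_ $ _" "w \<bullet> _"] mult.left_commute[of "_ $ _" "w \<bullet> _"] smean_proj[of n w]
  by (simp add: raw3_def mult_ac)

lemma smean_proj4:
  fixes u v w t :: "real ^ 'p"
  shows "smean n (\<lambda>i. (u \<bullet> y i) * ((v \<bullet> y i) * ((w \<bullet> y i) * (t \<bullet> y i))))
    = (\<Sum>a\<in>UNIV. u $ a * (\<Sum>b\<in>UNIV. v $ b * (\<Sum>c\<in>UNIV. w $ c * (\<Sum>d\<in>UNIV. t $ d * raw4 y n a b c d))))"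
  unfolding smean_proj[of n u] mult.left_commute[of "_ $ _" "v \<bullet> _"] smean_proj[of n v]
    mult.left_commute[of "_ $ _" "w \<bullet> _"] smean_proj[of n w]
    mult.commute[of "_ $ _" "t \<bullet> _"] mult.left_commute[of "_ $ _" "t \<bullet> _"] smean_proj[of n t]
  by (simp add: raw4_def mult_ac)

text \<open>Fourth moments enter \<open>dev_sq\<close> only when the kurtosis term has positive weight: for \<open>\<alpha> = 1\<close> their
  deviations are not controlled.\<close>

definition dev_sq :: "real \<Rightarrow> ('p \<Rightarrow> real) \<Rightarrow> ('p \<Rightarrow> real) \<Rightarrow> (nat \<Rightarrow> real ^ 'p) \<Rightarrow> nat \<Rightarrow> real" where
  "dev_sq \<alpha> \<gamma> \<kappa> x n = (\<Sum>a\<in>UNIV. (raw1 x n a)\<^sup>2)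
     + (\<Sum>(a, b)\<in>UNIV. (raw2 x n a b - kron a b)\<^sup>2)
     + (\<Sum>(a, b, c)\<in>UNIV. (raw3 x n a b c - mom3 \<gamma> a b c)\<^sup>2)
     + (if \<alpha> = 1 then 0 else (\<Sum>(a, b, c, d)\<in>UNIV. (raw4 x n a b c d - mom4 \<kappa> a b c d)\<^sup>2))"

text \<open>\<open>ident\<close> is the pairwise form of the three moment conditions, weighted so
  that a criterion of weight zero cannot help. It excludes two components invisible to the
  criterion, which could be rotated into each other.\<close>

locale spp_population =
  fixes \<alpha> :: real and \<gamma> \<kappa> :: "'p::finite \<Rightarrow> real"
  assumes \<alpha>: "0 \<le> \<alpha>" "\<alpha> \<le> 1"
    and ident: "k \<noteq> l \<Longrightarrow> 0 < \<alpha> * ((\<gamma> k)\<^sup>2 + (\<gamma> l)\<^sup>2) + (1 - \<alpha>) * ((\<kappa> k)\<^sup>2 + (\<kappa> l)\<^sup>2)"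
begin

definition dev :: "(nat \<Rightarrow> real ^ 'p) \<Rightarrow> nat \<Rightarrow> real" where
  "dev x n = sqrt (dev_sq \<alpha> \<gamma> \<kappa> x n)"

lemma dev_sq_nonneg: "0 \<le> dev_sq \<alpha> \<gamma> \<kappa> x n"
  unfolding dev_sq_def by (intro add_nonneg_nonneg sum_nonneg) (auto intro: sum_nonneg split: prod.split)

lemma dev_nonneg: "0 \<le> dev x n"
  by (simp add: dev_def dev_sq_nonneg)

lemma dev_bounds:
  shows "\<bar>raw1 x n a\<bar> \<le> dev x n"
    and "\<bar>raw2 x n a b - kron a b\<bar> \<le> dev x n"
    and "\<bar>raw3 x n a b c - mom3 \<gamma> a b c\<bar> \<le> dev x n"
    and "\<alpha> \<noteq> 1 \<Longrightarrow> \<bar>raw4 x n a b c d - mom4 \<kappa> a b c d\<bar> \<le> dev x n"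
proof -
  have le: "\<bar>t\<bar> \<le> dev x n" if "t\<^sup>2 \<le> dev_sq \<alpha> \<gamma> \<kappa> x n" for t
    unfolding dev_def using that by (rule real_le_rsqrt[of "\<bar>t\<bar>", simplified])
  let ?A = "\<Sum>a\<in>UNIV. (raw1 x n a)\<^sup>2"
  let ?B = "\<Sum>(a, b)\<in>UNIV. (raw2 x n a b - kron a b)\<^sup>2"
  let ?C = "\<Sum>(a, b, c)\<in>UNIV. (raw3 x n a b c - mom3 \<gamma> a b c)\<^sup>2"
  let ?D = "\<Sum>(a, b, c, d)\<in>UNIV. (raw4 x n a b c d - mom4 \<kappa> a b c d)\<^sup>2"
  have nn: "0 \<le> ?A" "0 \<le> ?B" "0 \<le> ?C" "0 \<le> ?D"
    by (auto intro: sum_nonneg split: prod.split)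
  have "(raw1 x n a)\<^sup>2 \<le> ?A" by (intro member_le_sum) auto
  then show "\<bar>raw1 x n a\<bar> \<le> dev x n" using nn by (intro le) (simp add: dev_sq_def)
  have "(raw2 x n a b - kron a b)\<^sup>2 \<le> ?B"
    using member_le_sum[of "(a, b)" UNIV "\<lambda>(a, b). (raw2 x n a b - kron a b)\<^sup>2"] by (auto split: prod.split)
  then show "\<bar>raw2 x n a b - kron a b\<bar> \<le> dev x n" using nn by (intro le) (simp add: dev_sq_def)
  have "(raw3 x n a b c - mom3 \<gamma> a b c)\<^sup>2 \<le> ?C"
    using member_le_sum[of "(a, b, c)" UNIV "\<lambda>(a, b, c). (raw3 x n a b c - mom3 \<gamma> a b c)\<^sup>2"]
    by (auto split: prod.split)
  then show "\<bar>raw3 x n a b c - mom3 \<gamma> a b c\<bar> \<le> dev x n" using nn by (intro le) (simp add: dev_sq_def)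
  assume "\<alpha> \<noteq> 1"
  moreover have "(raw4 x n a b c d - mom4 \<kappa> a b c d)\<^sup>2 \<le> ?D"
    using member_le_sum[of "(a, b, c, d)" UNIV "\<lambda>(a, b, c, d). (raw4 x n a b c d - mom4 \<kappa> a b c d)\<^sup>2"]
    by (auto split: prod.split)
  ultimately show "\<bar>raw4 x n a b c d - mom4 \<kappa> a b c d\<bar> \<le> dev x n"
    using nn by (intro le) (simp add: dev_sq_def)
qed

text \<open>There are \<open>CARD('p)\<close> squared entries, each off by at most twice the
  deviation (second moment plus product of means), and \<open>mat_inv_sqrt_near_one\<close> doubles
  their sum.\<close>

definition cov_const :: real where "cov_const = 4 * (real CARD('p))\<^sup>2"

lemma cov_const_ge: "4 \<le> cov_const"
  unfolding cov_const_def using one_le_power[of "real CARD('p)" 2] by simp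

lemma mat_inv_sqrt_cov_near_one:
  assumes n: "n > 0" and d: "cov_const * dev x n \<le> 1"
  shows "pos_def_matrix (sample_cov x n)"
    and "\<bar>mat_inv_sqrt (sample_cov x n) $ k $ l - kron k l\<bar> \<le> cov_const * dev x n"
proof -
  let ?e = "\<Sum>i\<in>UNIV. \<Sum>j\<in>UNIV. \<bar>(sample_cov x n - mat 1) $ i $ j\<bar>"
  \<comment> \<open>A deviation of at most 1 lets the quadratic term from centering be absorbed into
    a linear one.\<close>
  have d1: "dev x n \<le> 1"
    using d cov_const_ge dev_nonneg[of x n] mult_right_mono[of 4 cov_const "dev x n"] by linarith
  have "\<bar>(sample_cov x n - mat 1) $ i $ j\<bar> \<le> 2 * dev x n" for i j
  proof -
    have "\<bar>raw1 x n i * raw1 x n j\<bar> \<le> dev x n * dev x n"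
      unfolding abs_mult by (intro mult_mono dev_bounds dev_nonneg) auto
    also have "\<dots> \<le> dev x n" using d1 dev_nonneg[of x n] by (simp add: mult_left_le)
    finally have "\<bar>raw2 x n i j - raw1 x n i * raw1 x n j - kron i j\<bar> \<le> 2 * dev x n"
      using dev_bounds(2)[of x n i j] by linarith
    then show ?thesis
      by (simp add: sample_cov_nth raw2_centered[OF n] mat_def kron_def)
  qed
  then have "?e \<le> (\<Sum>i::'p\<in>UNIV. \<Sum>j::'p\<in>UNIV. 2 * dev x n)" by (intro sum_mono) auto
  then have e: "2 * ?e \<le> cov_const * dev x n" by (simp add: cov_const_def power2_eq_square)
  then have "?e \<le> 1 / 2" using d by linarith
  note * = mat_inv_sqrt_near_one[OF sample_cov_sym this]
  show "pos_def_matrix (sample_cov x n)" by (rule *(1))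
  show "\<bar>mat_inv_sqrt (sample_cov x n) $ k $ l - kron k l\<bar> \<le> cov_const * dev x n"
    using *(2)[of k l] e by (simp add: mat_def kron_def)
qed

section \<open>The population objective and its maximizers\<close>

definition pop_objective :: "real ^ 'p ^ 'p \<Rightarrow> real" where
  "pop_objective U = \<alpha> * (\<Sum>k\<in>UNIV. (\<Sum>a\<in>UNIV. \<gamma> a * (U $ k $ a) ^ 3)\<^sup>2)
     + (1 - \<alpha>) * (\<Sum>k\<in>UNIV. (\<Sum>a\<in>UNIV. \<kappa> a * (U $ k $ a) ^ 4)\<^sup>2)"

text \<open>The share of one component in the maximum of the population objective;
  \<open>weight_pos\<close> says that it vanishes for at most one component.\<close>

definition weight :: "'p \<Rightarrow> real" where
  "weight a = \<alpha> * (\<gamma> a)\<^sup>2 + (1 - \<alpha>) * (\<kappa> a)\<^sup>2"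

lemma weight_nonneg: "0 \<le> weight a"
  using \<alpha> by (simp add: weight_def)

lemma weight_pos: "k \<noteq> l \<Longrightarrow> weight k = 0 \<Longrightarrow> 0 < weight l"
  using ident[of k l] by (simp add: weight_def algebra_simps)

lemma pop_objective_one: "pop_objective (mat 1) = (\<Sum>a\<in>UNIV. weight a)"
proof -
  have "(\<Sum>a\<in>UNIV. f a * (mat 1 :: real ^ 'p ^ 'p) $ k $ a ^ Suc m) = f k" for f :: "'p \<Rightarrow> real" and k m
  proof -
    have "(\<Sum>a\<in>UNIV. f a * (mat 1 :: real ^ 'p ^ 'p) $ k $ a ^ Suc m) = (\<Sum>a\<in>UNIV. if k = a then f a else 0)"
      by (intro sum.cong) (auto simp: mat_def)
    then show ?thesis by simp
  qed
  from this[of _ _ 2] this[of _ _ 3] show ?thesis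
    by (simp add: pop_objective_def weight_def sum.distrib sum_distrib_left eval_nat_numeral)
qed

lemma unit_vector_nth_sq_le_1:
  fixes u :: "real ^ 'p"
  assumes "u \<bullet> u = 1"
  shows "(u $ a)\<^sup>2 \<le> 1"
  using member_le_sum[of a UNIV "\<lambda>a. (u $ a)\<^sup>2"] assms by (simp add: inner_vec_def power2_eq_square)

text \<open>Cauchy--Schwarz against the unit row \<open>u\<close> itself.\<close>

lemma pop_row_le:
  fixes u :: "real ^ 'p"
  assumes u: "u \<bullet> u = 1"
  shows "\<alpha> * (\<Sum>a\<in>UNIV. \<gamma> a * (u $ a) ^ 3)\<^sup>2 + (1 - \<alpha>) * (\<Sum>a\<in>UNIV. \<kappa> a * (u $ a) ^ 4)\<^sup>2
    \<le> (\<Sum>a\<in>UNIV. weight a * (u $ a) ^ 4)"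
proof -
  have norm1: "(\<Sum>a\<in>UNIV. (u $ a)\<^sup>2) = 1" using u by (simp add: inner_vec_def power2_eq_square)
  have "(\<Sum>a\<in>UNIV. \<gamma> a * (u $ a) ^ 3)\<^sup>2 = (\<Sum>a\<in>UNIV. u $ a * (\<gamma> a * (u $ a)\<^sup>2))\<^sup>2"
    by (simp add: eval_nat_numeral mult_ac)
  also have "\<dots> \<le> (\<Sum>a\<in>UNIV. (\<gamma> a * (u $ a)\<^sup>2)\<^sup>2)"
    using Cauchy_Schwarz_ineq_sum[of "\<lambda>a. u $ a" "\<lambda>a. \<gamma> a * (u $ a)\<^sup>2" UNIV] by (simp add: norm1)
  finally have 1: "(\<Sum>a\<in>UNIV. \<gamma> a * (u $ a) ^ 3)\<^sup>2 \<le> (\<Sum>a\<in>UNIV. (\<gamma> a)\<^sup>2 * (u $ a) ^ 4)"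
    by (simp add: power_mult_distrib flip: power_mult)
  have "(\<Sum>a\<in>UNIV. \<kappa> a * (u $ a) ^ 4)\<^sup>2 = (\<Sum>a\<in>UNIV. u $ a * (\<kappa> a * (u $ a) ^ 3))\<^sup>2"
    by (simp add: eval_nat_numeral mult_ac)
  also have "\<dots> \<le> (\<Sum>a\<in>UNIV. (\<kappa> a * (u $ a) ^ 3)\<^sup>2)"
    using Cauchy_Schwarz_ineq_sum[of "\<lambda>a. u $ a" "\<lambda>a. \<kappa> a * (u $ a) ^ 3" UNIV] by (simp add: norm1)
  \<comment> \<open>Lowering the exponent from 6 to 4 is possible for unit rows and brings the
    kurtosis bound to the power found for skewness, so that both merge into
    \<open>weight\<close>.\<close>
  also have "\<dots> \<le> (\<Sum>a\<in>UNIV. (\<kappa> a)\<^sup>2 * (u $ a) ^ 4)"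
  proof (rule sum_mono)
    fix a
    have "(u $ a) ^ 6 \<le> (u $ a) ^ 4"
      using mult_left_mono[OF unit_vector_nth_sq_le_1[OF u, of a], of "(u $ a) ^ 4"]
      by (simp flip: power_add)
    then show "(\<kappa> a * (u $ a) ^ 3)\<^sup>2 \<le> (\<kappa> a)\<^sup>2 * (u $ a) ^ 4"
      by (simp add: power_mult_distrib mult_left_mono flip: power_mult)
  qed
  finally have 2: "(\<Sum>a\<in>UNIV. \<kappa> a * (u $ a) ^ 4)\<^sup>2 \<le> (\<Sum>a\<in>UNIV. (\<kappa> a)\<^sup>2 * (u $ a) ^ 4)" .
  have "\<alpha> * (\<Sum>a\<in>UNIV. \<gamma> a * (u $ a) ^ 3)\<^sup>2 + (1 - \<alpha>) * (\<Sum>a\<in>UNIV. \<kappa> a * (u $ a) ^ 4)\<^sup>2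
      \<le> \<alpha> * (\<Sum>a\<in>UNIV. (\<gamma> a)\<^sup>2 * (u $ a) ^ 4) + (1 - \<alpha>) * (\<Sum>a\<in>UNIV. (\<kappa> a)\<^sup>2 * (u $ a) ^ 4)"
    using 1 2 \<alpha> by (intro add_mono mult_left_mono) auto
  also have "\<dots> = (\<Sum>a\<in>UNIV. weight a * (u $ a) ^ 4)"
    unfolding weight_def sum_distrib_left sum.distrib[symmetric]
    by (intro sum.cong) (simp_all add: algebra_simps)
  finally show ?thesis .
qed

lemma pop_objective_le:
  assumes "orthogonal_matrix U"
  shows "pop_objective U \<le> (\<Sum>a\<in>UNIV. weight a * (\<Sum>k\<in>UNIV. (U $ k $ a) ^ 4))"
proof -
  have "pop_objective U = (\<Sum>k\<in>UNIV. \<alpha> * (\<Sum>a\<in>UNIV. \<gamma> a * (U $ k $ a) ^ 3)\<^sup>2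
      + (1 - \<alpha>) * (\<Sum>a\<in>UNIV. \<kappa> a * (U $ k $ a) ^ 4)\<^sup>2)"
    by (simp add: pop_objective_def sum.distrib sum_distrib_left)
  also have "\<dots> \<le> (\<Sum>k\<in>UNIV. \<Sum>a\<in>UNIV. weight a * (U $ k $ a) ^ 4)"
    using assms by (intro sum_mono pop_row_le) (simp add: orthogonal_matrix_rows)
  also have "\<dots> = (\<Sum>a\<in>UNIV. weight a * (\<Sum>k\<in>UNIV. (U $ k $ a) ^ 4))"
    by (subst sum.swap) (simp add: sum_distrib_left)
  finally show ?thesis .
qed

definition signed_perm_matrix :: "('p \<Rightarrow> 'p) \<Rightarrow> ('p \<Rightarrow> real) \<Rightarrow> real ^ 'p ^ 'p" where
  "signed_perm_matrix \<pi> \<sigma> = (\<chi> k. \<sigma> k *\<^sub>R axis (\<pi> k) 1)"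

definition signed_perms :: "(real ^ 'p ^ 'p) set" where
  "signed_perms = {signed_perm_matrix \<pi> \<sigma> |\<pi> \<sigma>. bij \<pi> \<and> (\<forall>k. \<sigma> k = 1 \<or> \<sigma> k = -1)}"

text \<open>At the maximum the loss, a weighted sum of \<open>u\<^sup>2 - u\<^sup>4\<close> over all
  entries, is zero. Hence entries in columns of positive weight are 0, 1 or -1, and the unit norm of
  the rows settles the one column that may have weight zero.\<close>

lemma pop_objective_maximizer:
  assumes U: "orthogonal_matrix U" and max: "(\<Sum>a\<in>UNIV. weight a) \<le> pop_objective U"
  shows "U \<in> signed_perms"
proof -
  have row: "(\<Sum>a\<in>UNIV. (U $ k $ a)\<^sup>2) = 1" for k
    using U by (simp add: orthogonal_matrix_rows inner_vec_def power2_eq_square)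
  have col: "(\<Sum>k\<in>UNIV. (U $ k $ a)\<^sup>2) = 1" for a
  proof -
    have "transpose U $ a \<bullet> transpose U $ a = 1"
      using U orthogonal_matrix_transpose[of U] unfolding orthogonal_matrix_rows[of "transpose U"] by simp
    then show ?thesis by (simp add: inner_vec_def transpose_def power2_eq_square)
  qed
  have le1: "(U $ k $ a)\<^sup>2 \<le> 1" for k a
    using U by (intro unit_vector_nth_sq_le_1) (simp add: orthogonal_matrix_rows)
  have term_nn: "0 \<le> (U $ k $ a)\<^sup>2 - (U $ k $ a) ^ 4" for k a
    using mult_left_mono[OF le1[of k a], of "(U $ k $ a)\<^sup>2"] by (simp flip: power_add)
  have "(\<Sum>a\<in>UNIV. weight a * (\<Sum>k\<in>UNIV. (U $ k $ a)\<^sup>2 - (U $ k $ a) ^ 4)) \<le> 0"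
    using pop_objective_le[OF U] max by (simp add: sum_subtractf col algebra_simps)
  moreover have nn: "0 \<le> weight a * (\<Sum>k\<in>UNIV. (U $ k $ a)\<^sup>2 - (U $ k $ a) ^ 4)" for a
    by (intro mult_nonneg_nonneg weight_nonneg sum_nonneg term_nn)
  ultimately have "(\<Sum>a\<in>UNIV. weight a * (\<Sum>k\<in>UNIV. (U $ k $ a)\<^sup>2 - (U $ k $ a) ^ 4)) = 0"
    by (intro order_antisym sum_nonneg) auto
  then have "\<forall>a. weight a * (\<Sum>k\<in>UNIV. (U $ k $ a)\<^sup>2 - (U $ k $ a) ^ 4) = 0"
    using nn by (subst (asm) sum_nonneg_eq_0_iff) auto
  then have "weight a \<noteq> 0 \<Longrightarrow> (U $ k $ a)\<^sup>2 - (U $ k $ a) ^ 4 = 0" for a k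
    using sum_nonneg_eq_0_iff[of UNIV "\<lambda>k. (U $ k $ a)\<^sup>2 - (U $ k $ a) ^ 4"] term_nn by auto
  moreover have "t ^ 2 - t ^ 4 = 0 \<Longrightarrow> t\<^sup>2 = 0 \<or> t\<^sup>2 = 1" for t :: real
  proof -
    assume eq: "t ^ 2 - t ^ 4 = 0"
    have "t\<^sup>2 * (1 - t\<^sup>2) = t ^ 2 - t ^ 4" by (simp add: right_diff_distrib flip: power_add)
    then have "t\<^sup>2 * (1 - t\<^sup>2) = 0" using eq by simp
    then show ?thesis by simp
  qed
  ultimately have w01: "weight a \<noteq> 0 \<Longrightarrow> (U $ k $ a)\<^sup>2 = 0 \<or> (U $ k $ a)\<^sup>2 = 1" for a k by blast
  have all01: "(U $ k $ a)\<^sup>2 = 0 \<or> (U $ k $ a)\<^sup>2 = 1" for k a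
  proof (cases "weight a = 0")
    \<comment> \<open>All other columns have positive weight. If one of them already fills the row,
      the entry here is 0; otherwise it carries the whole norm of the row.\<close>
    case True
    have r: "(U $ k $ a)\<^sup>2 + (\<Sum>j\<in>UNIV - {a}. (U $ k $ j)\<^sup>2) = 1"
      using row[of k] by (simp add: sum.remove[of UNIV a])
    have j01: "(U $ k $ j)\<^sup>2 = 0 \<or> (U $ k $ j)\<^sup>2 = 1" if "j \<noteq> a" for j
      using w01[of j k] weight_pos[of a j] True that by force
    show ?thesis
    proof (cases "\<exists>j\<in>UNIV - {a}. (U $ k $ j)\<^sup>2 = 1")
      case True
      then obtain j where j: "j \<in> UNIV - {a}" "(U $ k $ j)\<^sup>2 = 1" by blast
      then have "1 \<le> (\<Sum>j\<in>UNIV - {a}. (U $ k $ j)\<^sup>2)"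
        using member_le_sum[of j "UNIV - {a}" "\<lambda>j. (U $ k $ j)\<^sup>2"] by simp
      then have "(U $ k $ a)\<^sup>2 \<le> 0" using r by linarith
      then show ?thesis by simp
    next
      case False
      then have "(\<Sum>j\<in>UNIV - {a}. (U $ k $ j)\<^sup>2) = 0" using j01 by (intro sum.neutral) blast
      then show ?thesis using r by simp
    qed
  qed (use w01 in blast)
  have "\<exists>a. (U $ k $ a)\<^sup>2 = 1" for k
  proof (rule ccontr)
    assume "\<nexists>a. (U $ k $ a)\<^sup>2 = 1"
    then have "(\<Sum>a\<in>UNIV. (U $ k $ a)\<^sup>2) = 0" using all01 by (intro sum.neutral) blast
    then show False using row[of k] by simp
  qed
  then obtain \<pi> where \<pi>: "\<And>k. (U $ k $ \<pi> k)\<^sup>2 = 1" by metis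
  define \<sigma> where "\<sigma> k = U $ k $ \<pi> k" for k
  have \<sigma>: "\<sigma> k = 1 \<or> \<sigma> k = -1" for k using \<pi>[of k] by (simp add: \<sigma>_def power2_eq_1_iff)
  have zero: "U $ k $ a = 0" if "a \<noteq> \<pi> k" for k a
  proof -
    have "(U $ k $ a)\<^sup>2 + (U $ k $ \<pi> k)\<^sup>2 = (\<Sum>j\<in>{a, \<pi> k}. (U $ k $ j)\<^sup>2)" using that by simp
    also have "\<dots> \<le> 1" unfolding row[of k, symmetric] by (intro sum_mono2) auto
    finally show ?thesis using \<pi>[of k] by simp
  qed
  have Urow: "U $ k = \<sigma> k *\<^sub>R axis (\<pi> k) 1" for k
    using zero by (auto simp: vec_eq_iff axis_def \<sigma>_def)
  have "inj \<pi>"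
  proof (rule injI, rule ccontr)
    fix k l assume "\<pi> k = \<pi> l" "k \<noteq> l"
    then have "\<sigma> k * \<sigma> l = U $ k \<bullet> U $ l" by (simp add: Urow inner_axis_axis)
    also have "\<dots> = 0" using U \<open>k \<noteq> l\<close> by (simp add: orthogonal_matrix_rows)
    finally show False using \<sigma>[of k] \<sigma>[of l] by auto
  qed
  then have "bij \<pi>" by (simp add: finite_UNIV_inj_surj bij_def)
  moreover have "U = signed_perm_matrix \<pi> \<sigma>" by (simp add: signed_perm_matrix_def vec_eq_iff Urow)
  ultimately show ?thesis using \<sigma> unfolding signed_perms_def by blast
qed

lemma continuous_on_pop_objective: "continuous_on S pop_objective"
  unfolding pop_objective_def by (intro continuous_intros)

text \<open>The orthogonal matrices at distance at least \<rho> from all signed permutations form a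
  compact set that contains no maximizer; \<open>g\<close> is the distance of its best value from
  the maximum.\<close>

lemma pop_objective_gap:
  assumes "\<rho> > 0"
  shows "\<exists>g>0. \<forall>U. orthogonal_matrix U \<longrightarrow> pop_objective (mat 1) - g < pop_objective U \<longrightarrow>
    (\<exists>P\<in>signed_perms. dist U P < \<rho>)"
proof -
  define K where "K = {U. orthogonal_matrix U \<and> (\<forall>P\<in>signed_perms. \<rho> \<le> dist U P)}"
  have "K = {U. orthogonal_matrix U} \<inter> (\<Inter>P\<in>signed_perms. {U. \<rho> \<le> dist U P})" by (auto simp: K_def)
  moreover have "closed (\<Inter>P\<in>signed_perms. {U. \<rho> \<le> dist U P})"
    by (intro closed_INT ballI closed_Collect_le continuous_intros)
  ultimately have K: "compact K" by (simp add: compact_Int_closed compact_orthogonal_matrices)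
  show ?thesis
  proof (cases "K = {}")
    case True
    then show ?thesis by (intro exI[of _ 1]) (auto simp: K_def not_le)
  next
    case False
    then obtain V where V: "V \<in> K" "\<And>U. U \<in> K \<Longrightarrow> pop_objective U \<le> pop_objective V"
      using continuous_attains_sup[OF K False continuous_on_pop_objective] by blast
    have "V \<notin> signed_perms" using V(1) assms by (auto simp: K_def)
    then have "pop_objective V < pop_objective (mat 1)"
      using pop_objective_maximizer[of V] V(1) by (fastforce simp: K_def pop_objective_one)
    then show ?thesis using V(2)
      by (intro exI[of _ "pop_objective (mat 1) - pop_objective V"]) (fastforce simp: K_def not_le)
  qed
qed

end

text \<open>Used to carry a maximizer close to some signed permutation over to one equally close to
  the identity.\<close>

lemma dist_signed_row_perm:
  fixes U V :: "real ^ 'p ^ 'p"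
  assumes "bij \<pi>" and \<sigma>: "\<And>k. \<sigma> k = 1 \<or> \<sigma> k = -1"
  shows "dist (signed_row_perm \<pi> \<sigma> U) (signed_row_perm \<pi> \<sigma> V) = dist U V"
proof -
  have "dist (\<sigma> k *\<^sub>R u) (\<sigma> k *\<^sub>R v) = dist u v" for k and u v :: "real ^ 'p"
    using \<sigma>[of k] by (auto simp: dist_minus)
  then show ?thesis
    using sum.reindex_bij_betw[of \<pi> UNIV UNIV "\<lambda>k. (dist (U $ k) (V $ k))\<^sup>2"] assms(1)
    by (simp add: dist_vec_def signed_row_perm_def L2_set_def)
qed

text \<open>The signs are reindexed by \<open>inv \<pi>\<close> because row \<open>k\<close> of the
  result comes from row \<open>inv \<pi> k\<close>, and each sign meets itself.\<close>

lemma signed_row_perm_inverse_matrix: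
  assumes "bij \<pi>" and \<sigma>: "\<And>k. \<sigma> k = 1 \<or> \<sigma> k = -1"
  shows "signed_row_perm (inv \<pi>) (\<sigma> \<circ> inv \<pi>) (\<chi> k. \<sigma> k *\<^sub>R axis (\<pi> k) 1) = mat 1"
proof -
  have "\<sigma> k * \<sigma> k = 1" for k using \<sigma>[of k] by auto
  moreover have "\<pi> (inv \<pi> k) = k" for k using assms(1) by (simp add: bij_is_surj surj_f_inv_f)
  ultimately show ?thesis by (simp add: signed_row_perm_def vec_eq_iff axis_def mat_def)
qed

section \<open>Consistency of the maximizers\<close>

text \<open>The target may vary with the configuration, as it depends on the orthogonal matrix. Its
  boundedness belongs to the notion because otherwise products would not preserve closeness.\<close>

definition near :: "'c filter \<Rightarrow> ('c \<Rightarrow> real) \<Rightarrow> ('c \<Rightarrow> real) \<Rightarrow> bool" where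
  "near F f g \<longleftrightarrow> (\<lambda>x. f x - g x) \<in> o[F](\<lambda>_. 1) \<and> g \<in> O[F](\<lambda>_. 1)"

lemma near_const: "near F (\<lambda>_. c) (\<lambda>_. c)"
  by (simp add: near_def)

lemma near_add: "near F f g \<Longrightarrow> near F f' g' \<Longrightarrow> near F (\<lambda>x. f x + f' x) (\<lambda>x. g x + g' x)"
  unfolding near_def
  using sum_in_smallo(1)[of "\<lambda>x. f x - g x" F "\<lambda>_. 1" "\<lambda>x. f' x - g' x"] sum_in_bigo(1)[of g F "\<lambda>_. 1" g']
  by (simp add: algebra_simps)

lemma near_diff: "near F f g \<Longrightarrow> near F f' g' \<Longrightarrow> near F (\<lambda>x. f x - f' x) (\<lambda>x. g x - g' x)"
  unfolding near_def
  using sum_in_smallo(2)[of "\<lambda>x. f x - g x" F "\<lambda>_. 1" "\<lambda>x. f' x - g' x"] sum_in_bigo(2)[of g F "\<lambda>_. 1" g']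
  by (simp add: algebra_simps)

lemma near_mult:
  assumes "near F f g" "near F f' g'"
  shows "near F (\<lambda>x. f x * f' x) (\<lambda>x. g x * g' x)"
proof -
  let ?e = "\<lambda>x. f x - g x" and ?e' = "\<lambda>x. f' x - g' x"
  have e: "?e \<in> o[F](\<lambda>_. 1)" "?e' \<in> o[F](\<lambda>_. 1)" "g \<in> O[F](\<lambda>_. 1)" "g' \<in> O[F](\<lambda>_. 1)"
    using assms by (auto simp: near_def)
  have "(\<lambda>x. ?e x * ?e' x + ?e x * g' x + g x * ?e' x) \<in> o[F](\<lambda>_. 1)"
    using landau_o.small_mult[OF e(1,2)] landau_o.small_big_mult[OF e(1,4)]
      landau_o.big_small_mult[OF e(3,2)] by (intro sum_in_smallo) simp_all
  moreover have "(\<lambda>x. ?e x * ?e' x + ?e x * g' x + g x * ?e' x) = (\<lambda>x. f x * f' x - g x * g' x)"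
    by (simp add: algebra_simps)
  ultimately show ?thesis using landau_o.big_mult[OF e(3,4)] by (simp add: near_def)
qed

lemma near_sum: "(\<And>a. a \<in> A \<Longrightarrow> near F (f a) (g a)) \<Longrightarrow> near F (\<lambda>x. \<Sum>a\<in>A. f a x) (\<lambda>x. \<Sum>a\<in>A. g a x)"
  unfolding near_def sum_subtractf[symmetric]
  by (intro conjI big_sum_in_smallo big_sum_in_bigo) auto

lemma near_power2: "near F f g \<Longrightarrow> near F (\<lambda>x. (f x)\<^sup>2) (\<lambda>x. (g x)\<^sup>2)"
  unfolding power2_eq_square by (rule near_mult)

lemma near_cong:
  assumes "near F f g" "eventually (\<lambda>x. f x = f' x) F" "eventually (\<lambda>x. g x = g' x) F"
  shows "near F f' g'"
proof -
  have "eventually (\<lambda>x. f x - g x = f' x - g' x) F" using assms(2,3) by eventually_elim simp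
  from landau_o.small.in_cong[OF this] landau_o.big.in_cong[OF assms(3)] show ?thesis
    using assms(1) unfolding near_def by simp
qed

lemma sum_mom3:
  fixes u :: "'p::finite \<Rightarrow> real"
  shows "(\<Sum>a\<in>UNIV. u a * (\<Sum>b\<in>UNIV. u b * (\<Sum>c\<in>UNIV. u c * mom3 \<gamma> a b c))) = (\<Sum>a\<in>UNIV. \<gamma> a * u a ^ 3)"
proof -
  have "(\<Sum>c\<in>UNIV. u c * mom3 \<gamma> a b c) = (if a = b then \<gamma> a * u a else 0)" for a b
    by (cases "a = b") (simp_all add: mom3_def mult_delta_right)
  then show ?thesis by (simp add: mult_delta_right eval_nat_numeral mult_ac)
qed

text \<open>Each of the three pairings contributes the squared norm squared. The sums are contracted
  from the innermost index outwards, so that each step leaves a short closed form.\<close>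

lemma sum_mom4:
  fixes u :: "'p::finite \<Rightarrow> real"
  shows "(\<Sum>a\<in>UNIV. u a * (\<Sum>b\<in>UNIV. u b * (\<Sum>c\<in>UNIV. u c * (\<Sum>d\<in>UNIV. u d * mom4 \<kappa> a b c d))))
    = 3 * (\<Sum>a\<in>UNIV. (u a)\<^sup>2)\<^sup>2 + (\<Sum>a\<in>UNIV. \<kappa> a * u a ^ 4)"
proof -
  define q where "q = (\<Sum>a\<in>UNIV. (u a)\<^sup>2)"
  have 1: "(\<Sum>d\<in>UNIV. u d * mom4 \<kappa> a b c d)
      = kron a b * u c + kron a c * u b + kron b c * u a + (if a = b \<and> b = c then \<kappa> a * u a else 0)" for a b c
    by (cases "a = b"; cases "b = c"; cases "a = c")
      (simp_all add: mom4_def kron_def distrib_left sum.distrib mult_delta_right)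
  have 2: "(\<Sum>c\<in>UNIV. u c * (kron a b * u c + kron a c * u b + kron b c * u a + (if a = b \<and> b = c then \<kappa> a * u a else 0)))
      = kron a b * q + 2 * u a * u b + (if a = b then \<kappa> a * (u a)\<^sup>2 else 0)" for a b
    by (cases "a = b") (simp_all add: kron_def distrib_left sum.distrib mult_delta_right mult_delta_left
        q_def power2_eq_square mult_ac)
  have 3: "(\<Sum>b\<in>UNIV. u b * (kron a b * q + 2 * u a * u b + (if a = b then \<kappa> a * (u a)\<^sup>2 else 0)))
      = 3 * u a * q + \<kappa> a * u a ^ 3" for a
  proof -
    have "(\<Sum>b\<in>UNIV. u b * (2 * u a * u b)) = 2 * u a * q"
      by (simp add: q_def sum_distrib_left power2_eq_square mult_ac)
    then show ?thesis
      by (simp add: kron_def distrib_left sum.distrib mult_delta_right mult_delta_left)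
        (simp add: eval_nat_numeral mult_ac)
  qed
  have "(\<Sum>a\<in>UNIV. u a * (3 * u a * q + \<kappa> a * u a ^ 3)) = 3 * q\<^sup>2 + (\<Sum>a\<in>UNIV. \<kappa> a * u a ^ 4)"
  proof -
    have "(\<Sum>a\<in>UNIV. u a * (3 * u a * q)) = 3 * q * q"
    proof -
      have "(\<Sum>a\<in>UNIV. u a * (3 * u a * q)) = (\<Sum>a\<in>UNIV. (u a)\<^sup>2 * (3 * q))"
        by (intro sum.cong) (simp_all add: power2_eq_square mult_ac)
      then show ?thesis unfolding sum_distrib_right[symmetric] q_def[symmetric] by simp
    qed
    then show ?thesis by (simp add: distrib_left sum.distrib power2_eq_square) (simp add: eval_nat_numeral mult_ac)
  qed
  then show ?thesis unfolding 1 2 3 by (simp add: q_def)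
qed

text \<open>Moves the inverse root from the data to the matrix: projections of whitened data become
  rows of \<open>W\<close> applied to centered data, and only centered moments have to be
  expanded.\<close>

lemma whitened_inner:
  "U $ k \<bullet> whitened x n i = (U ** mat_inv_sqrt (sample_cov x n)) $ k \<bullet> centered x n i"
  by (simp add: matrix_mult_row_inner whitened_def)

context spp_population
begin

text \<open>A configuration consists of a sample sequence, a sample size, and an orthogonal matrix.
  The filter describes small deviations of the sample moments, uniformly in the matrix.\<close>

definition config_filter :: "((nat \<Rightarrow> real ^ 'p) \<times> nat \<times> (real ^ 'p ^ 'p)) filter" where
  "config_filter = inf (filtercomap (\<lambda>(x, n, U). dev x n) (nhds 0))
     (principal {(x, n, U). 0 < n \<and> orthogonal_matrix U})"

text \<open>Translates between Landau statements and the uniform epsilon-delta statements needed at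
  the end.\<close>

lemma eventually_config_filter:
  "eventually P config_filter \<longleftrightarrow>
     (\<exists>\<rho>>0. \<forall>x n U. 0 < n \<longrightarrow> orthogonal_matrix U \<longrightarrow> dev x n < \<rho> \<longrightarrow> P (x, n, U))"
  (is "?L \<longleftrightarrow> ?R")
proof
  assume ?L
  then obtain Q where Q: "eventually Q (nhds 0)"
    "\<And>x n U. Q (dev x n) \<Longrightarrow> 0 < n \<Longrightarrow> orthogonal_matrix U \<Longrightarrow> P (x, n, U)"
    unfolding config_filter_def eventually_inf_principal eventually_filtercomap by force
  then obtain \<rho> where "\<rho> > 0" "\<And>t. dist t 0 < \<rho> \<Longrightarrow> Q t" unfolding eventually_nhds_metric by blast
  then show ?R using Q(2) dev_nonneg by (intro exI[of _ \<rho>]) (simp add: dist_real_def)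
next
  assume ?R
  then obtain \<rho> where \<rho>: "\<rho> > 0" "\<forall>x n U. 0 < n \<longrightarrow> orthogonal_matrix U \<longrightarrow> dev x n < \<rho> \<longrightarrow> P (x, n, U)" by blast
  have "eventually (\<lambda>t. t < \<rho>) (nhds 0)" using \<rho>(1)
    unfolding eventually_nhds_metric by (intro exI[of _ \<rho>]) (auto simp: dist_real_def)
  then show ?L
    unfolding config_filter_def eventually_inf_principal eventually_filtercomap using \<rho>(2) by force
qed

abbreviation (input) cdev where "cdev \<equiv> \<lambda>c. dev (fst c) (fst (snd c))"
abbreviation (input) cX where "cX \<equiv> \<lambda>c. fst c"
abbreviation (input) cN where "cN \<equiv> \<lambda>c. fst (snd c)"
abbreviation (input) cU where "cU \<equiv> \<lambda>c. snd (snd c)"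
abbreviation (input) cB where "cB \<equiv> \<lambda>c. mat_inv_sqrt (sample_cov (fst c) (fst (snd c)))"
abbreviation (input) cW where "cW \<equiv> \<lambda>c. snd (snd c) ** mat_inv_sqrt (sample_cov (fst c) (fst (snd c)))"

lemma eventually_config_basic:
  "eventually (\<lambda>c. 0 < cN c) config_filter" "eventually (\<lambda>c. orthogonal_matrix (cU c)) config_filter"
  by (auto simp: eventually_config_filter intro!: exI[of _ 1])

lemma cdev_smallo: "cdev \<in> o[config_filter](\<lambda>_. 1)"
proof (rule landau_o.smallI)
  fix e :: real assume "e > 0"
  then show "eventually (\<lambda>c. norm (cdev c) \<le> e * norm (1 :: real)) config_filter"
    unfolding eventually_config_filter by (intro exI[of _ e]) (auto simp: dev_nonneg)
qed

lemma config_bigo_dev: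
  shows "(\<lambda>c. raw1 (cX c) (cN c) a) \<in> O[config_filter](cdev)"
    and "(\<lambda>c. raw2 (cX c) (cN c) a b - kron a b) \<in> O[config_filter](cdev)"
    and "(\<lambda>c. raw3 (cX c) (cN c) a b d - mom3 \<gamma> a b d) \<in> O[config_filter](cdev)"
    and "\<alpha> \<noteq> 1 \<Longrightarrow> (\<lambda>c. raw4 (cX c) (cN c) a b d e - mom4 \<kappa> a b d e) \<in> O[config_filter](cdev)"
    and "(\<lambda>c. cB c $ a $ b - kron a b) \<in> O[config_filter](cdev)"
proof -
  show "(\<lambda>c. cB c $ a $ b - kron a b) \<in> O[config_filter](cdev)"
  proof (rule bigoI[of _ cov_const])
    have "cov_const > 0" using cov_const_ge by simp
    then show "eventually (\<lambda>c. norm (cB c $ a $ b - kron a b) \<le> cov_const * norm (cdev c)) config_filter"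
      unfolding eventually_config_filter
      by (intro exI[of _ "1 / cov_const"])
        (auto simp: dev_nonneg field_simps intro!: mat_inv_sqrt_cov_near_one(2))
  qed
qed (auto intro!: bigoI[of _ 1] always_eventually simp: dev_bounds dev_nonneg)

lemma near_of_bigo_dev:
  "(\<lambda>c. f c - g) \<in> O[config_filter](cdev) \<Longrightarrow> near config_filter f (\<lambda>_. g)"
  unfolding near_def using landau_o.big_small_trans[OF _ cdev_smallo] by auto

lemma near_raw:
  shows "near config_filter (\<lambda>c. raw1 (cX c) (cN c) a) (\<lambda>_. 0)"
    and "near config_filter (\<lambda>c. raw2 (cX c) (cN c) a b) (\<lambda>_. kron a b)"
    and "near config_filter (\<lambda>c. raw3 (cX c) (cN c) a b d) (\<lambda>_. mom3 \<gamma> a b d)"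
    and "\<alpha> \<noteq> 1 \<Longrightarrow> near config_filter (\<lambda>c. raw4 (cX c) (cN c) a b d e) (\<lambda>_. mom4 \<kappa> a b d e)"
  using config_bigo_dev by (auto intro!: near_of_bigo_dev)

lemma near_cen3:
  "near config_filter (\<lambda>c. raw3 (centered (cX c) (cN c)) (cN c) a b d) (\<lambda>_. mom3 \<gamma> a b d)"
proof (rule near_cong)
  let ?m = "\<lambda>a c. raw1 (cX c) (cN c) a" and ?s = "\<lambda>a b c. raw2 (cX c) (cN c) a b"
  \<comment> \<open>The limit keeps the shape of the expansion, with a zero for each sample mean, so
    that the closure rules apply term by term.\<close>
  show "near config_filter (\<lambda>c. raw3 (cX c) (cN c) a b d - ?m a c * ?s b d c - ?m b c * ?s a d c
      - ?m d c * ?s a b c + 2 * (?m a c * (?m b c * ?m d c)))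
    (\<lambda>_. mom3 \<gamma> a b d - 0 * kron b d - 0 * kron a d - 0 * kron a b + 2 * (0 * (0 * 0)))"
    by (intro near_add near_diff near_mult near_raw near_const)
qed (use eventually_config_basic(1) in \<open>auto elim!: eventually_mono simp: raw3_centered\<close>)

lemma near_cen4:
  assumes "\<alpha> \<noteq> 1"
  shows "near config_filter (\<lambda>c. raw4 (centered (cX c) (cN c)) (cN c) a b d e) (\<lambda>_. mom4 \<kappa> a b d e)"
proof (rule near_cong)
  let ?m = "\<lambda>a c. raw1 (cX c) (cN c) a" and ?s = "\<lambda>a b c. raw2 (cX c) (cN c) a b"
    and ?t = "\<lambda>a b d c. raw3 (cX c) (cN c) a b d"
  show "near config_filter (\<lambda>c. raw4 (cX c) (cN c) a b d e
      - ?m a c * ?t b d e c - ?m b c * ?t a d e c - ?m d c * ?t a b e c - ?m e c * ?t a b d c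
      + (?m a c * (?m b c * ?s d e c) + ?m a c * (?m d c * ?s b e c) + ?m a c * (?m e c * ?s b d c)
        + ?m b c * (?m d c * ?s a e c) + ?m b c * (?m e c * ?s a d c) + ?m d c * (?m e c * ?s a b c))
      - 3 * (?m a c * (?m b c * (?m d c * ?m e c))))
    (\<lambda>_. mom4 \<kappa> a b d e
      - 0 * mom3 \<gamma> b d e - 0 * mom3 \<gamma> a d e - 0 * mom3 \<gamma> a b e - 0 * mom3 \<gamma> a b d
      + (0 * (0 * kron d e) + 0 * (0 * kron b e) + 0 * (0 * kron b d)
        + 0 * (0 * kron a e) + 0 * (0 * kron a d) + 0 * (0 * kron a b))
      - 3 * (0 * (0 * (0 * 0))))"
    by (intro near_add near_diff near_mult near_raw near_const assms)
qed (use eventually_config_basic(1) in \<open>auto elim!: eventually_mono simp: raw4_centered\<close>)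

text \<open>Only boundedness has content here: it lets the matrix entries serve as targets inside
  products.\<close>

lemma near_U: "near config_filter (\<lambda>c. cU c $ k $ a) (\<lambda>c. cU c $ k $ a)"
proof -
  have "eventually (\<lambda>c. norm (cU c $ k $ a) \<le> 1 * norm (1 :: real)) config_filter"
    using eventually_config_basic(2)
  proof eventually_elim
    case (elim c)
    then have "(cU c $ k $ a)\<^sup>2 \<le> 1"
      by (intro unit_vector_nth_sq_le_1) (simp add: orthogonal_matrix_rows)
    then show ?case by (simp add: abs_square_le_1)
  qed
  then show ?thesis unfolding near_def by (auto intro: bigoI)
qed

lemma near_W: "near config_filter (\<lambda>c. cW c $ k $ a) (\<lambda>c. cU c $ k $ a)"
proof -
  have "near config_filter (\<lambda>c. \<Sum>j\<in>UNIV. cU c $ k $ j * cB c $ j $ a) (\<lambda>c. \<Sum>j\<in>UNIV. cU c $ k $ j * kron j a)"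
    by (intro near_sum near_mult near_U near_of_bigo_dev config_bigo_dev)
  then show ?thesis
    by (simp add: matrix_matrix_mult_def kron_def mult_delta_right)
qed

lemma near_objective:
  "near config_filter (\<lambda>c. spp_objective \<alpha> (cX c) (cN c) (cU c)) (\<lambda>c. pop_objective (cU c))"
proof -
  let ?y = "\<lambda>c. centered (cX c) (cN c)"
  let ?S = "\<lambda>m k c. smean (cN c) (\<lambda>i. (cU c $ k \<bullet> whitened (cX c) (cN c) i) ^ m)"
  have 3: "near config_filter (?S 3 k) (\<lambda>c. \<Sum>a\<in>UNIV. \<gamma> a * (cU c $ k $ a) ^ 3)" for k
  proof -
    have "near config_filter
        (\<lambda>c. \<Sum>a\<in>UNIV. cW c $ k $ a * (\<Sum>b\<in>UNIV. cW c $ k $ b * (\<Sum>d\<in>UNIV. cW c $ k $ d * raw3 (?y c) (cN c) a b d)))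
        (\<lambda>c. \<Sum>a\<in>UNIV. cU c $ k $ a * (\<Sum>b\<in>UNIV. cU c $ k $ b * (\<Sum>d\<in>UNIV. cU c $ k $ d * mom3 \<gamma> a b d)))"
      by (intro near_sum near_mult near_W near_cen3)
    then show ?thesis
      unfolding sum_mom3 smean_proj3[symmetric] whitened_inner by (simp add: power3_eq_cube mult.assoc)
  qed
  have 4: "near config_filter (\<lambda>c. ?S 4 k c - 3) (\<lambda>c. \<Sum>a\<in>UNIV. \<kappa> a * (cU c $ k $ a) ^ 4)" if "\<alpha> \<noteq> 1" for k
  proof (rule near_cong)
    show "near config_filter
        (\<lambda>c. (\<Sum>a\<in>UNIV. cW c $ k $ a * (\<Sum>b\<in>UNIV. cW c $ k $ b * (\<Sum>d\<in>UNIV. cW c $ k $ d *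
          (\<Sum>e\<in>UNIV. cW c $ k $ e * raw4 (?y c) (cN c) a b d e)))) - 3)
        (\<lambda>c. (\<Sum>a\<in>UNIV. cU c $ k $ a * (\<Sum>b\<in>UNIV. cU c $ k $ b * (\<Sum>d\<in>UNIV. cU c $ k $ d *
          (\<Sum>e\<in>UNIV. cU c $ k $ e * mom4 \<kappa> a b d e)))) - 3)"
      by (intro near_sum near_mult near_W near_cen4 near_diff near_const that)
    \<comment> \<open>The constant 3 subtracted in the objective cancels the pairings, because rows
      of an orthogonal matrix have norm 1.\<close>
    show "eventually (\<lambda>c. (\<Sum>a\<in>UNIV. cU c $ k $ a * (\<Sum>b\<in>UNIV. cU c $ k $ b * (\<Sum>d\<in>UNIV. cU c $ k $ d *
          (\<Sum>e\<in>UNIV. cU c $ k $ e * mom4 \<kappa> a b d e)))) - 3 = (\<Sum>a\<in>UNIV. \<kappa> a * (cU c $ k $ a) ^ 4)) config_filter"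
      using eventually_config_basic(2)
    proof eventually_elim
      case (elim c)
      then have "(\<Sum>a\<in>UNIV. (cU c $ k $ a)\<^sup>2) = 1"
        by (simp add: orthogonal_matrix_rows inner_vec_def power2_eq_square)
      then show ?case unfolding sum_mom4 by simp
    qed
  qed (simp add: smean_proj4[symmetric] whitened_inner power4_eq_xxxx mult.assoc)
  have "near config_filter (\<lambda>c. \<alpha> * (\<Sum>k\<in>UNIV. (?S 3 k c)\<^sup>2) + (1 - \<alpha>) * (\<Sum>k\<in>UNIV. (?S 4 k c - 3)\<^sup>2))
      (\<lambda>c. pop_objective (cU c))"
  \<comment> \<open>For \<alpha> = 1 the fourth moments are uncontrolled, and the kurtosis sum has
    to be removed by its zero factor before any estimate.\<close>
  proof (cases "\<alpha> = 1")
    case True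
    have "near config_filter (\<lambda>c. \<Sum>k\<in>UNIV. (?S 3 k c)\<^sup>2) (\<lambda>c. \<Sum>k\<in>UNIV. (\<Sum>a\<in>UNIV. \<gamma> a * (cU c $ k $ a) ^ 3)\<^sup>2)"
      by (intro near_sum near_power2 3)
    then show ?thesis unfolding pop_objective_def using True by simp
  next
    case False
    then show ?thesis unfolding pop_objective_def
      by (intro near_add near_mult near_sum near_power2 near_const 3 4)
  qed
  then show ?thesis by (simp add: spp_objective_def smean_def)
qed

definition is_spp_maximizer where
  "is_spp_maximizer x n \<equiv> is_arg_max (spp_objective \<alpha> x n) orthogonal_matrix"

lemma is_spp_maximizer_signed_row_perm:
  assumes "is_spp_maximizer x n U" "bij \<pi>" "\<And>k. \<sigma> k = 1 \<or> \<sigma> k = -1"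
  shows "is_spp_maximizer x n (signed_row_perm \<pi> \<sigma> U)"
  using assms spp_objective_signed_row_perm[OF assms(2,3)]
    orthogonal_signed_row_perm[OF bij_is_inj[OF assms(2)] assms(3)]
  by (simp add: is_spp_maximizer_def is_arg_max_def)

text \<open>A sample maximizer nearly maximizes the population objective, so it is close to some
  signed permutation. Undoing that permutation yields another sample maximizer, equally close to the
  identity, and the nearest one cannot be farther away.\<close>

lemma maximizer_consistency:
  assumes "\<rho> > 0"
  shows "\<exists>\<delta>>0. \<forall>x n U. 0 < n \<longrightarrow> dev x n < \<delta> \<longrightarrow> is_spp_maximizer x n U \<longrightarrow>
    (\<forall>V. is_spp_maximizer x n V \<longrightarrow> dist U (mat 1) \<le> dist V (mat 1)) \<longrightarrow> dist U (mat 1) < \<rho>"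
proof -
  obtain g where g: "g > 0"
    "\<And>U. orthogonal_matrix U \<Longrightarrow> pop_objective (mat 1) - g < pop_objective U \<Longrightarrow> \<exists>P\<in>signed_perms. dist U P < \<rho>"
    using pop_objective_gap[OF assms] by blast
  have "(\<lambda>c. spp_objective \<alpha> (cX c) (cN c) (cU c) - pop_objective (cU c)) \<in> o[config_filter](\<lambda>_. 1)"
    using near_objective by (simp add: near_def)
  \<comment> \<open>The approximation is used twice, at \<open>U\<close> and at the identity; thirds
    of the gap instead of halves keep the final inequality strict.\<close>
  then have "eventually (\<lambda>c. norm (spp_objective \<alpha> (cX c) (cN c) (cU c) - pop_objective (cU c))
      \<le> g / 3 * norm (1 :: real)) config_filter"
    using g(1) by (intro landau_o.smallD) auto
  then obtain \<delta> where \<delta>: "\<delta> > 0" "\<And>x n U. 0 < n \<Longrightarrow> orthogonal_matrix U \<Longrightarrow> dev x n < \<delta> \<Longrightarrow>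
      \<bar>spp_objective \<alpha> x n U - pop_objective U\<bar> \<le> g / 3"
    unfolding eventually_config_filter by auto
  show ?thesis
  proof (intro exI[of _ \<delta>] conjI allI impI \<delta>(1))
    fix x n U
    assume n: "0 < n" and d: "dev x n < \<delta>" and max: "is_spp_maximizer x n U"
      and closest: "\<forall>V. is_spp_maximizer x n V \<longrightarrow> dist U (mat 1) \<le> dist V (mat 1)"
    have U: "orthogonal_matrix U" and "spp_objective \<alpha> x n (mat 1) \<le> spp_objective \<alpha> x n U"
      using max orthogonal_matrix_id by (auto simp: is_spp_maximizer_def is_arg_max_def not_less)
    then have "pop_objective (mat 1) - g < pop_objective U"
      using \<delta>(2)[OF n U d] \<delta>(2)[OF n orthogonal_matrix_id d] g(1) by linarith
    then obtain \<pi> \<sigma> where P: "bij \<pi>" "\<And>k. \<sigma> k = 1 \<or> \<sigma> k = -1" "dist U (signed_perm_matrix \<pi> \<sigma>) < \<rho>"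
      using g(2)[OF U] unfolding signed_perms_def by blast
    let ?V = "signed_row_perm (inv \<pi>) (\<sigma> \<circ> inv \<pi>) U"
    have inv: "bij (inv \<pi>)" "\<And>k. (\<sigma> \<circ> inv \<pi>) k = 1 \<or> (\<sigma> \<circ> inv \<pi>) k = -1"
      using P(1,2) by (auto simp: bij_imp_bij_inv)
    have one: "mat 1 = signed_row_perm (inv \<pi>) (\<sigma> \<circ> inv \<pi>) (signed_perm_matrix \<pi> \<sigma>)"
      unfolding signed_perm_matrix_def
      using signed_row_perm_inverse_matrix[where \<sigma>=\<sigma>, OF P(1,2)] by simp
    have "dist ?V (mat 1) = dist U (signed_perm_matrix \<pi> \<sigma>)"
      unfolding one using inv by (rule dist_signed_row_perm)
    moreover have "dist U (mat 1) \<le> dist ?V (mat 1)"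
      by (rule closest[rule_format, OF is_spp_maximizer_signed_row_perm[OF max inv]])
    ultimately show "dist U (mat 1) < \<rho>" using P(3) by simp
  qed
qed

end

section \<open>Linearization of the first-order conditions\<close>

lemma bigo_cmult: "f \<in> O[F](g) \<Longrightarrow> (\<lambda>x. c * f x) \<in> O[F](g)" for c :: real
  by simp

text \<open>First-order expansions with respect to a gauge \<open>h\<close> tending to zero: a constant, a term of
  order \<open>h\<close>, and a remainder of order \<open>h\<^sup>2\<close>.\<close>

locale expansion =
  fixes F :: "'c filter" and h :: "'c \<Rightarrow> real"
  assumes h_small: "h \<in> o[F](\<lambda>_. 1)"
begin

text \<open>The term \<open>e\<close> is fixed only modulo \<open>h\<^sup>2\<close>, which lets each
  rule return an explicit expression instead of a canonical one.\<close>

definition lin :: "('c \<Rightarrow> real) \<Rightarrow> real \<Rightarrow> ('c \<Rightarrow> real) \<Rightarrow> bool" where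
  "lin f c e \<longleftrightarrow> (\<lambda>x. f x - c - e x) \<in> O[F](\<lambda>x. (h x)\<^sup>2) \<and> e \<in> O[F](h)"

lemma h_sq: "(\<lambda>x. (h x)\<^sup>2) \<in> o[F](h)"
  using landau_o.small_big_mult[OF h_small landau_o.big_refl[of h F]] by (simp add: power2_eq_square)

lemma bigo_h_mult: "f \<in> O[F](h) \<Longrightarrow> g \<in> O[F](h) \<Longrightarrow> (\<lambda>x. f x * g x) \<in> O[F](\<lambda>x. (h x)\<^sup>2)"
  using landau_o.big_mult[of f F h g h] by (simp add: power2_eq_square)

lemma bigo_h_bounded: "f \<in> O[F](h) \<Longrightarrow> f \<in> O[F](\<lambda>_. 1)"
  by (rule landau_o.big_trans[OF _ landau_o.small_imp_big[OF h_small]])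

lemma lin_const: "lin (\<lambda>_. c) c (\<lambda>_. 0)"
  by (simp add: lin_def)

lemma lin_of_bigo: "(\<lambda>x. f x - c) \<in> O[F](h) \<Longrightarrow> lin f c (\<lambda>x. f x - c)"
  by (simp add: lin_def)

lemma lin_add:
  assumes "lin f c e" "lin f' c' e'"
  shows "lin (\<lambda>x. f x + f' x) (c + c') (\<lambda>x. e x + e' x)"
  using sum_in_bigo(1)[of "\<lambda>x. f x - c - e x" F "\<lambda>x. (h x)\<^sup>2" "\<lambda>x. f' x - c' - e' x"]
    sum_in_bigo(1)[of e F h e'] assms
  by (simp add: lin_def algebra_simps)

lemma lin_diff:
  assumes "lin f c e" "lin f' c' e'"
  shows "lin (\<lambda>x. f x - f' x) (c - c') (\<lambda>x. e x - e' x)"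
  using sum_in_bigo(2)[of "\<lambda>x. f x - c - e x" F "\<lambda>x. (h x)\<^sup>2" "\<lambda>x. f' x - c' - e' x"]
    sum_in_bigo(2)[of e F h e'] assms
  by (simp add: lin_def algebra_simps)

lemma lin_mult:
  assumes f: "lin f c e" and g: "lin g d e'"
  shows "lin (\<lambda>x. f x * g x) (c * d) (\<lambda>x. c * e' x + d * e x)"
proof -
  let ?r = "\<lambda>x. f x - c - e x" and ?r' = "\<lambda>x. g x - d - e' x"
  have r: "?r \<in> O[F](\<lambda>x. (h x)\<^sup>2)" "?r' \<in> O[F](\<lambda>x. (h x)\<^sup>2)" "e \<in> O[F](h)" "e' \<in> O[F](h)"
    using f g by (auto simp: lin_def)
  have rh: "?r' \<in> O[F](h)"
    by (rule landau_o.big_trans[OF r(2) landau_o.small_imp_big[OF h_sq]])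
  have g1: "g \<in> O[F](\<lambda>_. 1)"
  proof -
    have "(\<lambda>x. ?r' x + d + e' x) \<in> O[F](\<lambda>_. 1)"
      by (intro sum_in_bigo bigo_h_bounded rh r bigo_const)
    then show ?thesis by simp
  qed
  \<comment> \<open>The error of the product rule, grouped so that every summand contains a
    remainder or two first-order factors.\<close>
  have "(\<lambda>x. ?r x * g x + e x * ?r' x + e x * e' x + c * ?r' x) \<in> O[F](\<lambda>x. (h x)\<^sup>2)"
    by (intro sum_in_bigo landau_o.big_1_mult r g1 bigo_h_mult rh bigo_cmult)
  moreover have "(\<lambda>x. ?r x * g x + e x * ?r' x + e x * e' x + c * ?r' x)
      = (\<lambda>x. f x * g x - c * d - (c * e' x + d * e x))"
    by (simp add: algebra_simps)
  ultimately show ?thesis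
    unfolding lin_def using r by (auto intro!: sum_in_bigo bigo_cmult)
qed

lemma lin_sum:
  assumes "\<And>a. a \<in> A \<Longrightarrow> lin (f a) (c a) (e a)"
  shows "lin (\<lambda>x. \<Sum>a\<in>A. f a x) (\<Sum>a\<in>A. c a) (\<lambda>x. \<Sum>a\<in>A. e a x)"
  using assms unfolding lin_def sum_subtractf[symmetric]
  by (intro conjI big_sum_in_bigo) auto

lemma lin_eq: "lin f c e \<Longrightarrow> c = c' \<Longrightarrow> (\<And>x. e x = e' x) \<Longrightarrow> lin f c' e'"
  by (metis ext)

lemma lin_cong:
  assumes "lin f c e" "eventually (\<lambda>x. f x = f' x) F"
  shows "lin f' c e"
proof -
  have "eventually (\<lambda>x. f x - c - e x = f' x - c - e x) F" using assms(2) by eventually_elim simp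
  from landau_o.big.in_cong[OF this] show ?thesis using assms(1) unfolding lin_def by simp
qed

text \<open>Contraction with a matrix near the identity selects index \<open>k\<close> to first
  order and adds one correction linear in the deviation of the matrix. Iterating it linearizes
  multilinear forms one index at a time.\<close>

lemma lin_contract:
  fixes k :: "'p::finite"
  assumes "\<And>a. lin (W a) (kron k a) (D a)" "\<And>a. lin (G a) (g a) (e a)"
  shows "lin (\<lambda>x. \<Sum>a\<in>UNIV. W a x * G a x) (g k) (\<lambda>x. e k x + (\<Sum>a\<in>UNIV. D a x * g a))"
proof -
  have "lin (\<lambda>x. \<Sum>a\<in>UNIV. W a x * G a x) (\<Sum>a\<in>UNIV. kron k a * g a)
      (\<lambda>x. \<Sum>a\<in>UNIV. kron k a * e a x + g a * D a x)"
    by (intro lin_sum lin_mult assms)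
  then show ?thesis
    by (rule lin_eq) (simp_all add: kron_def mult_delta_left mult_delta_right sum.distrib mult.commute)
qed

text \<open>Converts an exact equation into a linear relation with quadratic error.\<close>

lemma lin_vanish:
  assumes "lin f c e" "eventually (\<lambda>x. f x = c) F"
  shows "e \<in> O[F](\<lambda>x. (h x)\<^sup>2)"
proof -
  have "lin (\<lambda>_. c) c e" using assms by (rule lin_cong)
  then show ?thesis by (simp add: lin_def)
qed

end

lemma matrix_mult_nth: "(A ** B) $ k $ l = (\<Sum>j\<in>UNIV. A $ k $ j * B $ j $ l)"
  by (simp add: matrix_matrix_mult_def)

context spp_population
begin

text \<open>Restricts to maximizers approaching the identity. No rate of approach is built in; it
  has to be derived.\<close>

definition local_filter :: "((nat \<Rightarrow> real ^ 'p) \<times> nat \<times> (real ^ 'p ^ 'p)) filter" where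
  "local_filter = inf config_filter (inf (filtercomap (\<lambda>(x, n, U). dist U (mat 1)) (nhds 0))
     (principal {(x, n, U). is_spp_maximizer x n U}))"

lemma eventually_local_filterD:
  assumes "eventually P local_filter"
  shows "\<exists>\<rho>>0. \<forall>x n U. 0 < n \<longrightarrow> is_spp_maximizer x n U \<longrightarrow> dev x n < \<rho> \<longrightarrow>
    dist U (mat 1) < \<rho> \<longrightarrow> P (x, n, U)"
proof -
  obtain Q R where QR: "eventually Q config_filter"
    "eventually R (inf (filtercomap (\<lambda>(x, n, U). dist U (mat 1 :: real ^ 'p ^ 'p)) (nhds 0))
      (principal {(x, n, U). is_spp_maximizer x n U}))" "\<And>c. Q c \<Longrightarrow> R c \<Longrightarrow> P c"
    using assms unfolding local_filter_def eventually_inf by blast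
  obtain \<rho>1 where 1: "\<rho>1 > 0"
    "\<And>x n U. 0 < n \<Longrightarrow> orthogonal_matrix U \<Longrightarrow> dev x n < \<rho>1 \<Longrightarrow> Q (x, n, U)"
    using QR(1) unfolding eventually_config_filter by blast
  obtain S where S: "eventually S (nhds (0 :: real))"
    "\<And>x n U. S (dist U (mat 1)) \<Longrightarrow> is_spp_maximizer x n U \<Longrightarrow> R (x, n, U)"
    using QR(2) unfolding eventually_inf_principal eventually_filtercomap by force
  obtain \<rho>2 where 2: "\<rho>2 > 0" "\<And>t. dist t 0 < \<rho>2 \<Longrightarrow> S t"
    using S(1) unfolding eventually_nhds_metric by blast
  show ?thesis
  proof (intro exI[of _ "min \<rho>1 \<rho>2"] conjI allI impI)
    fix x n U assume *: "0 < n" "is_spp_maximizer x n U" "dev x n < min \<rho>1 \<rho>2" "dist U (mat 1) < min \<rho>1 \<rho>2"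
    have "orthogonal_matrix U" using *(2) by (simp add: is_spp_maximizer_def is_arg_max_def)
    then have "Q (x, n, U)" using * 1(2) by simp
    moreover have "R (x, n, U)" using * by (intro S(2) 2(2)) (simp_all add: dist_real_def)
    ultimately show "P (x, n, U)" by (rule QR(3))
  qed (use 1(1) 2(1) in simp)
qed

lemma local_filter_le: "local_filter \<le> config_filter"
  by (simp add: local_filter_def)

lemma eventually_local_maximizer: "eventually (\<lambda>c. is_spp_maximizer (cX c) (cN c) (cU c)) local_filter"
proof -
  have "local_filter \<le> principal {(x, n, U). is_spp_maximizer x n U}"
    by (auto simp: local_filter_def intro: le_infI2)
  from filter_leD[OF this] show ?thesis by (auto simp: eventually_principal)
qed

lemma eventually_local_n: "eventually (\<lambda>c. 0 < cN c) local_filter"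
  by (rule filter_leD[OF local_filter_le eventually_config_basic(1)])

lemma cU_tendsto_one: "((\<lambda>c. dist (cU c) (mat 1)) \<longlongrightarrow> 0) local_filter"
proof -
  have "((\<lambda>(x, n, U). dist U (mat 1)) \<longlongrightarrow> 0) local_filter"
    by (rule filterlim_mono[OF filterlim_filtercomap order_refl]) (auto simp: local_filter_def intro: le_infI1 le_infI2)
  then show ?thesis by (simp add: case_prod_unfold)
qed

abbreviation (input) cD where "cD k a \<equiv> \<lambda>c. cW c $ k $ a - kron k a"

text \<open>Includes the unknown error of \<open>W\<close>, because the expansions are quadratic in
  it as well. \<open>spp_expansion\<close> eliminates this part.\<close>

definition gauge :: "(nat \<Rightarrow> real ^ 'p) \<times> nat \<times> (real ^ 'p ^ 'p) \<Rightarrow> real" where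
  "gauge c = cdev c + (\<Sum>k\<in>UNIV. \<Sum>a\<in>UNIV. \<bar>cD k a c\<bar>)"

lemma cD_small: "cD k a \<in> o[local_filter](\<lambda>_. 1)"
proof -
  have "(\<lambda>c. cW c $ k $ a - cU c $ k $ a) \<in> o[local_filter](\<lambda>_. 1)"
    using near_W landau_o.small.filter_mono[OF local_filter_le] unfolding near_def by blast
  moreover have "(\<lambda>c. cU c $ k $ a - kron k a) \<in> o[local_filter](\<lambda>_. 1)"
  proof (rule smalloI_tendsto)
    have "\<bar>cU c $ k $ a - kron k a\<bar> \<le> dist (cU c) (mat 1)" for c :: "(nat \<Rightarrow> real ^ 'p) \<times> nat \<times> (real ^ 'p ^ 'p)"
    proof -
      have "\<bar>(cU c - mat 1) $ k $ a\<bar> \<le> norm ((cU c - mat 1) $ k)" by (rule component_le_norm_cart)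
      also have "\<dots> \<le> norm (cU c - mat 1)" by (rule Finite_Cartesian_Product.norm_nth_le)
      finally show ?thesis by (simp add: dist_norm kron_def mat_def)
    qed
    then have "((\<lambda>c. cU c $ k $ a - kron k a) \<longlongrightarrow> 0) local_filter"
      by (intro Lim_null_comparison[OF _ cU_tendsto_one] always_eventually) simp
    then show "((\<lambda>c. (cU c $ k $ a - kron k a) / 1) \<longlongrightarrow> 0) local_filter" by simp
  qed simp
  ultimately have "(\<lambda>c. (cW c $ k $ a - cU c $ k $ a) + (cU c $ k $ a - kron k a)) \<in> o[local_filter](\<lambda>_. 1)"
    by (rule sum_in_smallo)
  then show ?thesis by simp
qed

lemma gauge_small: "gauge \<in> o[local_filter](\<lambda>_. 1)"
  unfolding gauge_def
  using cD_small landau_o.small.filter_mono[OF local_filter_le cdev_smallo]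
  by (intro sum_in_smallo big_sum_in_smallo) auto

interpretation expansion local_filter gauge
  by standard (rule gauge_small)

lemma gauge_nonneg: "0 \<le> gauge c"
  unfolding gauge_def by (intro add_nonneg_nonneg sum_nonneg dev_nonneg) auto

lemma cdev_le_gauge: "cdev \<in> O[local_filter](gauge)"
proof (rule bigoI[of _ 1], rule always_eventually, rule allI)
  fix c show "norm (cdev c) \<le> 1 * norm (gauge c)"
    using gauge_nonneg[of c] by (simp add: gauge_def dev_nonneg sum_nonneg)
qed

lemma bigo_gauge: "f \<in> O[config_filter](cdev) \<Longrightarrow> f \<in> O[local_filter](gauge)"
  using landau_o.big_trans[OF landau_o.big.filter_mono[OF local_filter_le] cdev_le_gauge] .

lemma cD_le_gauge: "cD k a \<in> O[local_filter](gauge)"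
proof (rule bigoI[of _ 1], rule always_eventually, rule allI)
  fix c
  have "\<bar>cD k a c\<bar> \<le> (\<Sum>a\<in>UNIV. \<bar>cD k a c\<bar>)" by (rule member_le_sum) auto
  also have "\<dots> \<le> (\<Sum>k\<in>UNIV. \<Sum>a\<in>UNIV. \<bar>cD k a c\<bar>)"
    by (rule member_le_sum[where f="\<lambda>k. \<Sum>a\<in>UNIV. \<bar>cD k a c\<bar>"]) (auto intro: sum_nonneg)
  also have "\<dots> \<le> gauge c" by (simp add: gauge_def dev_nonneg)
  finally show "norm (cD k a c) \<le> 1 * norm (gauge c)" by simp
qed

lemma lin_W: "lin (\<lambda>c. cW c $ k $ a) (kron k a) (cD k a)"
  by (rule lin_of_bigo[OF cD_le_gauge])

section \<open>Expansions of centered and projected moments\<close>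

abbreviation (input) "m1 a \<equiv> \<lambda>c. raw1 (cX c) (cN c) a"
abbreviation (input) "d2 a b \<equiv> \<lambda>c. raw2 (cX c) (cN c) a b - kron a b"
abbreviation (input) "d3 a b d \<equiv> \<lambda>c. raw3 (cX c) (cN c) a b d - mom3 \<gamma> a b d"
abbreviation (input) "d4 a b d e \<equiv> \<lambda>c. raw4 (cX c) (cN c) a b d e - mom4 \<kappa> a b d e"

lemma lin_raw:
  shows "lin (m1 a) 0 (m1 a)"
    and "lin (\<lambda>c. raw2 (cX c) (cN c) a b) (kron a b) (d2 a b)"
    and "lin (\<lambda>c. raw3 (cX c) (cN c) a b d) (mom3 \<gamma> a b d) (d3 a b d)"
    and "\<alpha> \<noteq> 1 \<Longrightarrow> lin (\<lambda>c. raw4 (cX c) (cN c) a b d e) (mom4 \<kappa> a b d e) (d4 a b d e)"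
  using lin_of_bigo[of "m1 a" 0] lin_of_bigo bigo_gauge config_bigo_dev by auto

abbreviation (input) "e3 a b d \<equiv> \<lambda>c. d3 a b d c - kron b d * m1 a c - kron a d * m1 b c - kron a b * m1 d c"
abbreviation (input) "e4 a b d e \<equiv> \<lambda>c. d4 a b d e c - mom3 \<gamma> b d e * m1 a c - mom3 \<gamma> a d e * m1 b c
  - mom3 \<gamma> a b e * m1 d c - mom3 \<gamma> a b d * m1 e c"

text \<open>For second moments centering is a second-order effect, a product of two means.\<close>

lemma lin_cen2: "lin (\<lambda>c. raw2 (centered (cX c) (cN c)) (cN c) a b) (kron a b) (d2 a b)"
proof (rule lin_cong)
  show "lin (\<lambda>c. raw2 (cX c) (cN c) a b - m1 a c * m1 b c) (kron a b) (d2 a b)"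
    by (rule lin_eq, (rule lin_diff lin_mult lin_raw)+) simp_all
qed (use eventually_local_n in \<open>auto elim!: eventually_mono simp: raw2_centered\<close>)

lemma lin_cen3: "lin (\<lambda>c. raw3 (centered (cX c) (cN c)) (cN c) a b d) (mom3 \<gamma> a b d) (e3 a b d)"
proof (rule lin_cong)
  let ?s = "\<lambda>a b c. raw2 (cX c) (cN c) a b"
  show "lin (\<lambda>c. raw3 (cX c) (cN c) a b d - m1 a c * ?s b d c - m1 b c * ?s a d c
      - m1 d c * ?s a b c + 2 * (m1 a c * (m1 b c * m1 d c))) (mom3 \<gamma> a b d) (e3 a b d)"
    by (rule lin_eq, (rule lin_add lin_diff lin_mult lin_raw lin_const)+) simp_all
qed (use eventually_local_n in \<open>auto elim!: eventually_mono simp: raw3_centered\<close>)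

lemma lin_cen4:
  assumes "\<alpha> \<noteq> 1"
  shows "lin (\<lambda>c. raw4 (centered (cX c) (cN c)) (cN c) a b d e) (mom4 \<kappa> a b d e) (e4 a b d e)"
proof (rule lin_cong)
  let ?s = "\<lambda>a b c. raw2 (cX c) (cN c) a b" and ?t = "\<lambda>a b d c. raw3 (cX c) (cN c) a b d"
  show "lin (\<lambda>c. raw4 (cX c) (cN c) a b d e
      - m1 a c * ?t b d e c - m1 b c * ?t a d e c - m1 d c * ?t a b e c - m1 e c * ?t a b d c
      + (m1 a c * (m1 b c * ?s d e c) + m1 a c * (m1 d c * ?s b e c) + m1 a c * (m1 e c * ?s b d c)
        + m1 b c * (m1 d c * ?s a e c) + m1 b c * (m1 e c * ?s a d c) + m1 d c * (m1 e c * ?s a b c))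
      - 3 * (m1 a c * (m1 b c * (m1 d c * m1 e c)))) (mom4 \<kappa> a b d e) (e4 a b d e)"
    by (rule lin_eq, (rule lin_add lin_diff lin_mult lin_raw lin_raw(4)[OF assms] lin_const)+) simp_all
qed (use eventually_local_n in \<open>auto elim!: eventually_mono simp: raw4_centered\<close>)

abbreviation (input) "pr k i \<equiv> \<lambda>c. cU c $ k \<bullet> whitened (cX c) (cN c) i"

lemma lin_proj2:
  "lin (\<lambda>c. smean (cN c) (\<lambda>i. pr k i c * pr l i c)) (kron k l) (\<lambda>c. d2 k l c + cD l k c + cD k l c)"
  unfolding whitened_inner smean_proj2
proof (rule lin_eq)
  show "lin (\<lambda>c. \<Sum>a\<in>UNIV. cW c $ k $ a * (\<Sum>b\<in>UNIV. cW c $ l $ b * raw2 (centered (cX c) (cN c)) (cN c) a b))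
     (kron k l) (\<lambda>c. d2 k l c + (\<Sum>b\<in>UNIV. cD l b c * kron k b) + (\<Sum>a\<in>UNIV. cD k a c * kron a l))"
    by (intro lin_contract lin_W lin_cen2)
qed (simp_all add: kron_def mult_delta_right)

text \<open>Three applications of \<open>lin_contract\<close>, innermost index first; each leaves a
  correction in which one index of the limiting moment array is freed.\<close>

lemma lin_contract3:
  "lin (\<lambda>c. \<Sum>a\<in>UNIV. cW c $ k $ a * (\<Sum>b\<in>UNIV. cW c $ l $ b *
      (\<Sum>d\<in>UNIV. cW c $ m $ d * raw3 (centered (cX c) (cN c)) (cN c) a b d))) (mom3 \<gamma> k l m)
    (\<lambda>c. e3 k l m c + (\<Sum>d\<in>UNIV. cD m d c * mom3 \<gamma> k l d) + (\<Sum>b\<in>UNIV. cD l b c * mom3 \<gamma> k b m)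
      + (\<Sum>a\<in>UNIV. cD k a c * mom3 \<gamma> a l m))"
proof -
  have 1: "lin (\<lambda>c. \<Sum>d\<in>UNIV. cW c $ m $ d * raw3 (centered (cX c) (cN c)) (cN c) a b d) (mom3 \<gamma> a b m)
      (\<lambda>c. e3 a b m c + (\<Sum>d\<in>UNIV. cD m d c * mom3 \<gamma> a b d))" for a b
    by (rule lin_contract[OF lin_W lin_cen3])
  have 2: "lin (\<lambda>c. \<Sum>b\<in>UNIV. cW c $ l $ b * (\<Sum>d\<in>UNIV. cW c $ m $ d * raw3 (centered (cX c) (cN c)) (cN c) a b d))
      (mom3 \<gamma> a l m)
      (\<lambda>c. e3 a l m c + (\<Sum>d\<in>UNIV. cD m d c * mom3 \<gamma> a l d) + (\<Sum>b\<in>UNIV. cD l b c * mom3 \<gamma> a b m))" for a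
    by (rule lin_contract[OF lin_W 1])
  show ?thesis by (rule lin_contract[OF lin_W 2])
qed

lemma lin_contract4:
  assumes "\<alpha> \<noteq> 1"
  shows "lin (\<lambda>c. \<Sum>a\<in>UNIV. cW c $ k $ a * (\<Sum>b\<in>UNIV. cW c $ l $ b * (\<Sum>d\<in>UNIV. cW c $ m $ d *
      (\<Sum>e\<in>UNIV. cW c $ j $ e * raw4 (centered (cX c) (cN c)) (cN c) a b d e)))) (mom4 \<kappa> k l m j)
    (\<lambda>c. e4 k l m j c + (\<Sum>e\<in>UNIV. cD j e c * mom4 \<kappa> k l m e) + (\<Sum>d\<in>UNIV. cD m d c * mom4 \<kappa> k l d j)
      + (\<Sum>b\<in>UNIV. cD l b c * mom4 \<kappa> k b m j) + (\<Sum>a\<in>UNIV. cD k a c * mom4 \<kappa> a l m j))"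
proof -
  let ?r = "\<lambda>c. raw4 (centered (cX c) (cN c)) (cN c)"
  have 1: "lin (\<lambda>c. \<Sum>e\<in>UNIV. cW c $ j $ e * ?r c a b d e) (mom4 \<kappa> a b d j)
      (\<lambda>c. e4 a b d j c + (\<Sum>e\<in>UNIV. cD j e c * mom4 \<kappa> a b d e))" for a b d
    by (rule lin_contract[OF lin_W lin_cen4[OF assms]])
  have 2: "lin (\<lambda>c. \<Sum>d\<in>UNIV. cW c $ m $ d * (\<Sum>e\<in>UNIV. cW c $ j $ e * ?r c a b d e)) (mom4 \<kappa> a b m j)
      (\<lambda>c. e4 a b m j c + (\<Sum>e\<in>UNIV. cD j e c * mom4 \<kappa> a b m e) + (\<Sum>d\<in>UNIV. cD m d c * mom4 \<kappa> a b d j))" for a b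
    by (rule lin_contract[OF lin_W 1])
  have 3: "lin (\<lambda>c. \<Sum>b\<in>UNIV. cW c $ l $ b * (\<Sum>d\<in>UNIV. cW c $ m $ d * (\<Sum>e\<in>UNIV. cW c $ j $ e * ?r c a b d e)))
      (mom4 \<kappa> a l m j)
      (\<lambda>c. e4 a l m j c + (\<Sum>e\<in>UNIV. cD j e c * mom4 \<kappa> a l m e) + (\<Sum>d\<in>UNIV. cD m d c * mom4 \<kappa> a l d j)
        + (\<Sum>b\<in>UNIV. cD l b c * mom4 \<kappa> a b m j))" for a
    by (rule lin_contract[OF lin_W 2])
  show ?thesis by (rule lin_contract[OF lin_W 3])
qed

lemma r_hat_raw: "r_hat x n k l = raw3 x n k k l - raw1 x n l"
  unfolding raw3_def raw1_def smean_diff[symmetric]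
  by (simp add: r_hat_def smean_def power2_eq_square left_diff_distrib mult.assoc)

lemma q_hat_raw: "q_hat \<gamma> x n k l = raw4 x n k k k l - \<gamma> k * raw1 x n l"
  unfolding raw4_def raw1_def smean_cmult[symmetric] smean_diff[symmetric]
  by (simp add: q_hat_def smean_def power3_eq_cube left_diff_distrib mult.assoc)

lemma s_hat_raw: "s_hat x n k l = raw2 x n k l"
  by (simp add: s_hat_def raw2_def smean_def)

text \<open>Only the limit matters: in the first-order condition this factor multiplies one that
  tends to zero, so its own linear term drops out of the product rule.\<close>

lemma lin_proj3_diag:
  "\<exists>e. lin (\<lambda>c. smean (cN c) (\<lambda>i. (pr k i c) ^ 3)) (\<gamma> k) e"
  using lin_contract3[of k k k] unfolding smean_proj3[symmetric] whitened_inner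
  by (auto simp: mom3_def power3_eq_cube mult.assoc)

text \<open>Of the three corrections only the one freeing index \<open>l\<close> survives, as
  \<open>mom3\<close> vanishes off the diagonal; the linear mean term completes
  \<open>r_hat\<close>.\<close>

lemma lin_proj3:
  assumes "k \<noteq> l"
  shows "lin (\<lambda>c. smean (cN c) (\<lambda>i. (pr k i c)\<^sup>2 * pr l i c)) 0
    (\<lambda>c. r_hat (cX c) (cN c) k l + \<gamma> k * cD l k c)"
proof (rule lin_eq)
  show "lin (\<lambda>c. smean (cN c) (\<lambda>i. (pr k i c)\<^sup>2 * pr l i c)) (mom3 \<gamma> k k l)
      (\<lambda>c. e3 k k l c + (\<Sum>d\<in>UNIV. cD l d c * mom3 \<gamma> k k d) + (\<Sum>b\<in>UNIV. cD k b c * mom3 \<gamma> k b l)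
        + (\<Sum>a\<in>UNIV. cD k a c * mom3 \<gamma> a k l))"
    using lin_contract3[of k k l] unfolding smean_proj3[symmetric] whitened_inner power2_eq_square mult.assoc .
  show "mom3 \<gamma> k k l = 0" using assms by (simp add: mom3_def)
  fix c :: "(nat \<Rightarrow> real ^ 'p) \<times> nat \<times> (real ^ 'p ^ 'p)"
  note r_hat_raw[of "cX c" "cN c" k l]
  moreover have "(\<Sum>d\<in>UNIV. cD l d c * mom3 \<gamma> k k d) = \<gamma> k * cD l k c"
    by (simp add: mom3_def mult_delta_left mult_delta_right mult.commute)
  moreover have "(\<Sum>b\<in>UNIV. cD k b c * mom3 \<gamma> k b l) = 0" "(\<Sum>a\<in>UNIV. cD k a c * mom3 \<gamma> a k l) = 0"
    using assms by (auto intro!: sum.neutral simp: mom3_def)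
  ultimately show "e3 k k l c + (\<Sum>d\<in>UNIV. cD l d c * mom3 \<gamma> k k d) + (\<Sum>b\<in>UNIV. cD k b c * mom3 \<gamma> k b l)
        + (\<Sum>a\<in>UNIV. cD k a c * mom3 \<gamma> a k l) = r_hat (cX c) (cN c) k l + \<gamma> k * cD l k c"
    using assms by (simp add: mom3_def[of _ k k l] kron_def[of k l] kron_def[of k k])
qed

lemma lin_proj4_diag:
  assumes "\<alpha> \<noteq> 1"
  shows "\<exists>e. lin (\<lambda>c. smean (cN c) (\<lambda>i. (pr k i c) ^ 4) - 3) (\<kappa> k) e"
  using lin_diff[OF lin_contract4[OF assms, of k k k k] lin_const[of 3]]
  unfolding smean_proj4[symmetric] whitened_inner
  by (auto simp: mom4_def kron_def power4_eq_xxxx mult.assoc)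

text \<open>Freeing index \<open>l\<close> meets the diagonal moment \<open>3 + \<kappa> k\<close>.
  Freeing any of the three copies of \<open>k\<close> meets a pairing instead, which gives the
  coefficient 3 of \<open>cD k l\<close>.\<close>

lemma lin_proj4:
  assumes "\<alpha> \<noteq> 1" "k \<noteq> l"
  shows "lin (\<lambda>c. smean (cN c) (\<lambda>i. (pr k i c) ^ 3 * pr l i c)) 0
    (\<lambda>c. q_hat \<gamma> (cX c) (cN c) k l + (3 + \<kappa> k) * cD l k c + 3 * cD k l c)"
proof (rule lin_eq)
  let ?E = "\<lambda>c. e4 k k k l c + (\<Sum>e\<in>UNIV. cD l e c * mom4 \<kappa> k k k e) + (\<Sum>d\<in>UNIV. cD k d c * mom4 \<kappa> k k d l)
      + (\<Sum>b\<in>UNIV. cD k b c * mom4 \<kappa> k b k l) + (\<Sum>a\<in>UNIV. cD k a c * mom4 \<kappa> a k k l)"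
  show "lin (\<lambda>c. smean (cN c) (\<lambda>i. (pr k i c) ^ 3 * pr l i c)) (mom4 \<kappa> k k k l) ?E"
    using lin_contract4[OF assms(1), of k k k l]
    unfolding smean_proj4[symmetric] whitened_inner power3_eq_cube mult.assoc .
  show "mom4 \<kappa> k k k l = 0" using assms by (simp add: mom4_def kron_def)
  fix c :: "(nat \<Rightarrow> real ^ 'p) \<times> nat \<times> (real ^ 'p ^ 'p)"
  note q_hat_raw[of "cX c" "cN c" k l]
  moreover have "mom4 \<kappa> k k k e = (if k = e then 3 + \<kappa> k else 0)" for e
    by (simp add: mom4_def kron_def)
  then have "(\<Sum>e\<in>UNIV. cD l e c * mom4 \<kappa> k k k e) = (3 + \<kappa> k) * cD l k c"
    by (simp add: mult_delta_left mult_delta_right mult.commute)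
  moreover have "mom4 \<kappa> k k d l = (if d = l then 1 else 0)" "mom4 \<kappa> k d k l = (if d = l then 1 else 0)"
      "mom4 \<kappa> d k k l = (if d = l then 1 else 0)" for d
    using assms(2) by (auto simp: mom4_def kron_def)
  then have "(\<Sum>d\<in>UNIV. cD k d c * mom4 \<kappa> k k d l) = cD k l c" "(\<Sum>d\<in>UNIV. cD k d c * mom4 \<kappa> k d k l) = cD k l c"
      "(\<Sum>d\<in>UNIV. cD k d c * mom4 \<kappa> d k k l) = cD k l c"
    by (simp_all add: mult_delta_right)
  moreover have "mom4 \<kappa> k k k l = 0" "mom3 \<gamma> k k l = 0" "mom3 \<gamma> k k k = \<gamma> k"
    using assms(2) by (simp_all add: mom3_def mom4_def kron_def)
  ultimately show "?E c = q_hat \<gamma> (cX c) (cN c) k l + (3 + \<kappa> k) * cD l k c + 3 * cD k l c"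
    by simp
qed

section \<open>Leading terms and the quadratic remainder\<close>

definition lead_den :: "'p \<Rightarrow> 'p \<Rightarrow> real" where
  "lead_den k l = 3 * \<alpha> * ((\<gamma> k)\<^sup>2 + (\<gamma> l)\<^sup>2) + 4 * (1 - \<alpha>) * ((\<kappa> k)\<^sup>2 + (\<kappa> l)\<^sup>2)"

text \<open>The factor \<open>1 - \<alpha>\<close> stays attached to \<open>psi2_hat\<close>, so
  that for \<alpha> = 1 this part is zero before any fourth moment is estimated. The fourth moment
  is written \<open>\<kappa> k + 3\<close>, the locale fixing only the excess.\<close>

definition lead_num :: "(nat \<Rightarrow> real ^ 'p) \<Rightarrow> nat \<Rightarrow> 'p \<Rightarrow> 'p \<Rightarrow> real" where
  "lead_num x n k l = 3 * \<alpha> * psi1_hat \<gamma> x n k l + 4 * ((1 - \<alpha>) * psi2_hat \<gamma> (\<lambda>k. \<kappa> k + 3) \<kappa> x n k l)"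

definition lead :: "(nat \<Rightarrow> real ^ 'p) \<Rightarrow> nat \<Rightarrow> 'p \<Rightarrow> 'p \<Rightarrow> real" where
  "lead x n k l = (if k = l then - (1 / 2) * (s_hat x n k k - 1) else lead_num x n k l / lead_den k l)"

lemma lead_den_pos:
  assumes "k \<noteq> l"
  shows "0 < lead_den k l"
proof -
  have "lead_den k l = 3 * (\<alpha> * ((\<gamma> k)\<^sup>2 + (\<gamma> l)\<^sup>2)) + 4 * ((1 - \<alpha>) * ((\<kappa> k)\<^sup>2 + (\<kappa> l)\<^sup>2))"
    by (simp add: lead_den_def)
  moreover have "0 \<le> (1 - \<alpha>) * ((\<kappa> k)\<^sup>2 + (\<kappa> l)\<^sup>2)" using \<alpha> by simp
  ultimately show ?thesis using ident[OF assms] by linarith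
qed

text \<open>The leading terms do not involve \<open>W\<close>; this bound is what allows the gauge
  to be traded for the moment deviation.\<close>

lemma lead_bigo_dev: "(\<lambda>c. lead (cX c) (cN c) k l) \<in> O[config_filter](cdev)"
proof (cases "k = l")
  case True
  then show ?thesis
    using config_bigo_dev(2)[of k k] by (simp add: lead_def s_hat_raw kron_def)
next
  case False
  have s: "(\<lambda>c. s_hat (cX c) (cN c) k l) \<in> O[config_filter](cdev)"
    using config_bigo_dev(2)[of k l] False by (simp add: s_hat_raw kron_def)
  have r: "(\<lambda>c. r_hat (cX c) (cN c) a b) \<in> O[config_filter](cdev)" if "a \<noteq> b" for a b
  proof -
    have "mom3 \<gamma> a a b = 0" using that by (simp add: mom3_def)
    then show ?thesis using sum_in_bigo(2)[OF config_bigo_dev(3)[of a a b] config_bigo_dev(1)[of b]]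
      by (simp add: r_hat_raw)
  qed
  have 1: "(\<lambda>c. psi1_hat \<gamma> (cX c) (cN c) k l) \<in> O[config_filter](cdev)"
    unfolding psi1_hat_def using False r s by (intro sum_in_bigo) auto
  have 2: "(\<lambda>c. (1 - \<alpha>) * psi2_hat \<gamma> (\<lambda>k. \<kappa> k + 3) \<kappa> (cX c) (cN c) k l) \<in> O[config_filter](cdev)"
  proof (cases "\<alpha> = 1")
    case \<alpha>1: False
    have "(\<lambda>c. q_hat \<gamma> (cX c) (cN c) a b) \<in> O[config_filter](cdev)" if "a \<noteq> b" for a b
    proof -
      have "mom4 \<kappa> a a a b = 0" using that by (simp add: mom4_def kron_def)
      moreover have "(\<lambda>c. \<gamma> a * raw1 (cX c) (cN c) b) \<in> O[config_filter](cdev)"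
        using config_bigo_dev(1)[of b] by simp
      ultimately show ?thesis using sum_in_bigo(2)[OF config_bigo_dev(4)[OF \<alpha>1, of a a a b]]
        by (fastforce simp add: q_hat_raw)
    qed
    then have "(\<lambda>c. psi2_hat \<gamma> (\<lambda>k. \<kappa> k + 3) \<kappa> (cX c) (cN c) k l) \<in> O[config_filter](cdev)"
      unfolding psi2_hat_def using False s by (intro sum_in_bigo) auto
    then show ?thesis by simp
  qed simp
  have "(\<lambda>c. lead_num (cX c) (cN c) k l) \<in> O[config_filter](cdev)"
    unfolding lead_num_def by (intro sum_in_bigo bigo_cmult 1 2)
  then show ?thesis using False lead_den_pos[OF False] by (simp add: lead_def)
qed

text \<open>Only eventual, because the inverse root inverts the covariance only when that is
  positive definite, which holds once the deviation is at most \<open>1 / cov_const\<close>.\<close>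

lemma eventually_local_constraint:
  "eventually (\<lambda>c. smean (cN c) (\<lambda>i. pr k i c * pr l i c) = kron k l) local_filter"
proof -
  have "eventually (\<lambda>c. pos_def_matrix (sample_cov (cX c) (cN c))) config_filter"
    unfolding eventually_config_filter using cov_const_ge
    by (intro exI[of _ "1 / cov_const"])
      (auto simp: field_simps intro!: mat_inv_sqrt_cov_near_one(1))
  from filter_leD[OF local_filter_le this] filter_leD[OF local_filter_le eventually_config_basic(2)]
  show ?thesis
  proof eventually_elim
    case (elim c)
    let ?S = "sample_cov (cX c) (cN c)"
    have "smean (cN c) (\<lambda>i. pr k i c * pr l i c) = (\<Sum>a\<in>UNIV. \<Sum>b\<in>UNIV. cW c $ k $ a * ?S $ a $ b * cW c $ l $ b)"
      by (simp add: whitened_inner smean_proj2 sample_cov_nth sum_distrib_left mult_ac)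
    also have "\<dots> = (cW c ** ?S ** transpose (cW c)) $ k $ l"
      by (subst sum.swap) (simp add: matrix_mult_nth transpose_def sum_distrib_right)
    also have "\<dots> = kron k l"
      using spp_constraint[OF elim(2,1)] by (simp add: mat_def kron_def)
    finally show ?case .
  qed
qed

text \<open>Eliminating \<open>D' = w\<^sub>l\<^sub>k\<close> by the constraint \<open>s + D' + D = O(h\<^sup>2)\<close> from the
  first-order condition leaves a multiple of \<open>D = w\<^sub>k\<^sub>l\<close>.\<close>

lemma solve_constraint:
  fixes a gk gl kk kl s r r' q q' D D' :: real
  shows "(3 * a * gk\<^sup>2 + 4 * (1 - a) * (kk * (3 + kk) - 3 * kl)) * (s + D' + D)
      - (3 * a * (gk * (r + gk * D') - gl * (r' + gl * D))
         + 4 * ((1 - a) * (kk * (q + (3 + kk) * D' + 3 * D) - kl * (q' + (3 + kl) * D + 3 * D'))))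
    = (3 * a * (gk\<^sup>2 + gl\<^sup>2) + 4 * (1 - a) * (kk\<^sup>2 + kl\<^sup>2)) * D
      - (3 * a * (gk * r - gl * r' - gk\<^sup>2 * s)
         + 4 * ((1 - a) * (kk * q - kl * q' - (kk * (kk + 3) - 3 * kl) * s)))"
  by (simp add: algebra_simps power2_eq_square)

lemma spp_remainder:
  "(\<lambda>c. cD k l c - lead (cX c) (cN c) k l) \<in> O[local_filter](\<lambda>c. (gauge c)\<^sup>2)"
proof (cases "k = l")
  case True
  \<comment> \<open>On the diagonal the constraint alone determines the entry; this is where the
    universal factor -1/2 comes from.\<close>
  have "(\<lambda>c. (1 / 2) * (d2 k k c + cD k k c + cD k k c)) \<in> O[local_filter](\<lambda>c. (gauge c)\<^sup>2)"
    by (intro bigo_cmult lin_vanish[OF lin_proj2 eventually_local_constraint])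
  moreover have "(1 / 2) * (d2 k k c + cD k k c + cD k k c) = cD k l c - lead (cX c) (cN c) k l"
    for c :: "(nat \<Rightarrow> real ^ 'p) \<times> nat \<times> (real ^ 'p ^ 'p)"
    using True by (simp add: lead_def s_hat_raw kron_def field_simps)
  ultimately show ?thesis by (simp only:)
next
  case False
  let ?A3 = "\<lambda>k c. smean (cN c) (\<lambda>i. (pr k i c) ^ 3)"
    and ?B3 = "\<lambda>k l c. smean (cN c) (\<lambda>i. (pr k i c)\<^sup>2 * pr l i c)"
    and ?A4 = "\<lambda>k c. smean (cN c) (\<lambda>i. (pr k i c) ^ 4) - 3"
    and ?B4 = "\<lambda>k l c. smean (cN c) (\<lambda>i. (pr k i c) ^ 3 * pr l i c)"
  let ?f3 = "\<lambda>k l c. r_hat (cX c) (cN c) k l + \<gamma> k * cD l k c"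
    and ?f4 = "\<lambda>k l c. q_hat \<gamma> (cX c) (cN c) k l + (3 + \<kappa> k) * cD l k c + 3 * cD k l c"
  have 3: "lin (\<lambda>c. ?A3 k c * ?B3 k l c) 0 (\<lambda>c. \<gamma> k * ?f3 k l c)" if "k \<noteq> l" for k l
  proof -
    obtain e where "lin (?A3 k) (\<gamma> k) e" using lin_proj3_diag by blast
    from lin_mult[OF this lin_proj3[OF that]] show ?thesis by (rule lin_eq) simp_all
  qed
  have 4: "lin (\<lambda>c. ?A4 k c * ?B4 k l c) 0 (\<lambda>c. \<kappa> k * ?f4 k l c)" if a1: "\<alpha> \<noteq> 1" and kl: "k \<noteq> l" for k l
  proof -
    obtain e where "lin (?A4 k) (\<kappa> k) e" using lin_proj4_diag[OF a1] by blast
    from lin_mult[OF this lin_proj4[OF a1 kl]] show ?thesis by (rule lin_eq) simp_all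
  qed
  \<comment> \<open>The kurtosis part is expanded together with its factor, since for \<alpha> = 1
    only the zero product has an expansion at hand.\<close>
  have "lin (\<lambda>c. (1 - \<alpha>) * (?A4 k c * ?B4 k l c - ?A4 l c * ?B4 l k c)) 0
      (\<lambda>c. (1 - \<alpha>) * (\<kappa> k * ?f4 k l c - \<kappa> l * ?f4 l k c))"
  proof (cases "\<alpha> = 1")
    case True
    then show ?thesis using lin_const[of 0] by simp
  next
    case \<alpha>1: False
    show ?thesis
      by (rule lin_eq[OF lin_mult[OF lin_const lin_diff[OF 4[OF \<alpha>1 False] 4[OF \<alpha>1 False[symmetric]]]]]) simp_all
  qed
  then have "lin (\<lambda>c. 3 * \<alpha> * (?A3 k c * ?B3 k l c - ?A3 l c * ?B3 l k c)
      + 4 * ((1 - \<alpha>) * (?A4 k c * ?B4 k l c - ?A4 l c * ?B4 l k c))) 0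
      (\<lambda>c. 3 * \<alpha> * (\<gamma> k * ?f3 k l c - \<gamma> l * ?f3 l k c) + 4 * ((1 - \<alpha>) * (\<kappa> k * ?f4 k l c - \<kappa> l * ?f4 l k c)))"
    (is "lin ?FOC 0 ?E1")
    by (intro lin_eq[OF lin_add[OF lin_mult[OF lin_const lin_diff[OF 3[OF False] 3[OF False[symmetric]]]]
          lin_mult[OF lin_const[of 4]]]]) simp_all
  moreover have "eventually (\<lambda>c. ?FOC c = 0) local_filter"
    using eventually_local_maximizer
  proof eventually_elim
    case (elim c)
    from spp_first_order_condition[OF elim[unfolded is_spp_maximizer_def] False]
    show ?case by (simp only: mult.assoc)
  qed
  ultimately have E1: "?E1 \<in> O[local_filter](\<lambda>c. (gauge c)\<^sup>2)" by (rule lin_vanish)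
  let ?E2 = "\<lambda>c. d2 k l c + cD l k c + cD k l c"
  have E2: "?E2 \<in> O[local_filter](\<lambda>c. (gauge c)\<^sup>2)"
    by (rule lin_vanish[OF lin_proj2 eventually_local_constraint])
  \<comment> \<open>The total coefficient of \<open>cD l k\<close> in the linearized first-order
    condition, hence the multiple of the constraint to be subtracted.\<close>
  define w where "w = 3 * \<alpha> * (\<gamma> k)\<^sup>2 + 4 * (1 - \<alpha>) * (\<kappa> k * (3 + \<kappa> k) - 3 * \<kappa> l)"
  have "(\<lambda>c. (1 / lead_den k l) * (w * ?E2 c - ?E1 c)) \<in> O[local_filter](\<lambda>c. (gauge c)\<^sup>2)"
    by (intro bigo_cmult sum_in_bigo E1 E2)
  moreover have "(1 / lead_den k l) * (w * ?E2 c - ?E1 c) = cD k l c - lead (cX c) (cN c) k l"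
    for c :: "(nat \<Rightarrow> real ^ 'p) \<times> nat \<times> (real ^ 'p ^ 'p)"
  proof -
    define s r r' q q' D D' where "s = s_hat (cX c) (cN c) k l" and "r = r_hat (cX c) (cN c) k l"
      and "r' = r_hat (cX c) (cN c) l k" and "q = q_hat \<gamma> (cX c) (cN c) k l"
      and "q' = q_hat \<gamma> (cX c) (cN c) l k" and "D = cD k l c" and "D' = cD l k c"
    have "?E2 c = s + D' + D" using False by (simp add: s_def s_hat_raw D_def D'_def kron_def)
    moreover have "?E1 c = 3 * \<alpha> * (\<gamma> k * (r + \<gamma> k * D') - \<gamma> l * (r' + \<gamma> l * D))
        + 4 * ((1 - \<alpha>) * (\<kappa> k * (q + (3 + \<kappa> k) * D' + 3 * D) - \<kappa> l * (q' + (3 + \<kappa> l) * D + 3 * D')))"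
      by (simp only: r_def r'_def q_def q'_def D_def D'_def)
    moreover have "lead_num (cX c) (cN c) k l = 3 * \<alpha> * (\<gamma> k * r - \<gamma> l * r' - (\<gamma> k)\<^sup>2 * s)
        + 4 * ((1 - \<alpha>) * (\<kappa> k * q - \<kappa> l * q' - (\<kappa> k * (\<kappa> k + 3) - 3 * \<kappa> l) * s))"
      by (simp only: lead_num_def psi1_hat_def psi2_hat_def r_def r'_def q_def q'_def s_def)
    ultimately have "w * ?E2 c - ?E1 c = lead_den k l * D - lead_num (cX c) (cN c) k l"
      unfolding w_def lead_den_def by (simp only: solve_constraint)
    then show ?thesis
      using lead_den_pos[OF False] False by (simp add: lead_def D_def divide_simps)
  qed
  ultimately show ?thesis by (simp only:)
qed

text \<open>A bootstrap: the remainders sum to a quantity of order gauge squared, hence eventually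
  at most half the gauge. The gauge is then at most twice the deviation plus the leading terms, so
  it is of the order of the deviation, and the remainder is quadratic in the deviation
  alone.\<close>

lemma spp_expansion:
  "\<exists>K \<delta>. 0 < \<delta> \<and> (\<forall>x n U. 0 < n \<longrightarrow> is_spp_maximizer x n U \<longrightarrow> dev x n < \<delta> \<longrightarrow> dist U (mat 1) < \<delta> \<longrightarrow>
     (\<forall>k l. \<bar>(U ** mat_inv_sqrt (sample_cov x n)) $ k $ l - kron k l - lead x n k l\<bar> \<le> K * (dev x n)\<^sup>2))"
proof -
  let ?f = "\<lambda>c. cdev c + (\<Sum>k\<in>UNIV. \<Sum>l\<in>UNIV. \<bar>lead (cX c) (cN c) k l\<bar>)"
  let ?g = "\<lambda>c. \<Sum>k\<in>UNIV. \<Sum>l\<in>UNIV. \<bar>cD k l c - lead (cX c) (cN c) k l\<bar>"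
  have g: "?g \<in> O[local_filter](\<lambda>c. (gauge c)\<^sup>2)"
    using spp_remainder by (intro big_sum_in_bigo) simp
  have "?g \<in> o[local_filter](gauge)" by (rule landau_o.big_small_trans[OF g h_sq])
  then have ev: "eventually (\<lambda>c. norm (?g c) \<le> (1 / 2) * norm (gauge c)) local_filter"
    by (rule landau_o.smallD) simp
  \<comment> \<open>The absorption: \<open>g\<close> is moved to the left side at the cost of a
    factor 2.\<close>
  have aux: "\<bar>G\<bar> \<le> 2 * \<bar>f\<bar>" if "G \<le> f + g" "\<bar>g\<bar> \<le> (1 / 2) * \<bar>G\<bar>" "0 \<le> G" for G f g :: real
    using that by linarith
  have "eventually (\<lambda>c. norm (gauge c) \<le> 2 * norm (?f c)) local_filter"
    using ev
  proof eventually_elim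
    case (elim c)
    have "\<bar>cD k l c\<bar> \<le> \<bar>lead (cX c) (cN c) k l\<bar> + \<bar>cD k l c - lead (cX c) (cN c) k l\<bar>" for k l by linarith
    then have "gauge c \<le> cdev c + (\<Sum>k\<in>UNIV. \<Sum>l\<in>UNIV. \<bar>lead (cX c) (cN c) k l\<bar> + \<bar>cD k l c - lead (cX c) (cN c) k l\<bar>)"
      unfolding gauge_def by (intro add_left_mono sum_mono)
    also have "\<dots> = ?f c + ?g c" by (simp add: sum.distrib)
    finally have "gauge c \<le> ?f c + ?g c" .
    then show ?case using elim gauge_nonneg[of c] unfolding real_norm_def by (rule aux)
  qed
  then have "gauge \<in> O[local_filter](?f)" by (rule bigoI)
  also have "?f \<in> O[local_filter](cdev)"
    using landau_o.big.filter_mono[OF local_filter_le lead_bigo_dev]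
    by (intro sum_in_bigo big_sum_in_bigo) auto
  finally have "gauge \<in> O[local_filter](cdev)" .
  then have "(\<lambda>c. (gauge c)\<^sup>2) \<in> O[local_filter](\<lambda>c. (cdev c)\<^sup>2)" by (rule landau_o.big_power)
  with g have "?g \<in> O[local_filter](\<lambda>c. (cdev c)\<^sup>2)" by (rule landau_o.big_trans)
  then obtain K where "eventually (\<lambda>c. norm (?g c) \<le> K * norm ((cdev c)\<^sup>2)) local_filter"
    by (elim landau_o.bigE)
  then obtain \<delta> where \<delta>: "\<delta> > 0" "\<And>x n U. 0 < n \<Longrightarrow> is_spp_maximizer x n U \<Longrightarrow> dev x n < \<delta> \<Longrightarrow>
      dist U (mat 1) < \<delta> \<Longrightarrow> norm (?g (x, n, U)) \<le> K * norm ((cdev (x, n, U))\<^sup>2)"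
    using eventually_local_filterD by blast
  have "\<bar>cD k l c - lead (cX c) (cN c) k l\<bar> \<le> norm (?g c)" for k l
    and c :: "(nat \<Rightarrow> real ^ 'p) \<times> nat \<times> (real ^ 'p ^ 'p)"
  proof -
    have "\<bar>cD k l c - lead (cX c) (cN c) k l\<bar> \<le> (\<Sum>l\<in>UNIV. \<bar>cD k l c - lead (cX c) (cN c) k l\<bar>)"
      by (rule member_le_sum[where f="\<lambda>l. \<bar>cD k l c - lead (cX c) (cN c) k l\<bar>"]) auto
    also have "\<dots> \<le> ?g c"
      by (rule member_le_sum[where f="\<lambda>k. \<Sum>l\<in>UNIV. \<bar>cD k l c - lead (cX c) (cN c) k l\<bar>"]) (auto intro: sum_nonneg)
    finally show ?thesis by simp
  qed
  note le = this
  have "\<bar>(U ** mat_inv_sqrt (sample_cov x n)) $ k $ l - kron k l - lead x n k l\<bar> \<le> K * (dev x n)\<^sup>2"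
    if "0 < n" "is_spp_maximizer x n U" "dev x n < \<delta>" "dist U (mat 1) < \<delta>" for x n U k l
  proof -
    have "\<bar>cD k l (x, n, U) - lead (cX (x, n, U)) (cN (x, n, U)) k l\<bar> \<le> norm (?g (x, n, U))" by (rule le)
    from order_trans[OF this \<delta>(2)[OF that]] show ?thesis by simp
  qed
  then show ?thesis using \<delta>(1) by blast
qed

end

section \<open>Sample moments in probability\<close>

text \<open>Meant for squared deviations, where a mean of order 1/n is the root-n rate. A bound on
  means, unlike a limit law, is stable under finite sums without any joint information.\<close>

definition root_n_consistent :: "'a measure \<Rightarrow> (nat \<Rightarrow> 'a \<Rightarrow> real) \<Rightarrow> bool" where
  "root_n_consistent M f \<longleftrightarrow>
     (\<exists>C. \<forall>n>0. integrable M (f n) \<and> (LINT \<omega>|M. f n \<omega>) \<le> C / real n)"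

lemma root_n_consistent_zero: "root_n_consistent M (\<lambda>_ _. 0)"
  unfolding root_n_consistent_def by (intro exI[of _ 0]) simp

lemma root_n_consistent_add:
  assumes "root_n_consistent M f" "root_n_consistent M g"
  shows "root_n_consistent M (\<lambda>n \<omega>. f n \<omega> + g n \<omega>)"
proof -
  obtain C D where "\<forall>n>0. integrable M (f n) \<and> (LINT \<omega>|M. f n \<omega>) \<le> C / real n"
    "\<forall>n>0. integrable M (g n) \<and> (LINT \<omega>|M. g n \<omega>) \<le> D / real n"
    using assms unfolding root_n_consistent_def by blast
  then show ?thesis unfolding root_n_consistent_def
    by (intro exI[of _ "C + D"]) (auto simp: add_divide_distrib intro: add_mono)
qed

lemma root_n_consistent_sum:
  assumes "finite A" "\<And>a. a \<in> A \<Longrightarrow> root_n_consistent M (f a)"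
  shows "root_n_consistent M (\<lambda>n \<omega>. \<Sum>a\<in>A. f a n \<omega>)"
  using assms by (induction rule: finite_induct) (auto intro: root_n_consistent_zero root_n_consistent_add)

lemma norm_power_mono:
  fixes t :: real
  assumes "0 \<le> t" "m \<le> k"
  shows "t ^ m \<le> 1 + t ^ k"
proof (cases "t \<le> 1")
  case True
  then have "t ^ m \<le> 1" using assms(1) by (simp add: power_le_one)
  then show ?thesis using assms(1) zero_le_power[of t k] by linarith
next
  case False
  then have "t ^ m \<le> t ^ k" using assms(2) by (intro power_increasing) auto
  then show ?thesis by linarith
qed

locale independent_components = prob_space M for M :: "'a measure" +
  fixes z :: "'a \<Rightarrow> real ^ 'p"
  assumes z [measurable]: "z \<in> borel_measurable M"
    and indep: "indep_vars (\<lambda>_. borel) (\<lambda>k \<omega>. z \<omega> $ k) UNIV"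
    and mean: "expectation (\<lambda>\<omega>. z \<omega> $ k) = 0"
    and var: "variance (\<lambda>\<omega>. z \<omega> $ k) = 1"
begin

lemma integrable_monomial:
  assumes "integrable M (\<lambda>\<omega>. norm (z \<omega>) ^ K)" "m \<le> K"
    and [measurable]: "f \<in> borel_measurable M" and "\<And>\<omega>. \<bar>f \<omega>\<bar> \<le> norm (z \<omega>) ^ m"
  shows "integrable M f"
proof (rule Bochner_Integration.integrable_bound)
  show "integrable M (\<lambda>\<omega>. 1 + norm (z \<omega>) ^ K)" using assms(1) by simp
  show "AE \<omega> in M. norm (f \<omega>) \<le> norm (1 + norm (z \<omega>) ^ K)"
    using assms(4) norm_power_mono[OF norm_ge_zero assms(2)] by (auto intro!: AE_I2 intro: order_trans)
qed simp

definition cmom :: "'p \<Rightarrow> nat \<Rightarrow> real" where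
  "cmom k m = expectation (\<lambda>\<omega>. (z \<omega> $ k) ^ m)"

lemma cmom_simps:
  shows "cmom k 0 = 1" "cmom k 1 = 0" "cmom k 2 = 1" "cmom k 3 = gam M z k" "cmom k 4 = kap M z k + 3"
  using mean[of k] var[of k] by (simp_all add: cmom_def gam_def kap_def bet_def prob_space)

text \<open>Each exponent, not their sum, has to stay below \<open>K\<close>: by independence,
  integrable factors suffice.\<close>

lemma expectation_prod_power:
  assumes int: "integrable M (\<lambda>\<omega>. norm (z \<omega>) ^ K)" and m: "\<And>k. m k \<le> K"
  shows "expectation (\<lambda>\<omega>. \<Prod>k\<in>UNIV. (z \<omega> $ k) ^ m k) = (\<Prod>k\<in>UNIV. cmom k (m k))"
  unfolding cmom_def
proof (rule indep_vars_lebesgue_integral)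
  show "indep_vars (\<lambda>_. borel) (\<lambda>k \<omega>. (z \<omega> $ k) ^ m k) UNIV"
    by (rule indep_vars_compose2[OF indep]) simp
  show "integrable M (\<lambda>\<omega>. (z \<omega> $ k) ^ m k)" for k
    by (rule integrable_monomial[OF int m[of k]]) (simp_all add: power_abs power_mono component_le_norm_cart)
qed simp

text \<open>Encodes a coordinate as a monomial with an indicator exponent, so that a mixed moment is
  read off from index multiplicities.\<close>

lemma prod_of_bool_power: "(\<Prod>k\<in>UNIV. (v $ k) ^ of_bool (k = a)) = v $ a" for v :: "real ^ 'p"
proof -
  have "(\<Prod>k\<in>UNIV. (v $ k) ^ of_bool (k = a)) = (\<Prod>k\<in>UNIV. if k = a then v $ k else 1)"
    by (intro prod.cong) auto
  then show ?thesis by simp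
qed

text \<open>An index of multiplicity one contributes a zero mean and kills the product; otherwise
  there is a single index, or all multiplicities are 0 or 2 and every factor is 1.\<close>

lemma expectation_products:
  shows "integrable M (\<lambda>\<omega>. norm (z \<omega>) ^ 6) \<Longrightarrow> expectation (\<lambda>\<omega>. z \<omega> $ a * z \<omega> $ b) = kron a b"
    and "integrable M (\<lambda>\<omega>. norm (z \<omega>) ^ 6) \<Longrightarrow>
      expectation (\<lambda>\<omega>. z \<omega> $ a * (z \<omega> $ b * z \<omega> $ c)) = mom3 (gam M z) a b c"
    and "integrable M (\<lambda>\<omega>. norm (z \<omega>) ^ 6) \<Longrightarrow>
      expectation (\<lambda>\<omega>. z \<omega> $ a * (z \<omega> $ b * (z \<omega> $ c * z \<omega> $ d))) = mom4 (kap M z) a b c d"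
proof -
  assume int: "integrable M (\<lambda>\<omega>. norm (z \<omega>) ^ 6)"
  have zero: "(\<Prod>k\<in>UNIV. cmom k (m k)) = 0" if "m j = 1" for m :: "'p \<Rightarrow> nat" and j
    using that cmom_simps(2)[of j] by (intro prod_zero bexI[of _ j]) auto
  have one: "(\<Prod>k\<in>UNIV. cmom k (m k)) = 1" if "\<And>k. m k = 0 \<or> m k = 2" for m :: "'p \<Rightarrow> nat"
  proof (intro prod.neutral ballI)
    fix k show "cmom k (m k) = 1" using that[of k] cmom_simps(1,3)[of k] by auto
  qed
  have single: "(\<Prod>k\<in>UNIV. cmom k (if k = a then j else 0)) = cmom a j" for a :: 'p and j
  proof -
    have "(\<Prod>k\<in>UNIV. cmom k (if k = a then j else 0)) = (\<Prod>k\<in>UNIV. if k = a then cmom k j else 1)"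
      by (intro prod.cong) (auto simp: cmom_simps(1))
    then show ?thesis by simp
  qed
  show "expectation (\<lambda>\<omega>. z \<omega> $ a * z \<omega> $ b) = kron a b"
  proof -
    let ?m = "\<lambda>k. of_bool (k = a) + of_bool (k = b) :: nat"
    have "expectation (\<lambda>\<omega>. z \<omega> $ a * z \<omega> $ b) = (\<Prod>k\<in>UNIV. cmom k (?m k))"
      using expectation_prod_power[OF int, of ?m] by (simp add: power_add prod.distrib prod_of_bool_power)
    also have "\<dots> = kron a b"
    proof (cases "a = b")
      case True
      then show ?thesis by (subst one) (auto simp: kron_def)
    next
      case False
      then show ?thesis by (subst zero[of _ a]) (auto simp: kron_def)
    qed
    finally show ?thesis .
  qed
  show "expectation (\<lambda>\<omega>. z \<omega> $ a * (z \<omega> $ b * z \<omega> $ c)) = mom3 (gam M z) a b c"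
  proof -
    let ?m = "\<lambda>k. of_bool (k = a) + (of_bool (k = b) + of_bool (k = c)) :: nat"
    have "expectation (\<lambda>\<omega>. z \<omega> $ a * (z \<omega> $ b * z \<omega> $ c)) = (\<Prod>k\<in>UNIV. cmom k (?m k))"
      using expectation_prod_power[OF int, of ?m] by (simp add: power_add prod.distrib prod_of_bool_power)
    also have "\<dots> = mom3 (gam M z) a b c"
    proof (cases "a = b \<and> b = c")
      case True
      then have "?m k = (if k = a then 3 else 0)" for k by simp
      then have "(\<Prod>k\<in>UNIV. cmom k (?m k)) = cmom a 3" by (simp only: single)
      then show ?thesis using True by (simp add: mom3_def cmom_simps)
    next
      case False
      then have "?m a = 1 \<or> ?m b = 1 \<or> ?m c = 1" by auto
      then have "(\<Prod>k\<in>UNIV. cmom k (?m k)) = 0"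
        using zero[of ?m a] zero[of ?m b] zero[of ?m c] by blast
      moreover have "mom3 (gam M z) a b c = 0" using False by (auto simp: mom3_def)
      ultimately show ?thesis by simp
    qed
    finally show ?thesis .
  qed
  show "expectation (\<lambda>\<omega>. z \<omega> $ a * (z \<omega> $ b * (z \<omega> $ c * z \<omega> $ d))) = mom4 (kap M z) a b c d"
  proof -
    let ?m = "\<lambda>k. of_bool (k = a) + (of_bool (k = b) + (of_bool (k = c) + of_bool (k = d))) :: nat"
    have "expectation (\<lambda>\<omega>. z \<omega> $ a * (z \<omega> $ b * (z \<omega> $ c * z \<omega> $ d))) = (\<Prod>k\<in>UNIV. cmom k (?m k))"
      using expectation_prod_power[OF int, of ?m] by (simp add: power_add prod.distrib prod_of_bool_power)
    also have "\<dots> = mom4 (kap M z) a b c d"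
    proof -
      consider "a = b \<and> b = c \<and> c = d" | "a = b \<and> c = d \<and> a \<noteq> c" | "a = c \<and> b = d \<and> a \<noteq> b"
        | "a = d \<and> b = c \<and> a \<noteq> b"
        | "\<not> (a = b \<and> c = d)" "\<not> (a = c \<and> b = d)" "\<not> (a = d \<and> b = c)" by blast
      then show ?thesis
      proof cases
        case 1
        then have "?m k = (if k = a then 4 else 0)" for k by simp
        then have "(\<Prod>k\<in>UNIV. cmom k (?m k)) = cmom a 4" by (simp only: single)
        then show ?thesis using 1 by (simp add: mom4_def kron_def cmom_simps)
      next
        case 5
        \<comment> \<open>Four indices without a complete pairing always contain one that occurs
          exactly once.\<close>
        then have "?m a = 1 \<or> ?m b = 1 \<or> ?m c = 1 \<or> ?m d = 1"
          by (cases "a = b"; cases "a = c"; cases "a = d"; cases "b = c"; cases "b = d"; cases "c = d") auto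
        then have "(\<Prod>k\<in>UNIV. cmom k (?m k)) = 0"
          using zero[of ?m a] zero[of ?m b] zero[of ?m c] zero[of ?m d] by blast
        moreover have "mom4 (kap M z) a b c d = 0" using 5 by (auto simp: mom4_def kron_def)
        ultimately show ?thesis by simp
      next
        case 2
        then have eq: "b = a" "d = c" "a \<noteq> c" by blast+
        have "(\<Prod>k\<in>UNIV. cmom k (?m k)) = 1" unfolding eq(1,2) by (rule one) (use eq(3) in simp)
        moreover have "mom4 (kap M z) a b c d = 1" unfolding eq(1,2) using eq(3) by (simp add: mom4_def kron_def)
        ultimately show ?thesis by (simp only:)
      next
        case 3
        then have eq: "c = a" "d = b" "a \<noteq> b" by blast+
        have "(\<Prod>k\<in>UNIV. cmom k (?m k)) = 1" unfolding eq(1,2) by (rule one) (use eq(3) in simp)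
        moreover have "mom4 (kap M z) a b c d = 1" unfolding eq(1,2) using eq(3) by (simp add: mom4_def kron_def)
        ultimately show ?thesis by (simp only:)
      next
        case 4
        then have eq: "d = a" "c = b" "a \<noteq> b" by blast+
        have "(\<Prod>k\<in>UNIV. cmom k (?m k)) = 1" unfolding eq(1,2) by (rule one) (use eq(3) in simp)
        moreover have "mom4 (kap M z) a b c d = 1" unfolding eq(1,2) using eq(3) by (simp add: mom4_def kron_def)
        ultimately show ?thesis by (simp only:)
      qed
    qed
    finally show ?thesis .
  qed
qed

end

locale iid_sample = independent_components M z for M :: "'a measure" and z :: "'a \<Rightarrow> real ^ 'p" +
  fixes Z :: "nat \<Rightarrow> 'a \<Rightarrow> real ^ 'p"
  assumes indep_Z: "indep_vars (\<lambda>_. borel) Z UNIV"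
    and distr_Z: "distr M borel (Z i) = distr M borel z"
begin

lemma Z_measurable [measurable]: "Z i \<in> borel_measurable M"
  using indep_Z by (auto simp: indep_vars_def)

lemma sample_expectation:
  fixes f :: "real ^ 'p \<Rightarrow> real"
  assumes [measurable]: "f \<in> borel_measurable borel"
  shows "integrable M (\<lambda>\<omega>. f (Z i \<omega>)) \<longleftrightarrow> integrable M (\<lambda>\<omega>. f (z \<omega>))"
    and "expectation (\<lambda>\<omega>. f (Z i \<omega>)) = expectation (\<lambda>\<omega>. f (z \<omega>))"
proof -
  show "integrable M (\<lambda>\<omega>. f (Z i \<omega>)) \<longleftrightarrow> integrable M (\<lambda>\<omega>. f (z \<omega>))"
    using integrable_distr_eq[of "Z i" M borel f] integrable_distr_eq[of z M borel f] by (simp add: distr_Z)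
  show "expectation (\<lambda>\<omega>. f (Z i \<omega>)) = expectation (\<lambda>\<omega>. f (z \<omega>))"
    using integral_distr[of "Z i" M borel f] integral_distr[of z M borel f] by (simp add: distr_Z)
qed

text \<open>The variance of an average: the centered terms are uncorrelated by independence, so of
  the double sum only the \<open>n\<close> diagonal terms remain.\<close>

lemma smean_root_n_consistent:
  fixes g :: "real ^ 'p \<Rightarrow> real"
  assumes g [measurable]: "g \<in> borel_measurable borel"
    and int: "integrable M (\<lambda>\<omega>. g (z \<omega>))" and int2: "integrable M (\<lambda>\<omega>. (g (z \<omega>))\<^sup>2)"
    and \<mu>: "expectation (\<lambda>\<omega>. g (z \<omega>)) = \<mu>"
  shows "root_n_consistent M (\<lambda>n \<omega>. (smean n (\<lambda>i. g (Z i \<omega>)) - \<mu>)\<^sup>2)"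
proof -
  define Y where "Y i \<omega> = g (Z i \<omega>) - \<mu>" for i \<omega>
  define v where "v = expectation (\<lambda>\<omega>. (g (z \<omega>) - \<mu>)\<^sup>2)"
  have sq: "integrable M (\<lambda>\<omega>. (g (z \<omega>) - \<mu>)\<^sup>2)"
    using int int2 by (simp add: power2_diff)
  have Yint: "integrable M (Y i)" for i
    unfolding Y_def using sample_expectation(1)[of g i] int by simp
  have Y0: "expectation (Y i) = 0" for i
    unfolding Y_def using sample_expectation[of g i] int \<mu> by (simp add: prob_space)
  have Ysq: "integrable M (\<lambda>\<omega>. Y i \<omega> * Y i \<omega>)" "expectation (\<lambda>\<omega>. Y i \<omega> * Y i \<omega>) = v" for i
    using sample_expectation[of "\<lambda>x. (g x - \<mu>)\<^sup>2" i] sq by (simp_all add: Y_def v_def power2_eq_square)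
  have indY: "indep_vars (\<lambda>_. borel) Y UNIV"
    unfolding Y_def by (rule indep_vars_compose2[OF indep_Z, where Y="\<lambda>_ x. g x - \<mu>"]) simp
  have cross: "integrable M (\<lambda>\<omega>. Y i \<omega> * Y j \<omega>) \<and> expectation (\<lambda>\<omega>. Y i \<omega> * Y j \<omega>) = (if i = j then v else 0)" for i j
  proof (cases "i = j")
    case False
    have ind: "indep_vars (\<lambda>_. borel) Y {i, j}" by (rule indep_vars_subset[OF indY]) simp
    show ?thesis
      using indep_vars_lebesgue_integral[OF _ ind] indep_vars_integrable[OF _ ind] Yint Y0 False by simp
  qed (use Ysq in simp)
  have "integrable M (\<lambda>\<omega>. (smean n (\<lambda>i. g (Z i \<omega>)) - \<mu>)\<^sup>2) \<and>
      expectation (\<lambda>\<omega>. (smean n (\<lambda>i. g (Z i \<omega>)) - \<mu>)\<^sup>2) \<le> v / real n" if n: "n > 0" for n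
  proof -
    have "smean n (\<lambda>i. g (Z i \<omega>)) - \<mu> = smean n (\<lambda>i. Y i \<omega>)" for \<omega>
      unfolding Y_def smean_diff using smean_const[OF n] by simp
    then have eq: "(\<lambda>\<omega>. (smean n (\<lambda>i. g (Z i \<omega>)) - \<mu>)\<^sup>2) = (\<lambda>\<omega>. (\<Sum>i<n. \<Sum>j<n. Y i \<omega> * Y j \<omega>) / (real n)\<^sup>2)"
      by (simp add: smean_def power2_eq_square sum_product)
    have "expectation (\<lambda>\<omega>. (\<Sum>i<n. \<Sum>j<n. Y i \<omega> * Y j \<omega>) / (real n)\<^sup>2)
        = (\<Sum>i<n. \<Sum>j<n. if i = j then v else 0) / (real n)\<^sup>2"
      using cross by (simp add: Bochner_Integration.integral_sum)
    also have "\<dots> = v / real n" using n by (simp add: power2_eq_square)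
    finally show ?thesis unfolding eq using cross by simp
  qed
  then show ?thesis unfolding root_n_consistent_def by blast
qed

lemma dev_sq_root_n_consistent:
  assumes int6: "integrable M (\<lambda>\<omega>. norm (z \<omega>) ^ 6)"
    and int8: "\<alpha> \<noteq> 1 \<Longrightarrow> integrable M (\<lambda>\<omega>. norm (z \<omega>) ^ 8)"
  shows "root_n_consistent M (\<lambda>n \<omega>. dev_sq \<alpha> (gam M z) (kap M z) (\<lambda>i. Z i \<omega>) n)"
proof -
  \<comment> \<open>The square of a monomial of degree \<open>m\<close> is dominated by the norm to
    the power \<open>2 * m\<close>, which is the origin of the required moment orders.\<close>
  have mono: "root_n_consistent M (\<lambda>n \<omega>. (smean n (\<lambda>i. g (Z i \<omega>)) - \<mu>)\<^sup>2)"
    if "g \<in> borel_measurable borel" and bd: "\<And>v. \<bar>g v\<bar> \<le> norm v ^ m" and m: "2 * m \<le> K"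
      and K: "integrable M (\<lambda>\<omega>. norm (z \<omega>) ^ K)" and \<mu>: "expectation (\<lambda>\<omega>. g (z \<omega>)) = \<mu>"
    for g :: "real ^ 'p \<Rightarrow> real" and m K \<mu>
  proof (rule smean_root_n_consistent[OF _ _ _ \<mu>])
    note [measurable] = that(1)
    show "g \<in> borel_measurable borel" by measurable
    show "integrable M (\<lambda>\<omega>. g (z \<omega>))"
      using m bd by (intro integrable_monomial[OF K, of m]) auto
    have "\<bar>(g v)\<^sup>2\<bar> \<le> norm v ^ (2 * m)" for v
      using power_mono[OF bd abs_ge_zero, of v 2] by (simp add: power_mult mult.commute[of 2])
    then show "integrable M (\<lambda>\<omega>. (g (z \<omega>))\<^sup>2)"
      using m by (intro integrable_monomial[OF K, of "2 * m"]) auto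
  qed
  have c: "\<bar>v $ a\<bar> \<le> norm v" for v :: "real ^ 'p" and a by (rule component_le_norm_cart)
  have c2: "\<bar>v $ a * v $ b\<bar> \<le> norm v ^ 2" for v :: "real ^ 'p" and a b
    unfolding abs_mult power2_eq_square by (intro mult_mono c) auto
  have c3: "\<bar>v $ a * (v $ b * v $ d)\<bar> \<le> norm v ^ 3" for v :: "real ^ 'p" and a b d
    unfolding abs_mult[of "v $ a"] power3_eq_cube mult.assoc
    by (intro mult_mono c c2[unfolded power2_eq_square]) auto
  have c4: "\<bar>v $ a * (v $ b * (v $ d * v $ e))\<bar> \<le> norm v ^ 4" for v :: "real ^ 'p" and a b d e
    unfolding abs_mult[of "v $ a"] power4_eq_xxxx mult.assoc
    by (intro mult_mono c c3[unfolded power3_eq_cube mult.assoc]) auto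
  have 1: "root_n_consistent M (\<lambda>n \<omega>. (raw1 (\<lambda>i. Z i \<omega>) n a)\<^sup>2)" for a
    using mono[of "\<lambda>v. v $ a" 1 6 0] c int6 mean by (simp add: raw1_def)
  have 2: "root_n_consistent M (\<lambda>n \<omega>. (raw2 (\<lambda>i. Z i \<omega>) n a b - kron a b)\<^sup>2)" for a b
    unfolding raw2_def
    by (rule mono[of "\<lambda>v. v $ a * v $ b" 2 6])
      (use c2 int6 expectation_products(1)[OF int6] in simp_all)
  have 3: "root_n_consistent M (\<lambda>n \<omega>. (raw3 (\<lambda>i. Z i \<omega>) n a b d - mom3 (gam M z) a b d)\<^sup>2)" for a b d
    unfolding raw3_def
    by (rule mono[of "\<lambda>v. v $ a * (v $ b * v $ d)" 3 6])
      (use c3 int6 expectation_products(2)[OF int6] in simp_all)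
  have 4: "root_n_consistent M (\<lambda>n \<omega>. (raw4 (\<lambda>i. Z i \<omega>) n a b d e - mom4 (kap M z) a b d e)\<^sup>2)"
    if "\<alpha> \<noteq> 1" for a b d e
    unfolding raw4_def
    by (rule mono[of "\<lambda>v. v $ a * (v $ b * (v $ d * v $ e))" 4 8])
      (use c4 int8[OF that] expectation_products(3)[OF int6] in simp_all)
  show ?thesis
    unfolding dev_sq_def
    by (cases "\<alpha> = 1") (auto intro!: root_n_consistent_add root_n_consistent_sum root_n_consistent_zero 1 2 3 4
        split: prod.split)
qed

end

section \<open>The asymptotic expansion\<close>

lemma norm_matrix_le_sum:
  fixes A :: "real ^ 'n ^ 'm"
  shows "norm A \<le> (\<Sum>k\<in>UNIV. \<Sum>a\<in>UNIV. \<bar>A $ k $ a\<bar>)"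
proof -
  have "norm A \<le> (\<Sum>k\<in>UNIV. norm (A $ k))"
    unfolding norm_vec_def by (rule L2_set_le_sum) simp
  also have "\<dots> \<le> (\<Sum>k\<in>UNIV. \<Sum>a\<in>UNIV. \<bar>A $ k $ a\<bar>)"
    by (intro sum_mono norm_le_l1_cart)
  finally show ?thesis .
qed

lemma (in spp_population) spp_consistency:
  assumes "\<epsilon> > 0"
  shows "\<exists>\<delta>>0. \<forall>x n U. 0 < n \<longrightarrow> dev x n < \<delta> \<longrightarrow> is_spp_maximizer x n U \<longrightarrow>
    (\<forall>V. is_spp_maximizer x n V \<longrightarrow> dist U (mat 1) \<le> dist V (mat 1)) \<longrightarrow>
    dist (U ** mat_inv_sqrt (sample_cov x n)) (mat 1) < \<epsilon>"
proof -
  let ?p = "real CARD('p)"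
  \<comment> \<open>Entrywise errors of size \<open>e\<close> add up, over \<open>CARD('p)\<close>
    squared entries, to half of \<epsilon>; the other half is spent on the distance of
    \<open>U\<close> to the identity.\<close>
  define e where "e = \<epsilon> / (2 * (?p * ?p))"
  have e: "e > 0" using assms by (simp add: e_def)
  have "(\<lambda>c. cW c $ k $ a - cU c $ k $ a) \<in> o[config_filter](\<lambda>_. 1)" for k a
    using near_W by (simp add: near_def)
  then have "eventually (\<lambda>c. norm (cW c $ k $ a - cU c $ k $ a) \<le> e * norm (1 :: real)) config_filter" for k a
    using e by (intro landau_o.smallD)
  then have "eventually (\<lambda>c. \<forall>k a. \<bar>cW c $ k $ a - cU c $ k $ a\<bar> \<le> e) config_filter"
    by (intro eventually_all_finite) simp
  then obtain \<delta>1 where \<delta>1: "\<delta>1 > 0" "\<And>x n U k a. 0 < n \<Longrightarrow> orthogonal_matrix U \<Longrightarrow> dev x n < \<delta>1 \<Longrightarrow>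
      \<bar>(U ** mat_inv_sqrt (sample_cov x n)) $ k $ a - U $ k $ a\<bar> \<le> e"
    unfolding eventually_config_filter by auto
  obtain \<delta>2 where \<delta>2: "\<delta>2 > 0" "\<And>x n U. 0 < n \<Longrightarrow> dev x n < \<delta>2 \<Longrightarrow> is_spp_maximizer x n U \<Longrightarrow>
      (\<forall>V. is_spp_maximizer x n V \<longrightarrow> dist U (mat 1) \<le> dist V (mat 1)) \<Longrightarrow> dist U (mat 1) < \<epsilon> / 2"
    using maximizer_consistency[of "\<epsilon> / 2"] assms by auto
  show ?thesis
  proof (intro exI[of _ "min \<delta>1 \<delta>2"] conjI allI impI)
    fix x n U
    assume *: "0 < n" "dev x n < min \<delta>1 \<delta>2" "is_spp_maximizer x n U"
      "\<forall>V. is_spp_maximizer x n V \<longrightarrow> dist U (mat 1) \<le> dist V (mat 1)"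
    let ?W = "U ** mat_inv_sqrt (sample_cov x n)"
    have "orthogonal_matrix U" using *(3) by (simp add: is_spp_maximizer_def is_arg_max_def)
    then have le: "\<bar>(?W - U) $ k $ a\<bar> \<le> e" for k a using * \<delta>1(2)[of n U x] by simp
    have "dist ?W U \<le> (\<Sum>k\<in>UNIV. \<Sum>a\<in>UNIV. \<bar>(?W - U) $ k $ a\<bar>)"
      unfolding dist_norm by (rule norm_matrix_le_sum)
    also have "\<dots> \<le> (\<Sum>k::'p\<in>UNIV. \<Sum>a::'p\<in>UNIV. e)" by (intro sum_mono le)
    also have "\<dots> = \<epsilon> / 2" by (simp add: e_def)
    finally have "dist ?W U \<le> \<epsilon> / 2" .
    moreover have "dist U (mat 1) < \<epsilon> / 2" using * by (intro \<delta>2(2)) auto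
    ultimately show "dist ?W (mat 1) < \<epsilon>" using dist_triangle[of ?W "mat 1" U] by linarith
  qed (use \<delta>1(1) \<delta>2(1) in simp)
qed

text \<open>The threshold \<open>c / sqrt n\<close> for the squared deviation balances two needs: an
  error quadratic in the deviation stays small after multiplication by \<open>sqrt n\<close>, while
  Markov's inequality still bounds the exceptional probability by a multiple of
  \<open>1 / sqrt n\<close>.\<close>

lemma (in prob_space) conv_in_prob_of_root_n_consistent:
  fixes X :: "nat \<Rightarrow> 'a \<Rightarrow> 'b :: metric_space"
  assumes X: "\<And>n. X n \<in> borel_measurable M"
    and V: "root_n_consistent M V" "\<And>n \<omega>. 0 \<le> V n \<omega>"
    and le: "\<And>\<epsilon>. \<epsilon> > 0 \<Longrightarrow> \<exists>c>0. \<forall>n>0. \<forall>\<omega>\<in>space M. V n \<omega> < c / sqrt (real n) \<longrightarrow> dist (X n \<omega>) x \<le> \<epsilon>"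
  shows "conv_in_prob M X x"
  unfolding conv_in_prob_def
proof (intro conjI allI impI X)
  fix \<epsilon> :: real assume "\<epsilon> > 0"
  from le[OF this] obtain c where c: "c > 0"
    "\<And>n \<omega>. n > 0 \<Longrightarrow> \<omega> \<in> space M \<Longrightarrow> V n \<omega> < c / sqrt (real n) \<Longrightarrow> dist (X n \<omega>) x \<le> \<epsilon>"
    by blast
  obtain C where C: "\<And>n. n > 0 \<Longrightarrow> integrable M (V n)" "\<And>n. n > 0 \<Longrightarrow> expectation (V n) \<le> C / real n"
    using V(1) unfolding root_n_consistent_def by blast
  have bound: "measure M {\<omega> \<in> space M. dist (X n \<omega>) x > \<epsilon>} \<le> C / c * inverse (sqrt (real n))" if n: "n > 0" for n
  proof -
    note [measurable] = borel_measurable_integrable[OF C(1)[OF n]]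
    have "measure M {\<omega> \<in> space M. dist (X n \<omega>) x > \<epsilon>} \<le> measure M {\<omega> \<in> space M. V n \<omega> \<ge> c / sqrt (real n)}"
      using c(2)[OF n] by (intro finite_measure_mono) (auto simp: not_le[symmetric])
    also have "\<dots> \<le> expectation (V n) / (c / sqrt (real n))"
      using c(1) n V(2) by (intro integral_Markov_inequality_measure[OF C(1)[OF n], of "{}"]) auto
    also have "\<dots> \<le> C / real n / (c / sqrt (real n))"
      using c(1) n C(2)[OF n] by (intro divide_right_mono) auto
    also have "\<dots> = C / c * inverse (sqrt (real n))"
      using n c(1) by (simp add: field_simps real_sqrt_mult_self flip: power2_eq_square)
    finally show ?thesis .
  qed
  have "(\<lambda>n. inverse (sqrt (real n))) \<longlonglongrightarrow> 0"
    by (rule tendsto_inverse_0_at_top[OF filterlim_compose[OF sqrt_at_top filterlim_real_sequentially]])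
  from tendsto_mult_right_zero[OF this]
  have lim: "(\<lambda>n. C / c * inverse (sqrt (real n))) \<longlonglongrightarrow> 0" .
  have ev: "eventually (\<lambda>n. measure M {\<omega> \<in> space M. dist (X n \<omega>) x > \<epsilon>} \<le> C / c * inverse (sqrt (real n))) sequentially"
    using eventually_gt_at_top[of 0] by eventually_elim (rule bound)
  show "(\<lambda>n. measure M {\<omega> \<in> space M. dist (X n \<omega>) x > \<epsilon>}) \<longlonglongrightarrow> 0"
    by (rule tendsto_sandwich[OF _ ev tendsto_const lim]) simp
qed

lemma (in iid_sample) spp_solution_expansion:
  assumes pop: "spp_population \<alpha> (gam M z) (kap M z)"
    and int6: "integrable M (\<lambda>\<omega>. norm (z \<omega>) ^ 6)"
    and int8: "\<alpha> \<noteq> 1 \<Longrightarrow> integrable M (\<lambda>\<omega>. norm (z \<omega>) ^ 8)"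
  shows "\<exists>W. spp_solution_seq M \<alpha> Z W \<and> conv_in_prob M W (mat 1) \<and>
    (\<forall>k l. conv_in_prob M (\<lambda>n \<omega>. sqrt (real n) *
      (W n \<omega> $ k $ l - kron k l - spp_population.lead \<alpha> (gam M z) (kap M z) (\<lambda>i. Z i \<omega>) n k l)) 0)"
proof -
  interpret P: spp_population \<alpha> "gam M z" "kap M z" by (rule pop)
  let ?Z = "\<lambda>\<omega> i. Z i \<omega>"
  have "\<exists>U\<in>borel_measurable M. \<forall>\<omega>\<in>space M. P.is_spp_maximizer (?Z \<omega>) n (U \<omega>) \<and>
      (\<forall>V. P.is_spp_maximizer (?Z \<omega>) n V \<longrightarrow> dist (U \<omega>) (mat 1) \<le> dist V (mat 1))" for n
    unfolding P.is_spp_maximizer_def by (rule measurable_spp_maximizer) simp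
  then obtain U where U: "\<And>n. U n \<in> borel_measurable M"
    "\<And>n \<omega>. \<omega> \<in> space M \<Longrightarrow> P.is_spp_maximizer (?Z \<omega>) n (U n \<omega>)"
    "\<And>n \<omega>. \<omega> \<in> space M \<Longrightarrow> \<forall>V. P.is_spp_maximizer (?Z \<omega>) n V \<longrightarrow> dist (U n \<omega>) (mat 1) \<le> dist V (mat 1)"
    by metis
  note [measurable] = U(1)
  define W where "W n \<omega> = U n \<omega> ** mat_inv_sqrt (sample_cov (?Z \<omega>) n)" for n \<omega>
  have [measurable]: "(\<lambda>\<omega>. sample_cov (?Z \<omega>) n) \<in> borel_measurable M"
    "(\<lambda>\<omega>. mat_inv_sqrt (sample_cov (?Z \<omega>) n)) \<in> borel_measurable M" for n
    by (rule sample_cov_measurable mat_inv_sqrt_sample_cov_measurable; simp)+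
  have W [measurable]: "W n \<in> borel_measurable M" for n unfolding W_def by measurable
  let ?V = "\<lambda>n \<omega>. dev_sq \<alpha> (gam M z) (kap M z) (?Z \<omega>) n"
  have V: "root_n_consistent M ?V" by (rule dev_sq_root_n_consistent[OF int6 int8])
  \<comment> \<open>For positive \<open>n\<close> the shrinking threshold is at most
    \<open>c\<close>, so the event used for the remainder also places the sample in the fixed
    neighborhood needed for consistency.\<close>
  have dev_less: "P.dev (?Z \<omega>) n < \<delta>" if "?V n \<omega> < c / sqrt (real n)" "n > 0" "c \<le> \<delta>\<^sup>2" "c > 0" "\<delta> > 0" for n \<omega> c \<delta>
  proof -
    have "c / sqrt (real n) \<le> c" using that by (simp add: divide_le_eq)
    then have "?V n \<omega> < \<delta>\<^sup>2" using that by linarith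
    then show ?thesis unfolding P.dev_def using that(5) real_sqrt_less_mono[of "?V n \<omega>" "\<delta>\<^sup>2"] by simp
  qed
  have "spp_solution_seq M \<alpha> Z W"
    unfolding spp_solution_seq_def is_spp_solution_def W_def[symmetric]
    using W U(2) unfolding P.is_spp_maximizer_def W_def by blast
  moreover have "conv_in_prob M W (mat 1)"
  proof (rule conv_in_prob_of_root_n_consistent[OF W V P.dev_sq_nonneg])
    fix \<epsilon> :: real assume "\<epsilon> > 0"
    from P.spp_consistency[OF this] obtain \<delta> where \<delta>: "\<delta> > 0"
      "\<And>x n U. 0 < n \<Longrightarrow> P.dev x n < \<delta> \<Longrightarrow> P.is_spp_maximizer x n U \<Longrightarrow>
        (\<forall>V. P.is_spp_maximizer x n V \<longrightarrow> dist U (mat 1) \<le> dist V (mat 1)) \<Longrightarrow>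
        dist (U ** mat_inv_sqrt (sample_cov x n)) (mat 1) < \<epsilon>" by blast
    have "dist (W n \<omega>) (mat 1) \<le> \<epsilon>" if "0 < n" "\<omega> \<in> space M" "?V n \<omega> < \<delta>\<^sup>2 / sqrt (real n)" for n \<omega>
      unfolding W_def using that \<delta>(1)
      by (intro less_imp_le[OF \<delta>(2)] U dev_less[OF that(3)]) auto
    then show "\<exists>c>0. \<forall>n>0. \<forall>\<omega>\<in>space M. ?V n \<omega> < c / sqrt (real n) \<longrightarrow> dist (W n \<omega>) (mat 1) \<le> \<epsilon>"
      using \<delta>(1) by (intro exI[of _ "\<delta>\<^sup>2"]) simp
  qed
  moreover have "conv_in_prob M (\<lambda>n \<omega>. sqrt (real n) * (W n \<omega> $ k $ l - kron k l - P.lead (?Z \<omega>) n k l)) 0" for k l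
  proof (rule conv_in_prob_of_root_n_consistent[OF _ V P.dev_sq_nonneg])
    show "(\<lambda>\<omega>. sqrt (real n) * (W n \<omega> $ k $ l - kron k l - P.lead (?Z \<omega>) n k l)) \<in> borel_measurable M" for n
      unfolding P.lead_def P.lead_num_def psi1_hat_def psi2_hat_def s_hat_def r_hat_def q_hat_def
      by (cases "k = l") (simp_all, measurable)
    obtain K \<delta>1 where \<delta>1: "\<delta>1 > 0" "\<forall>x n U. 0 < n \<longrightarrow> P.is_spp_maximizer x n U \<longrightarrow> P.dev x n < \<delta>1 \<longrightarrow>
        dist U (mat 1) < \<delta>1 \<longrightarrow>
        (\<forall>k l. \<bar>(U ** mat_inv_sqrt (sample_cov x n)) $ k $ l - kron k l - P.lead x n k l\<bar> \<le> K * (P.dev x n)\<^sup>2)"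
      using P.spp_expansion by (elim exE conjE)
    obtain \<delta>2 where \<delta>2: "\<delta>2 > 0" "\<And>x n U. 0 < n \<Longrightarrow> P.dev x n < \<delta>2 \<Longrightarrow> P.is_spp_maximizer x n U \<Longrightarrow>
        (\<forall>V. P.is_spp_maximizer x n V \<longrightarrow> dist U (mat 1) \<le> dist V (mat 1)) \<Longrightarrow> dist U (mat 1) < \<delta>1"
      using P.maximizer_consistency[OF \<delta>1(1)] by blast
    define \<delta> where "\<delta> = min \<delta>1 \<delta>2"
    have \<delta>: "\<delta> > 0" using \<delta>1(1) \<delta>2(1) by (simp add: \<delta>_def)
    fix \<epsilon> :: real assume \<epsilon>: "\<epsilon> > 0"
    \<comment> \<open>The first bound secures the local expansion, the second makes the scaled
      remainder at most \<epsilon>; \<open>max K 1\<close> guards against a constant that is not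
      positive.\<close>
    define c where "c = min (\<delta>\<^sup>2) (\<epsilon> / max K 1)"
    have c: "c > 0" "c \<le> \<delta>\<^sup>2" using \<delta> \<epsilon> by (auto simp: c_def)
    have "dist (sqrt (real n) * (W n \<omega> $ k $ l - kron k l - P.lead (?Z \<omega>) n k l)) 0 \<le> \<epsilon>"
      if n: "0 < n" and \<omega>: "\<omega> \<in> space M" and v: "?V n \<omega> < c / sqrt (real n)" for n \<omega>
    proof -
      have d: "P.dev (?Z \<omega>) n < \<delta>" by (rule dev_less[OF v n c(2,1) \<delta>])
      then have "dist (U n \<omega>) (mat 1) < \<delta>1"
        using n U(2,3)[OF \<omega>] by (intro \<delta>2(2)) (auto simp: \<delta>_def)
      then have "\<bar>W n \<omega> $ k $ l - kron k l - P.lead (?Z \<omega>) n k l\<bar> \<le> K * (P.dev (?Z \<omega>) n)\<^sup>2"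
        unfolding W_def using n d U(2)[OF \<omega>] by (intro \<delta>1(2)[rule_format]) (auto simp: \<delta>_def)
      also have "\<dots> = K * ?V n \<omega>" by (simp add: P.dev_def P.dev_sq_nonneg)
      also have "\<dots> \<le> max K 1 * (c / sqrt (real n))"
        using v P.dev_sq_nonneg by (intro mult_mono) auto
      also have "\<dots> \<le> max K 1 * (\<epsilon> / max K 1 / sqrt (real n))"
        by (intro mult_left_mono divide_right_mono) (auto simp: c_def)
      also have "\<dots> = \<epsilon> / sqrt (real n)" by simp
      finally have "sqrt (real n) * \<bar>W n \<omega> $ k $ l - kron k l - P.lead (?Z \<omega>) n k l\<bar>
          \<le> sqrt (real n) * (\<epsilon> / sqrt (real n))"
        by (intro mult_left_mono) auto
      then show ?thesis using n by (simp add: dist_real_def abs_mult)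
    qed
    then show "\<exists>c>0. \<forall>n>0. \<forall>\<omega>\<in>space M. ?V n \<omega> < c / sqrt (real n) \<longrightarrow>
        dist (sqrt (real n) * (W n \<omega> $ k $ l - kron k l - P.lead (?Z \<omega>) n k l)) 0 \<le> \<epsilon>"
      using c(1) by blast
  qed
  ultimately show ?thesis by blast
qed

lemma card_zeros_le_1D:
  fixes P :: "'p::finite \<Rightarrow> bool"
  assumes "card {k. P k} \<le> 1" "k \<noteq> l"
  shows "\<not> P k \<or> \<not> P l"
  using assms card_le_Suc0_iff_eq[of "{k. P k}"] by auto

text \<open>In the third part, one criterion drops out when \<alpha> is 0 or 1. Two indices at which
  the moments of the other criterion vanish would then make the limiting denominator zero; the two
  implications on \<alpha> exclude this.\<close>

theorem theorem4p2p2: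
  fixes M :: "'a measure"
    and z :: "'a \<Rightarrow> real ^ 'p"
    and Z :: "nat \<Rightarrow> 'a \<Rightarrow> real ^ 'p"
    and \<gamma> \<beta> \<kappa> :: "'p \<Rightarrow> real"
  defines "\<gamma> \<equiv> gam M z" and "\<beta> \<equiv> bet M z" and "\<kappa> \<equiv> kap M z"
  assumes "prob_space M"
    and "z \<in> borel_measurable M"
    and "prob_space.indep_vars M (\<lambda>_. borel) (\<lambda>k \<omega>. z \<omega> $ k) UNIV"
    and "\<And>k. prob_space.expectation M (\<lambda>\<omega>. z \<omega> $ k) = 0"
    and "\<And>k. prob_space.variance M (\<lambda>\<omega>. z \<omega> $ k) = 1"
    and "prob_space.indep_vars M (\<lambda>_. borel) Z UNIV"
    and "\<And>i. distr M borel (Z i) = distr M borel z"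
  shows
    "(integrable M (\<lambda>\<omega>. norm (z \<omega>) ^ 6) \<longrightarrow> card {k. \<gamma> k = 0} \<le> 1 \<longrightarrow>
      (\<exists>W. spp_solution_seq M 1 Z W \<and> conv_in_prob M W (mat 1) \<and>
        (\<forall>k. eq_up_to_oP M
          (\<lambda>n \<omega>. sqrt (real n) * (W n \<omega> $ k $ k - 1))
          (\<lambda>n \<omega>. - (1 / 2) * (sqrt (real n) * (s_hat (\<lambda>i. Z i \<omega>) n k k - 1)))) \<and>
        (\<forall>k l. l \<noteq> k \<longrightarrow> eq_up_to_oP M
          (\<lambda>n \<omega>. sqrt (real n) * W n \<omega> $ k $ l)
          (\<lambda>n \<omega>. sqrt (real n) * psi1_hat \<gamma> (\<lambda>i. Z i \<omega>) n k l / ((\<gamma> k)\<^sup>2 + (\<gamma> l)\<^sup>2)))))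
     \<and>
     (integrable M (\<lambda>\<omega>. norm (z \<omega>) ^ 8) \<longrightarrow> card {k. \<kappa> k = 0} \<le> 1 \<longrightarrow>
      (\<exists>W. spp_solution_seq M 0 Z W \<and> conv_in_prob M W (mat 1) \<and>
        (\<forall>k. eq_up_to_oP M
          (\<lambda>n \<omega>. sqrt (real n) * (W n \<omega> $ k $ k - 1))
          (\<lambda>n \<omega>. - (1 / 2) * (sqrt (real n) * (s_hat (\<lambda>i. Z i \<omega>) n k k - 1)))) \<and>
        (\<forall>k l. l \<noteq> k \<longrightarrow> eq_up_to_oP M
          (\<lambda>n \<omega>. sqrt (real n) * W n \<omega> $ k $ l)
          (\<lambda>n \<omega>. sqrt (real n) * psi2_hat \<gamma> \<beta> \<kappa> (\<lambda>i. Z i \<omega>) n k l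
                   / ((\<kappa> k)\<^sup>2 + (\<kappa> l)\<^sup>2)))))
     \<and>
     (\<forall>\<alpha>\<in>{0..1}.
      integrable M (\<lambda>\<omega>. norm (z \<omega>) ^ 8) \<longrightarrow> card {k. \<gamma> k = 0 \<and> \<kappa> k = 0} \<le> 1 \<longrightarrow>
      (\<alpha> = 1 \<longrightarrow> card {k. \<gamma> k = 0} \<le> 1) \<longrightarrow>
      (\<alpha> = 0 \<longrightarrow> card {k. \<kappa> k = 0} \<le> 1) \<longrightarrow>
      (\<exists>W. spp_solution_seq M \<alpha> Z W \<and> conv_in_prob M W (mat 1) \<and>
        (\<forall>k. eq_up_to_oP M
          (\<lambda>n \<omega>. sqrt (real n) * (W n \<omega> $ k $ k - 1))
          (\<lambda>n \<omega>. - (1 / 2) * (sqrt (real n) * (s_hat (\<lambda>i. Z i \<omega>) n k k - 1)))) \<and>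
        (\<forall>k l. l \<noteq> k \<longrightarrow> eq_up_to_oP M
          (\<lambda>n \<omega>. sqrt (real n) * W n \<omega> $ k $ l)
          (\<lambda>n \<omega>. (3 * \<alpha> * (sqrt (real n) * psi1_hat \<gamma> (\<lambda>i. Z i \<omega>) n k l)
                     + 4 * (1 - \<alpha>) * (sqrt (real n) * psi2_hat \<gamma> \<beta> \<kappa> (\<lambda>i. Z i \<omega>) n k l))
                   / (3 * \<alpha> * ((\<gamma> k)\<^sup>2 + (\<gamma> l)\<^sup>2)
                      + 4 * (1 - \<alpha>) * ((\<kappa> k)\<^sup>2 + (\<kappa> l)\<^sup>2))))))"
proof -
  interpret iid_sample M z Z
    using assms(4-10) by (simp add: iid_sample_def iid_sample_axioms_def independent_components_def
        independent_components_axioms_def)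
  let ?Q = "\<lambda>\<alpha> r. \<exists>W. spp_solution_seq M \<alpha> Z W \<and> conv_in_prob M W (mat 1) \<and>
      (\<forall>k. eq_up_to_oP M
        (\<lambda>n \<omega>. sqrt (real n) * (W n \<omega> $ k $ k - 1))
        (\<lambda>n \<omega>. - (1 / 2) * (sqrt (real n) * (s_hat (\<lambda>i. Z i \<omega>) n k k - 1)))) \<and>
      (\<forall>k l. l \<noteq> k \<longrightarrow> eq_up_to_oP M (\<lambda>n \<omega>. sqrt (real n) * W n \<omega> $ k $ l) (r k l))"
  let ?r = "\<lambda>\<alpha> k l n \<omega>. (3 * \<alpha> * (sqrt (real n) * psi1_hat \<gamma> (\<lambda>i. Z i \<omega>) n k l)
         + 4 * (1 - \<alpha>) * (sqrt (real n) * psi2_hat \<gamma> \<beta> \<kappa> (\<lambda>i. Z i \<omega>) n k l))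
       / (3 * \<alpha> * ((\<gamma> k)\<^sup>2 + (\<gamma> l)\<^sup>2) + 4 * (1 - \<alpha>) * ((\<kappa> k)\<^sup>2 + (\<kappa> l)\<^sup>2))"
  \<comment> \<open>All three parts are instances of this. Eighth moments are required only for
    \<alpha> \<noteq> 1, so the first part gets by with sixth moments.\<close>
  have main: "?Q \<alpha> (?r \<alpha>)"
    if \<alpha>: "0 \<le> \<alpha>" "\<alpha> \<le> 1"
      and ident: "\<forall>k l. k \<noteq> l \<longrightarrow> 0 < \<alpha> * ((\<gamma> k)\<^sup>2 + (\<gamma> l)\<^sup>2) + (1 - \<alpha>) * ((\<kappa> k)\<^sup>2 + (\<kappa> l)\<^sup>2)"
      and int6: "integrable M (\<lambda>\<omega>. norm (z \<omega>) ^ 6)"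
      and int8: "\<alpha> \<noteq> 1 \<longrightarrow> integrable M (\<lambda>\<omega>. norm (z \<omega>) ^ 8)" for \<alpha>
  proof -
    have pop: "spp_population \<alpha> (gam M z) (kap M z)"
      using \<alpha> ident unfolding \<gamma>_def \<kappa>_def by unfold_locales blast+
    interpret P: spp_population \<alpha> "gam M z" "kap M z" by (rule pop)
    obtain W where W: "spp_solution_seq M \<alpha> Z W" "conv_in_prob M W (mat 1)"
      "\<And>k l. conv_in_prob M (\<lambda>n \<omega>. sqrt (real n) * (W n \<omega> $ k $ l - kron k l - P.lead (\<lambda>i. Z i \<omega>) n k l)) 0"
      using spp_solution_expansion[OF pop int6 int8[rule_format]] by blast
    have \<beta>: "(\<lambda>k. kap M z k + 3) = \<beta>" by (simp add: kap_def \<beta>_def)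
    have "eq_up_to_oP M (\<lambda>n \<omega>. sqrt (real n) * (W n \<omega> $ k $ k - 1))
        (\<lambda>n \<omega>. - (1 / 2) * (sqrt (real n) * (s_hat (\<lambda>i. Z i \<omega>) n k k - 1)))" for k
    proof -
      have "sqrt (real n) * (W n \<omega> $ k $ k - 1) - - (1 / 2) * (sqrt (real n) * (s_hat (\<lambda>i. Z i \<omega>) n k k - 1))
          = sqrt (real n) * (W n \<omega> $ k $ k - kron k k - P.lead (\<lambda>i. Z i \<omega>) n k k)" for n \<omega>
        by (simp add: kron_def P.lead_def algebra_simps)
      then show ?thesis using W(3)[of k k] unfolding eq_up_to_oP_def by (simp only:)
    qed
    moreover have "eq_up_to_oP M (\<lambda>n \<omega>. sqrt (real n) * W n \<omega> $ k $ l) (?r \<alpha> k l)" if "l \<noteq> k" for k l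
    proof -
      have "sqrt (real n) * W n \<omega> $ k $ l - ?r \<alpha> k l n \<omega>
          = sqrt (real n) * (W n \<omega> $ k $ l - kron k l - P.lead (\<lambda>i. Z i \<omega>) n k l)" for n \<omega>
      proof -
        have "3 * \<alpha> * (sqrt (real n) * psi1_hat \<gamma> (\<lambda>i. Z i \<omega>) n k l)
            + 4 * (1 - \<alpha>) * (sqrt (real n) * psi2_hat \<gamma> \<beta> \<kappa> (\<lambda>i. Z i \<omega>) n k l)
          = sqrt (real n) * P.lead_num (\<lambda>i. Z i \<omega>) n k l"
        proof -
          have "P.lead_num (\<lambda>i. Z i \<omega>) n k l = 3 * \<alpha> * psi1_hat \<gamma> (\<lambda>i. Z i \<omega>) n k l
              + 4 * ((1 - \<alpha>) * psi2_hat \<gamma> \<beta> \<kappa> (\<lambda>i. Z i \<omega>) n k l)"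
            by (simp only: P.lead_num_def \<beta> \<gamma>_def \<kappa>_def)
          then show ?thesis by (simp only: distrib_left) (simp only: mult_ac)
        qed
        then show ?thesis
          using that unfolding P.lead_def P.lead_den_def \<gamma>_def \<kappa>_def
          by (simp add: kron_def right_diff_distrib)
      qed
      then show ?thesis using W(3)[of k l] unfolding eq_up_to_oP_def by (simp only:)
    qed
    ultimately show ?thesis using W(1,2) by blast
  qed
  have int6: "integrable M (\<lambda>\<omega>. norm (z \<omega>) ^ 6)" if "integrable M (\<lambda>\<omega>. norm (z \<omega>) ^ 8)"
    by (rule integrable_monomial[OF that, of 6]) simp_all
  have sq: "0 < s\<^sup>2 + t\<^sup>2" if "s \<noteq> 0 \<or> t \<noteq> 0" for s t :: real
    using that by (simp add: sum_power2_gt_zero_iff)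
  show ?thesis
  proof (intro conjI impI ballI)
    assume *: "integrable M (\<lambda>\<omega>. norm (z \<omega>) ^ 6)" "card {k. \<gamma> k = 0} \<le> 1"
    have ident: "\<forall>k l. k \<noteq> l \<longrightarrow> 0 < 1 * ((\<gamma> k)\<^sup>2 + (\<gamma> l)\<^sup>2) + (1 - 1) * ((\<kappa> k)\<^sup>2 + (\<kappa> l)\<^sup>2)"
      using sq[OF card_zeros_le_1D[OF *(2)]] by simp
    have "1 \<noteq> (1 :: real) \<longrightarrow> integrable M (\<lambda>\<omega>. norm (z \<omega>) ^ 8)" by simp
    note main[OF zero_le_one order_refl ident *(1) this]
    \<comment> \<open>Stated for arbitrary reals, the identity rewrites the general quotient under
      the binders, where the common factor 3 cancels.\<close>
    moreover have "(3 * 1 * (s * a) + 4 * (1 - 1) * (s * b)) / (3 * 1 * g + 4 * (1 - 1) * h) = s * a / g"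
      for s a b g h :: real by simp
    ultimately show "?Q 1 (\<lambda>k l n \<omega>. sqrt (real n) * psi1_hat \<gamma> (\<lambda>i. Z i \<omega>) n k l / ((\<gamma> k)\<^sup>2 + (\<gamma> l)\<^sup>2))"
      by (simp only:)
  next
    assume *: "integrable M (\<lambda>\<omega>. norm (z \<omega>) ^ 8)" "card {k. \<kappa> k = 0} \<le> 1"
    have "\<forall>k l. k \<noteq> l \<longrightarrow> 0 < 0 * ((\<gamma> k)\<^sup>2 + (\<gamma> l)\<^sup>2) + (1 - 0) * ((\<kappa> k)\<^sup>2 + (\<kappa> l)\<^sup>2)"
      using sq[OF card_zeros_le_1D[OF *(2)]] by simp
    note main[OF order_refl zero_le_one this int6[OF *(1)] impI[OF *(1)]]
    moreover have "(3 * 0 * (s * a) + 4 * (1 - 0) * (s * b)) / (3 * 0 * g + 4 * (1 - 0) * h) = s * b / h"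
      for s a b g h :: real by simp
    ultimately show "?Q 0 (\<lambda>k l n \<omega>. sqrt (real n) * psi2_hat \<gamma> \<beta> \<kappa> (\<lambda>i. Z i \<omega>) n k l / ((\<kappa> k)\<^sup>2 + (\<kappa> l)\<^sup>2))"
      by (simp only:)
  next
    fix \<alpha> :: real
    assume \<alpha>: "\<alpha> \<in> {0..1}" and int8: "integrable M (\<lambda>\<omega>. norm (z \<omega>) ^ 8)"
      and c: "card {k. \<gamma> k = 0 \<and> \<kappa> k = 0} \<le> 1"
      and c1: "\<alpha> = 1 \<longrightarrow> card {k. \<gamma> k = 0} \<le> 1" and c0: "\<alpha> = 0 \<longrightarrow> card {k. \<kappa> k = 0} \<le> 1"
    have ident: "0 < \<alpha> * ((\<gamma> k)\<^sup>2 + (\<gamma> l)\<^sup>2) + (1 - \<alpha>) * ((\<kappa> k)\<^sup>2 + (\<kappa> l)\<^sup>2)" if "k \<noteq> l" for k l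
    proof -
      \<comment> \<open>In the interior both criteria have positive weight, so a nonzero moment of
        either kind at \<open>k\<close> or \<open>l\<close> suffices; at the endpoints it has to be
        of the right kind, as \<open>c1\<close> and \<open>c0\<close> provide.\<close>
      consider "\<alpha> = 1" | "\<alpha> = 0" | "0 < \<alpha>" "\<alpha> < 1" using \<alpha> by fastforce
      then show ?thesis
      proof cases
        case 3
        then have "(\<gamma> k \<noteq> 0 \<or> \<gamma> l \<noteq> 0) \<or> (\<kappa> k \<noteq> 0 \<or> \<kappa> l \<noteq> 0)"
          using card_zeros_le_1D[OF c that] by blast
        then show ?thesis
        proof
          assume "\<gamma> k \<noteq> 0 \<or> \<gamma> l \<noteq> 0"
          then show ?thesis using 3 by (intro add_pos_nonneg mult_pos_pos sq) auto
        next
          assume "\<kappa> k \<noteq> 0 \<or> \<kappa> l \<noteq> 0"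
          then show ?thesis using 3 by (intro add_nonneg_pos mult_pos_pos sq) auto
        qed
      qed (use c0 c1 sq card_zeros_le_1D[OF _ that] in auto)
    qed
    show "?Q \<alpha> (?r \<alpha>)"
      using \<alpha> ident int8 int6[OF int8] by (intro main) simp_all
  qed
qed

end
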